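(* Let $K(u,v)$, $H(u,v)$ be smooth real functions in a neighbourhood $D$ of a point $(u_0,v_0)\in\mathbb R^2$, with $K>0$ and $K-H^2>0$ in $D$. Define $a=\frac{H}{\sqrt{K-H^2}}$. Let $(\Phi,\Psi)$ be the solution of the PDE system $$ \Phi_v=-\frac1{4K}\left(K_v\Phi+aK_u\Psi\right),\qquad \Psi_u=\frac1{4K}\left(aK_v\Phi-K_u\Psi\right) $$ with initial conditions $$ \Phi(u,v_0)=\exp\left(\int_{u_0}^u\left(a(\log\sqrt[4]{K})_v-(\log\sqrt[4]{K})_u\right)(t,v_0)\,dt-\log\sqrt[4]{K}(u_0,v_0)\right), $$ $$ \Psi(u_0,v)=\exp\left(\int_{v_0}^v\left(-(\log\sqrt[4]{K})_v-a(\log\sqrt[4]{K})_u\right)(u_0,s)\,ds-\log\sqrt[4]{K}(u_0,v_0)\right). $$ If the equation $$ \frac1{\Phi\Psi}\left(\frac{a_{uv}}{1+a^2}-\frac{a\,a_ua_v}{(1+a^2)^2}-\frac{aK_uK_v}{8K^2}\right)-\frac{a\,a_uK_u}{4(1+a^2)K\Phi^2}+\frac{a\,a_vK_v}{4(1+a^2)K\Psi^2}+\frac{(K_u)^2}{16\Phi^2K^2}-\frac{(K_v)^2}{16\Psi^2K^2}-\frac1{4\Phi}\left(\frac{K_u}{\Phi K}\right)_u+\frac1{4\Psi}\left(\frac{K_v}{\Psi K}\right)_v+K=0 $$ is satisfied, then there exists a unique (up to a motion) time-like surface $z=z(u,v)$ in $\mathbb R^3_1$, defined in a neighbourhood of $(u_0,v_0)$,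 for which $(u,v)$ are canonical asymptotic parameters (about $(u_0,v_0)$) and whose Gauss curvature is $K$ and mean curvature is $H$.
   Context: $\mathbb R^3_1$ is $\mathbb R^3$ with the scalar product $\langle x,y\rangle=x_1y_1+x_2y_2-x_3y_3$; write $x^2=\langle x,x\rangle$. A (smooth, regular, parametrized) surface $z=z(u,v)$ in $\mathbb R^3_1$ is time-like if its normal vector is space-like ($\langle\cdot,\cdot\rangle>0$) at every point. Let $E=z_u^2$, $F=\langle z_u,z_v\rangle$, $G=z_v^2$; let $n$ be the unit normal ($n^2=1$) such that $\{z_u,z_v,n\}$ is positively oriented; let $L=\langle n,z_{uu}\rangle$, $M=\langle n,z_{uv}\rangle$, $N=\langle n,z_{vv}\rangle$. The Gauss and mean curvatures are $K=\frac{LN-M^2}{EG-F^2}$ and $H=\frac{EN-2FM+GL}{2(EG-F^2)}$. The parameters $(u,v)$ are asymptotic if $L=N=0$. The surfaces considered are time-like with $K-H^2>0$, and asymptotic parameters are always taken so that $E>0$, $G<0$. In such parameters put $$ a=\frac{F}{\sqrt E\sqrt{-G}},\qquad \alpha=\frac{M}{\sqrt E\sqrt{-G}},\qquad f=\tfrac12\left(\log\sqrt{1+a^2}-\log|\alpha|\right). $$ Then $K=\frac{\alpha^2}{1+a^2}$, $H=\frac{a\alpha}{1+a^2}$, $f=-\log\sqrt[4]{K}$; the sign is normalized by $\alpha>0$ (i.e. $M>0$), so that $a=\frac{H}{\sqrt{K-H^2}}$ and $\alpha=\frac{K}{\sqrt{K-H^2}}$. The asymptotic parameters $(u,v)$ (on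 an open rectangle containing $(u_0,v_0)$) are called canonical asymptotic parameters about $(u_0,v_0)$ if $$ \sqrt E=\exp\left(\int_{v_0}^v\left(f_v+af_u\frac{\sqrt{-G}}{\sqrt E}\right)(u,s)\,ds+\int_{u_0}^u\left(-af_v\frac{\sqrt E}{\sqrt{-G}}+f_u\right)(t,v_0)\,dt+f(u_0,v_0)\right), $$ $$ \sqrt{-G}=\exp\left(\int_{u_0}^u\left(-af_v\frac{\sqrt E}{\sqrt{-G}}+f_u\right)(t,v)\,dt+\int_{v_0}^v\left(f_v+af_u\frac{\sqrt{-G}}{\sqrt E}\right)(u_0,s)\,ds+f(u_0,v_0)\right). $$ The statement is local: $D$ may be replaced by a smaller neighbourhood of $(u_0,v_0)$, e.g. an open rectangle on which $\Phi,\Psi>0$, and the surface is defined on a possibly smaller neighbourhood; uniqueness is among time-like surfaces in $\mathbb R^3_1$ with $K-H^2>0$, $E>0$, $G<0$ and $\alpha>0$, parametrized by $(u,v)$ as canonical asymptotic parameters (on a common connected neighbourhood). A motion is a map $p\mapsto Ap+b$ where $A$ is a linear isometry of $\mathbb R^3_1$ with $\det A=1$. *)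

theory Defs
  imports "HOL-Analysis.Analysis"
begin

text \<open>Functions of the two parameters \<open>(u, v)\<close> are total functions on \<^typ>\<open>real \<times> real\<close>; only their
  values on the set under consideration matter. All sets below on which derivatives are taken are
  open.\<close>

definition Du :: "(real \<times> real \<Rightarrow> 'a::real_normed_vector) \<Rightarrow> real \<times> real \<Rightarrow> 'a" where
  "Du g p = vector_derivative (\<lambda>t. g (t, snd p)) (at (fst p))"

definition Dv :: "(real \<times> real \<Rightarrow> 'a::real_normed_vector) \<Rightarrow> real \<times> real \<Rightarrow> 'a" where
  "Dv g p = vector_derivative (\<lambda>t. g (fst p, t)) (at (snd p))"

primrec Ck_on :: "nat \<Rightarrow> (real \<times> real) set \<Rightarrow> (real \<times> real \<Rightarrow> 'a::real_normed_vector) \<Rightarrow> bool" where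
  "Ck_on 0 S g \<longleftrightarrow> continuous_on S g"
| "Ck_on (Suc k) S g \<longleftrightarrow> (\<forall>p\<in>S. g differentiable (at p)) \<and> Ck_on k S (Du g) \<and> Ck_on k S (Dv g)"

definition smooth_on :: "(real \<times> real) set \<Rightarrow> (real \<times> real \<Rightarrow> 'a::real_normed_vector) \<Rightarrow> bool" where
  "smooth_on S g \<longleftrightarrow> (\<forall>k. Ck_on k S g)"

definition open_rectangle :: "(real \<times> real) set \<Rightarrow> bool" where
  "open_rectangle W \<longleftrightarrow> (\<exists>a b. W = box a b)"


definition lorentz :: "real^3 \<Rightarrow> real^3 \<Rightarrow> real" where
  "lorentz x y = x $ 1 * y $ 1 + x $ 2 * y $ 2 - x $ 3 * y $ 3"

definition motion :: "(real^3 \<Rightarrow> real^3) \<Rightarrow> bool" where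
  "motion T \<longleftrightarrow> (\<exists>A b. linear A \<and> (\<forall>x y. lorentz (A x) (A y) = lorentz x y)
     \<and> det (matrix A) = 1 \<and> T = (\<lambda>x. A x + b))"

definition regular_on :: "(real \<times> real) set \<Rightarrow> (real \<times> real \<Rightarrow> real^3) \<Rightarrow> bool" where
  "regular_on W z \<longleftrightarrow> (\<forall>p\<in>W. Du z p \<noteq> Dv z p \<and> independent {Du z p, Dv z p})"

definition timelike_on :: "(real \<times> real) set \<Rightarrow> (real \<times> real \<Rightarrow> real^3) \<Rightarrow> bool" where
  "timelike_on W z \<longleftrightarrow> (\<forall>p\<in>W. \<forall>m. m \<noteq> 0 \<and> lorentz m (Du z p) = 0 \<and> lorentz m (Dv z p) = 0
     \<longrightarrow> lorentz m m > 0)"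

definition timelike_surface :: "(real \<times> real) set \<Rightarrow> (real \<times> real \<Rightarrow> real^3) \<Rightarrow> bool" where
  "timelike_surface W z \<longleftrightarrow> smooth_on W z \<and> regular_on W z \<and> timelike_on W z"

definition coefE :: "(real \<times> real \<Rightarrow> real^3) \<Rightarrow> real \<times> real \<Rightarrow> real" where
  "coefE z p = lorentz (Du z p) (Du z p)"

definition coefF :: "(real \<times> real \<Rightarrow> real^3) \<Rightarrow> real \<times> real \<Rightarrow> real" where
  "coefF z p = lorentz (Du z p) (Dv z p)"

definition coefG :: "(real \<times> real \<Rightarrow> real^3) \<Rightarrow> real \<times> real \<Rightarrow> real" where
  "coefG z p = lorentz (Dv z p) (Dv z p)"

text \<open>For a time-like regular surface the conditions below determine the vector uniquely; the sign
  is fixed by the orientation of \<open>(z\<^sub>u, z\<^sub>v, n)\<close>, i.e. by the ordinary determinant.\<close>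

definition unit_normal :: "(real \<times> real \<Rightarrow> real^3) \<Rightarrow> real \<times> real \<Rightarrow> real^3" where
  "unit_normal z p = (THE n. lorentz n n = 1 \<and> lorentz n (Du z p) = 0 \<and> lorentz n (Dv z p) = 0
     \<and> det (vector [Du z p, Dv z p, n] :: real^3^3) > 0)"

definition coefL :: "(real \<times> real \<Rightarrow> real^3) \<Rightarrow> real \<times> real \<Rightarrow> real" where
  "coefL z p = lorentz (unit_normal z p) (Du (Du z) p)"

definition coefM :: "(real \<times> real \<Rightarrow> real^3) \<Rightarrow> real \<times> real \<Rightarrow> real" where
  "coefM z p = lorentz (unit_normal z p) (Dv (Du z) p)"

definition coefN :: "(real \<times> real \<Rightarrow> real^3) \<Rightarrow> real \<times> real \<Rightarrow> real" where
  "coefN z p = lorentz (unit_normal z p) (Dv (Dv z) p)"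

definition gauss_curv :: "(real \<times> real \<Rightarrow> real^3) \<Rightarrow> real \<times> real \<Rightarrow> real" where
  "gauss_curv z p = (coefL z p * coefN z p - (coefM z p)\<^sup>2)
     / (coefE z p * coefG z p - (coefF z p)\<^sup>2)"

definition mean_curv :: "(real \<times> real \<Rightarrow> real^3) \<Rightarrow> real \<times> real \<Rightarrow> real" where
  "mean_curv z p = (coefE z p * coefN z p - 2 * coefF z p * coefM z p + coefG z p * coefL z p)
     / (2 * (coefE z p * coefG z p - (coefF z p)\<^sup>2))"

definition surf_a :: "(real \<times> real \<Rightarrow> real^3) \<Rightarrow> real \<times> real \<Rightarrow> real" where
  "surf_a z p = coefF z p / (sqrt (coefE z p) * sqrt (- coefG z p))"

definition surf_alpha :: "(real \<times> real \<Rightarrow> real^3) \<Rightarrow> real \<times> real \<Rightarrow> real" where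
  "surf_alpha z p = coefM z p / (sqrt (coefE z p) * sqrt (- coefG z p))"

definition surf_f :: "(real \<times> real \<Rightarrow> real^3) \<Rightarrow> real \<times> real \<Rightarrow> real" where
  "surf_f z p = (1/2) * (ln (sqrt (1 + (surf_a z p)\<^sup>2)) - ln \<bar>surf_alpha z p\<bar>)"

text \<open>Asymptotic parameters together with the standing normalizations \<open>K - H\<^sup>2 > 0\<close>,
  \<open>E > 0\<close>, \<open>G < 0\<close> and \<open>\<alpha> > 0\<close>.\<close>

definition asymptotic_on :: "(real \<times> real) set \<Rightarrow> (real \<times> real \<Rightarrow> real^3) \<Rightarrow> bool" where
  "asymptotic_on W z \<longleftrightarrow> (\<forall>p\<in>W. coefL z p = 0 \<and> coefN z p = 0
     \<and> gauss_curv z p - (mean_curv z p)\<^sup>2 > 0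
     \<and> coefE z p > 0 \<and> coefG z p < 0 \<and> surf_alpha z p > 0)"

text \<open>The integrands \<open>f\<^sub>v + a f\<^sub>u \<surd>(-G)/\<surd>E\<close> (integrated in \<open>v\<close>) and \<open>f\<^sub>u - a f\<^sub>v \<surd>E/\<surd>(-G)\<close>
  (integrated in \<open>u\<close>).\<close>

definition canon_v :: "(real \<times> real \<Rightarrow> real^3) \<Rightarrow> real \<times> real \<Rightarrow> real" where
  "canon_v z p = Dv (surf_f z) p
     + surf_a z p * Du (surf_f z) p * (sqrt (- coefG z p) / sqrt (coefE z p))"

definition canon_u :: "(real \<times> real \<Rightarrow> real^3) \<Rightarrow> real \<times> real \<Rightarrow> real" where
  "canon_u z p = - (surf_a z p * Dv (surf_f z) p * (sqrt (coefE z p) / sqrt (- coefG z p)))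
     + Du (surf_f z) p"

text \<open>The interval integral \<open>LBINT x=a..b. h x\<close> is oriented, so the upper limit may lie below the
  base point.\<close>

definition canonical_asymptotic_on ::
  "(real \<times> real) set \<Rightarrow> real \<Rightarrow> real \<Rightarrow> (real \<times> real \<Rightarrow> real^3) \<Rightarrow> bool" where
  "canonical_asymptotic_on W u0 v0 z \<longleftrightarrow> open_rectangle W \<and> (u0, v0) \<in> W \<and> asymptotic_on W z
     \<and> (\<forall>u v. (u, v) \<in> W \<longrightarrow>
          sqrt (coefE z (u, v)) =
            exp ((LBINT s=v0..v. canon_v z (u, s)) + (LBINT t=u0..u. canon_u z (t, v0))
                 + surf_f z (u0, v0))
        \<and> sqrt (- coefG z (u, v)) =
            exp ((LBINT t=u0..u. canon_u z (t, v)) + (LBINT s=v0..v. canon_v z (u0, s))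
                 + surf_f z (u0, v0)))"

definition canonical_surface_with_curvatures ::
  "(real \<times> real) set \<Rightarrow> real \<Rightarrow> real \<Rightarrow> (real \<times> real \<Rightarrow> real) \<Rightarrow> (real \<times> real \<Rightarrow> real) \<Rightarrow>
   (real \<times> real \<Rightarrow> real^3) \<Rightarrow> bool" where
  "canonical_surface_with_curvatures W u0 v0 K H z \<longleftrightarrow>
     timelike_surface W z \<and> canonical_asymptotic_on W u0 v0 z
     \<and> (\<forall>p\<in>W. gauss_curv z p = K p \<and> mean_curv z p = H p)"

end

(* Write Phi = sqrt E, Psi = sqrt (-G), w = sqrt (1 + a^2), f = - log (K^(1/4)). A time-like surface with
   L = N = 0 carries the Lorentzian orthonormal frame e1 = z_u / Phi, e2 = (z_v / Psi - a e1) / w, n, and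
   its structure equations

     e1_u = p e2,           e2_u = p e1 + r n,   n_u = r e2,
     e1_v = q e2 + m n,     e2_v = q e1 + k n,   n_v = k e2 - m e1

   have the coefficients p = w f_v Phi / Psi - a_u / w, q = w f_u Psi / Phi, r = sqrt K Phi,
   m = w sqrt K Psi, k = - a sqrt K Psi. The PDE system for (Phi, Psi) yields the Codazzi equations
   and the closedness of dz, and the long equation is the Gauss equation, so the
   total linear system for (z, e1, e2, n) is integrable and can be solved locally. The initial
   conditions force Phi = Psi on both coordinate axes; there the ratio Phi / Psi in the definition of
   canonical parameters drops out, and both integrands are logarithmic derivatives, so the parameters
   are canonical.

   Conversely, for a surface in canonical parameters (Phi, Psi) solves a linear Goursat problem
   determined by K and H alone. Hence two such surfaces have the same structure equations, and the
   linear map between their frames is constant. *)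
theory Submission
  imports Defs
begin

subsection \<open>Partial derivatives and the classes \<open>C\<^sup>k\<close>\<close>

text \<open>The contraction that solves the total system builds in only half of it: the
  \<open>v\<close>-equation everywhere and the \<open>u\<close>-equation on one edge. Carrying the
  \<open>u\<close>-equation into the interior is what integrability is for, and this is where the
  Gauss and Codazzi equations are consumed. The solution is at first known only to be
  differentiable; smoothness is recovered from the system itself. The Gram products of a moving
  frame satisfy coupled linear equations. The equivalent completeness relation has identically
  vanishing derivative instead, so orthonormality propagates by mere constancy. For uniqueness the
  obstacle is that the canonical integrands contain the ratio of the very functions they define.
  Differentiating the exponentials multiplies each integrand by the function in its denominator,
  which leaves a linear system with coefficients made of \<open>K\<close> and \<open>a\<close>. A
  weighted sup norm then compares two surfaces on the whole of their common rectangle, not only near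
  the base point.\<close>

lemma has_derivative_imp_partials:
  assumes "(g has_derivative g') (at (u, v))"
  shows "((\<lambda>t. g (t, v)) has_vector_derivative g' (1, 0)) (at u)"
    and "((\<lambda>t. g (u, t)) has_vector_derivative g' (0, 1)) (at v)"
proof -
  interpret bounded_linear g' using assms by (rule has_derivative_bounded_linear)
  have "((\<lambda>t. g (t, v)) has_derivative (\<lambda>h. g' (h, 0))) (at u)"
    by (rule has_derivative_compose[of "\<lambda>t. (t, v)" _ u UNIV g g'])
       (use assms in \<open>auto intro!: derivative_eq_intros\<close>)
  moreover have "(\<lambda>h. g' (h, 0)) = (\<lambda>h. h *\<^sub>R g' (1, 0))" by (simp flip: scaleR)
  ultimately show "((\<lambda>t. g (t, v)) has_vector_derivative g' (1, 0)) (at u)"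
    by (metis has_vector_derivative_def)
  have "((\<lambda>t. g (u, t)) has_derivative (\<lambda>h. g' (0, h))) (at v)"
    by (rule has_derivative_compose[of "\<lambda>t. (u, t)" _ v UNIV g g'])
       (use assms in \<open>auto intro!: derivative_eq_intros\<close>)
  moreover have "(\<lambda>h. g' (0, h)) = (\<lambda>h. h *\<^sub>R g' (0, 1))" by (simp flip: scaleR)
  ultimately show "((\<lambda>t. g (u, t)) has_vector_derivative g' (0, 1)) (at v)"
    by (metis has_vector_derivative_def)
qed

lemma Du_eqI: "((\<lambda>t. g (t, snd p)) has_vector_derivative d) (at (fst p)) \<Longrightarrow> Du g p = d"
  unfolding Du_def by (rule vector_derivative_at)

lemma Dv_eqI: "((\<lambda>t. g (fst p, t)) has_vector_derivative d) (at (snd p)) \<Longrightarrow> Dv g p = d"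
  unfolding Dv_def by (rule vector_derivative_at)

lemma has_derivative_Du: "(g has_derivative g') (at p) \<Longrightarrow> Du g p = g' (1, 0)"
  by (rule Du_eqI, rule has_derivative_imp_partials) simp

lemma has_derivative_Dv: "(g has_derivative g') (at p) \<Longrightarrow> Dv g p = g' (0, 1)"
  by (rule Dv_eqI, rule has_derivative_imp_partials) simp

lemma differentiable_partials:
  assumes "g differentiable (at p)"
  shows "(g has_derivative (\<lambda>h. fst h *\<^sub>R Du g p + snd h *\<^sub>R Dv g p)) (at p)"
    and "((\<lambda>t. g (t, snd p)) has_vector_derivative Du g p) (at (fst p))"
    and "((\<lambda>t. g (fst p, t)) has_vector_derivative Dv g p) (at (snd p))"
proof -
  obtain g' where g': "(g has_derivative g') (at p)" using assms by (auto simp: differentiable_def)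
  interpret bounded_linear g' using g' by (rule has_derivative_bounded_linear)
  have "g' = (\<lambda>h. fst h *\<^sub>R g' (1, 0) + snd h *\<^sub>R g' (0, 1))"
    by (simp flip: scaleR add)
  then have "g' = (\<lambda>h. fst h *\<^sub>R Du g p + snd h *\<^sub>R Dv g p)"
    by (simp only: has_derivative_Du[OF g'] has_derivative_Dv[OF g'])
  with g' show "(g has_derivative (\<lambda>h. fst h *\<^sub>R Du g p + snd h *\<^sub>R Dv g p)) (at p)" by simp
  from has_derivative_imp_partials[of g _ "fst p" "snd p"] this
  show "((\<lambda>t. g (t, snd p)) has_vector_derivative Du g p) (at (fst p))"
       "((\<lambda>t. g (fst p, t)) has_vector_derivative Dv g p) (at (snd p))"
    by fastforce+
qed

lemma eventually_line_in_open:
  assumes "open S" "p \<in> S"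
  shows "eventually (\<lambda>t. (t, snd p) \<in> S) (nhds (fst p))"
    and "eventually (\<lambda>t. (fst p, t) \<in> S) (nhds (snd p))"
proof -
  have "open ((\<lambda>t. (t, snd p)) -` S)" "open ((\<lambda>t. (fst p, t)) -` S)"
    by (intro open_vimage assms continuous_intros)+
  with assms show "eventually (\<lambda>t. (t, snd p) \<in> S) (nhds (fst p))"
    "eventually (\<lambda>t. (fst p, t) \<in> S) (nhds (snd p))"
    by (auto simp: eventually_nhds)
qed

lemma Du_Dv_cong:
  assumes "open S" "p \<in> S" "\<And>q. q \<in> S \<Longrightarrow> f q = g q"
  shows "Du f p = Du g p" "Dv f p = Dv g p"
  unfolding Du_def Dv_def
  by (rule vector_derivative_cong_eq;
      use eventually_line_in_open[OF assms(1,2)] assms(3) in \<open>auto elim!: eventually_mono\<close>)+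

lemma differentiable_cong_open:
  assumes "open S" "p \<in> S" "\<And>q. q \<in> S \<Longrightarrow> f q = g q" "f differentiable (at p)"
  shows "g differentiable (at p)"
  using assms has_derivative_transform_within_open[of f _ p UNIV S g]
  unfolding differentiable_def by auto

text \<open>Formulas for \<open>Du\<close> and \<open>Dv\<close> are available only at points of
  \<open>S\<close>. Openness turns equality on \<open>S\<close> into equality of germs, so the class
  of the formula passes to the derivative itself at every order.\<close>

lemma Ck_on_cong:
  assumes "open S" "\<And>q. q \<in> S \<Longrightarrow> f q = g q" "Ck_on k S f"
  shows "Ck_on k S g"
  using assms(2,3)
proof (induction k arbitrary: f g)
  case 0
  then show ?case using continuous_on_cong[of S S f g] by simp
next
  case (Suc k)
  have "Ck_on k S (Du g)" 
  proof (rule Suc.IH[of "Du f"])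
    show "Du f q = Du g q" if "q \<in> S" for q
      by (rule Du_Dv_cong(1)[OF assms(1) that Suc.prems(1)])
  qed (use Suc.prems in simp)
  moreover have "Ck_on k S (Dv g)" 
  proof (rule Suc.IH[of "Dv f"])
    show "Dv f q = Dv g q" if "q \<in> S" for q
      by (rule Du_Dv_cong(2)[OF assms(1) that Suc.prems(1)])
  qed (use Suc.prems in simp)
  ultimately show ?case using Suc.prems differentiable_cong_open[OF assms(1), of _ f g] by auto
qed

lemma differentiable_at_imp_continuous_on:
  "(\<And>p. p \<in> S \<Longrightarrow> f differentiable (at p)) \<Longrightarrow> continuous_on S f"
  by (meson differentiable_imp_continuous_on differentiable_on_def differentiable_at_withinI)

lemma Ck_on_SucD: "Ck_on (Suc k) S f \<Longrightarrow> Ck_on k S f"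
proof (induction k arbitrary: f)
  case 0
  then show ?case by (simp add: differentiable_at_imp_continuous_on)
next
  case (Suc k)
  have "Ck_on (Suc k) S (Du f)" "Ck_on (Suc k) S (Dv f)" "\<forall>p\<in>S. f differentiable (at p)"
    using Suc.prems Ck_on.simps(2)[of "Suc k" S f] by blast+
  then show ?case using Suc.IH[of "Du f"] Suc.IH[of "Dv f"] Ck_on.simps(2)[of k S f] by blast
qed

lemma Ck_on_subset: "Ck_on k S f \<Longrightarrow> T \<subseteq> S \<Longrightarrow> Ck_on k T f"
  by (induction k arbitrary: f) (auto intro: continuous_on_subset)

lemma Ck_on_const: "Ck_on k S (\<lambda>_. c)"
proof (induction k arbitrary: c)
  case (Suc k)
  have "Du (\<lambda>_. c) = (\<lambda>_. 0)" "Dv (\<lambda>_. c) = (\<lambda>_. 0)" by (auto simp: Du_def Dv_def)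
  then show ?case using Suc by simp
qed simp

lemma Ck_on_add:
  assumes "open S" "Ck_on k S f" "Ck_on k S g"
  shows "Ck_on k S (\<lambda>p. f p + g p)"
  using assms(2,3)
proof (induction k arbitrary: f g)
  case (Suc k)
  have D: "((\<lambda>p. f p + g p) has_derivative (\<lambda>h. (fst h *\<^sub>R Du f p + snd h *\<^sub>R Dv f p)
      + (fst h *\<^sub>R Du g p + snd h *\<^sub>R Dv g p))) (at p)" if "p \<in> S" for p
    using that Suc.prems by (intro has_derivative_add differentiable_partials) auto
  have "Ck_on k S (Du (\<lambda>p. f p + g p))"
    by (rule Ck_on_cong[OF assms(1), of "\<lambda>p. Du f p + Du g p"])
       (use has_derivative_Du[OF D] Suc in auto)
  moreover have "Ck_on k S (Dv (\<lambda>p. f p + g p))"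
    by (rule Ck_on_cong[OF assms(1), of "\<lambda>p. Dv f p + Dv g p"])
       (use has_derivative_Dv[OF D] Suc in auto)
  ultimately show ?case using D by (auto simp: differentiable_def)
qed (auto intro: continuous_intros)

text \<open>Proved once for every bounded bilinear map: the instances used are multiplication,
  scaling, application of a bounded linear operator, the Lorentz product and the Lorentz cross
  product. The product rule needs the factors themselves in class \<open>k\<close>, which
  \<open>Ck_on_SucD\<close> supplies.\<close>

lemma (in bounded_bilinear) Ck_on_prod:
  assumes "open S" "Ck_on k S f" "Ck_on k S g"
  shows "Ck_on k S (\<lambda>p. prod (f p) (g p))"
  using assms(2,3)
proof (induction k arbitrary: f g)
  case (Suc k)
  have D: "((\<lambda>p. prod (f p) (g p)) has_derivative (\<lambda>h. prod (f p) (fst h *\<^sub>R Du g p + snd h *\<^sub>R Dv g p)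
      + prod (fst h *\<^sub>R Du f p + snd h *\<^sub>R Dv f p) (g p))) (at p)" if "p \<in> S" for p
    using that Suc.prems by (intro FDERIV differentiable_partials) auto
  note C = Suc.prems[THEN Ck_on_SucD]
  have "Ck_on k S (Du (\<lambda>p. prod (f p) (g p)))"
    by (rule Ck_on_cong[OF assms(1), of "\<lambda>p. prod (f p) (Du g p) + prod (Du f p) (g p)"])
       (use has_derivative_Du[OF D] Suc C in \<open>auto intro!: Ck_on_add[OF assms(1)]\<close>)
  moreover have "Ck_on k S (Dv (\<lambda>p. prod (f p) (g p)))"
    by (rule Ck_on_cong[OF assms(1), of "\<lambda>p. prod (f p) (Dv g p) + prod (Dv f p) (g p)"])
       (use has_derivative_Dv[OF D] Suc C in \<open>auto intro!: Ck_on_add[OF assms(1)]\<close>)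
  ultimately show ?case using D by (auto simp: differentiable_def)
qed (auto intro: continuous_on)

lemmas Ck_on_mult = bounded_bilinear.Ck_on_prod[OF bounded_bilinear_mult]
lemmas Ck_on_scaleR = bounded_bilinear.Ck_on_prod[OF bounded_bilinear_scaleR]
lemmas Ck_on_blinfun_apply = bounded_bilinear.Ck_on_prod[OF bounded_bilinear_blinfun_apply]

lemma Ck_on_bounded_linear:
  assumes "bounded_linear L" "open S" "Ck_on k S f"
  shows "Ck_on k S (\<lambda>p. L (f p))"
  using assms(3)
proof (induction k arbitrary: f)
  case (Suc k)
  have D: "((\<lambda>p. L (f p)) has_derivative (\<lambda>h. L (fst h *\<^sub>R Du f p + snd h *\<^sub>R Dv f p))) (at p)"
    if "p \<in> S" for p
    using that Suc.prems by (intro bounded_linear.has_derivative[OF assms(1)] differentiable_partials) auto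
  have "Ck_on k S (Du (\<lambda>p. L (f p)))"
    by (rule Ck_on_cong[OF assms(2), of "\<lambda>p. L (Du f p)"])
       (use has_derivative_Du[OF D] Suc in auto)
  moreover have "Ck_on k S (Dv (\<lambda>p. L (f p)))"
    by (rule Ck_on_cong[OF assms(2), of "\<lambda>p. L (Dv f p)"])
       (use has_derivative_Dv[OF D] Suc in auto)
  ultimately show ?case using D by (auto simp: differentiable_def)
qed (simp add: bounded_linear.continuous_on[OF assms(1)])

text \<open>Premise \<open>step\<close> feeds an induction on \<open>k\<close>: for \<open>inverse\<close> and \<open>sqrt\<close> the derivative \<open>h'\<close> is itself
  a polynomial expression in \<open>h\<close> and \<open>inverse\<close>.\<close>

lemma Ck_on_compose_real:
  fixes f :: "real \<times> real \<Rightarrow> real" and h h' :: "real \<Rightarrow> real"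
  assumes "open S" and h: "\<And>p. p \<in> S \<Longrightarrow> (h has_real_derivative h' (f p)) (at (f p))"
    and step: "\<And>k. Ck_on k S f \<Longrightarrow> Ck_on k S (\<lambda>p. h (f p)) \<Longrightarrow> Ck_on k S (\<lambda>p. h' (f p))"
    and "Ck_on k S f"
  shows "Ck_on k S (\<lambda>p. h (f p))"
  using assms(4)
proof (induction k)
  case 0
  have "isCont h (f p)" if "p \<in> S" for p using h[OF that] by (rule DERIV_isCont)
  moreover have "isCont f p" if "p \<in> S" for p
    using 0 that assms(1) by (auto simp: continuous_on_eq_continuous_at)
  ultimately show ?case
    by (simp add: continuous_on_eq_continuous_at[OF assms(1)] isCont_o2)
next
  case (Suc k)
  have D: "((\<lambda>p. h (f p)) has_derivative (\<lambda>d. h' (f p) * (fst d *\<^sub>R Du f p + snd d *\<^sub>R Dv f p))) (at p)"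
    if "p \<in> S" for p
    using that Suc.prems
    by (intro has_derivative_compose[OF differentiable_partials(1) h[unfolded has_field_derivative_def]]) auto
  note C = step[OF Ck_on_SucD[OF Suc.prems] Suc.IH[OF Ck_on_SucD[OF Suc.prems]]]
  have "Ck_on k S (Du (\<lambda>p. h (f p)))"
    by (rule Ck_on_cong[OF assms(1), of "\<lambda>p. h' (f p) * Du f p"])
       (use has_derivative_Du[OF D] Suc C in \<open>auto intro!: Ck_on_mult[OF assms(1)]\<close>)
  moreover have "Ck_on k S (Dv (\<lambda>p. h (f p)))"
    by (rule Ck_on_cong[OF assms(1), of "\<lambda>p. h' (f p) * Dv f p"])
       (use has_derivative_Dv[OF D] Suc C in \<open>auto intro!: Ck_on_mult[OF assms(1)]\<close>)
  ultimately show ?case using D by (auto simp: differentiable_def)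
qed

section \<open>Closure properties of smooth functions and rules for their partial
  derivatives\<close>

lemma smooth_on_const: "smooth_on S (\<lambda>_. c)" by (simp add: smooth_on_def Ck_on_const)

lemma smooth_on_subset: "smooth_on S f \<Longrightarrow> T \<subseteq> S \<Longrightarrow> smooth_on T f"
  by (auto simp: smooth_on_def intro: Ck_on_subset)

lemma smooth_on_add: "open S \<Longrightarrow> smooth_on S f \<Longrightarrow> smooth_on S g \<Longrightarrow> smooth_on S (\<lambda>p. f p + g p)"
  by (simp add: smooth_on_def Ck_on_add)

lemma smooth_on_mult:
  "open S \<Longrightarrow> smooth_on S f \<Longrightarrow> smooth_on S g \<Longrightarrow> smooth_on S (\<lambda>p. f p * g p :: 'a :: real_normed_algebra)"
  by (simp add: smooth_on_def Ck_on_mult)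

lemma smooth_on_scaleR:
  "open S \<Longrightarrow> smooth_on S f \<Longrightarrow> smooth_on S g \<Longrightarrow> smooth_on S (\<lambda>p. f p *\<^sub>R g p)"
  by (simp add: smooth_on_def Ck_on_scaleR)

lemma smooth_on_minus: "open S \<Longrightarrow> smooth_on S f \<Longrightarrow> smooth_on S (\<lambda>p. - f p)"
  unfolding smooth_on_def by (intro allI Ck_on_bounded_linear[OF bounded_linear_minus[OF bounded_linear_ident]]) auto

lemma smooth_on_diff:
  "open S \<Longrightarrow> smooth_on S f \<Longrightarrow> smooth_on S g \<Longrightarrow> smooth_on S (\<lambda>p. f p - g p)"
  using smooth_on_add[OF _ _ smooth_on_minus, of S f g] by simp

lemma smooth_on_power2:
  "open S \<Longrightarrow> smooth_on S f \<Longrightarrow> smooth_on S (\<lambda>p. (f p)\<^sup>2 :: real)"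
  unfolding power2_eq_square by (rule smooth_on_mult)

lemma smooth_on_inverse:
  fixes f :: "real \<times> real \<Rightarrow> real"
  assumes "open S" "smooth_on S f" "\<And>p. p \<in> S \<Longrightarrow> f p \<noteq> 0"
  shows "smooth_on S (\<lambda>p. inverse (f p))"
  unfolding smooth_on_def
proof
  fix k
  show "Ck_on k S (\<lambda>p. inverse (f p))"
  proof (rule Ck_on_compose_real[OF assms(1), where f = f and h = inverse and h' = "\<lambda>x. - (inverse x * inverse x)"])
    show "(inverse has_real_derivative - (inverse (f p) * inverse (f p))) (at (f p))" if "p \<in> S" for p
      using DERIV_inverse[of "f p" UNIV] assms(3)[OF that] by (simp add: power2_eq_square)
    show "Ck_on k S (\<lambda>p. - (inverse (f p) * inverse (f p)))" if "Ck_on k S (\<lambda>p. inverse (f p))" for k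
      using Ck_on_bounded_linear[OF bounded_linear_minus[OF bounded_linear_ident] assms(1)
            Ck_on_mult[OF assms(1) that that]] by simp
  qed (use assms in \<open>simp add: smooth_on_def\<close>)
qed

lemma smooth_on_divide:
  fixes f g :: "real \<times> real \<Rightarrow> real"
  assumes "open S" "smooth_on S f" "smooth_on S g" "\<And>p. p \<in> S \<Longrightarrow> g p \<noteq> 0"
  shows "smooth_on S (\<lambda>p. f p / g p)"
  unfolding divide_inverse by (intro smooth_on_mult smooth_on_inverse assms)

lemma smooth_on_sqrt:
  fixes f :: "real \<times> real \<Rightarrow> real"
  assumes "open S" "smooth_on S f" "\<And>p. p \<in> S \<Longrightarrow> f p > 0"
  shows "smooth_on S (\<lambda>p. sqrt (f p))"
  unfolding smooth_on_def
proof
  fix k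
  have inv: "smooth_on S (\<lambda>p. inverse (f p))"
    by (intro smooth_on_inverse) (use assms(1,2) less_imp_neq[OF assms(3)] in force)+
  show "Ck_on k S (\<lambda>p. sqrt (f p))"
  \<comment> \<open>The derivative \<open>1 / (2 sqrt x)\<close> is written as
    \<open>sqrt x * (1 / x * 1 / 2)\<close>, so that only \<open>sqrt\<close>, available by
    induction, and the inverse of \<open>f\<close>, already smooth, occur.\<close>
  proof (rule Ck_on_compose_real[OF assms(1), where f = f and h = sqrt and h' = "\<lambda>x. sqrt x * (inverse x * inverse 2)"])
    show "(sqrt has_real_derivative sqrt (f p) * (inverse (f p) * inverse 2)) (at (f p))"
      if "p \<in> S" for p
    proof -
      have "f p > 0" by (rule assms(3)[OF that])
      then have "inverse (sqrt (f p)) / 2 = sqrt (f p) * (inverse (f p) * inverse 2)"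
        using real_sqrt_mult_self[of "f p"] by (simp add: field_simps)
      with DERIV_real_sqrt[OF \<open>f p > 0\<close>] show ?thesis by simp
    qed
    show "Ck_on k S (\<lambda>p. sqrt (f p) * (inverse (f p) * inverse 2))"
      if "Ck_on k S (\<lambda>p. sqrt (f p))" for k
      by (intro Ck_on_mult assms(1) that Ck_on_const) (use inv in \<open>simp add: smooth_on_def\<close>)
  qed (use assms in \<open>simp add: smooth_on_def\<close>)
qed

lemma smooth_on_Du: "smooth_on S f \<Longrightarrow> smooth_on S (Du f)"
  and smooth_on_Dv: "smooth_on S f \<Longrightarrow> smooth_on S (Dv f)"
  unfolding smooth_on_def by (meson Ck_on.simps(2))+

lemma smooth_on_differentiable: "smooth_on S f \<Longrightarrow> p \<in> S \<Longrightarrow> f differentiable (at p)"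
  unfolding smooth_on_def by (meson Ck_on.simps(2))

lemma smooth_on_continuous: "smooth_on S f \<Longrightarrow> continuous_on S f"
  unfolding smooth_on_def by (metis Ck_on.simps(1))

lemma smooth_on_partials:
  assumes "smooth_on S g" "(u, v) \<in> S"
  shows "((\<lambda>t. g (t, v)) has_vector_derivative Du g (u, v)) (at u)"
    and "((\<lambda>t. g (u, t)) has_vector_derivative Dv g (u, v)) (at v)"
  using differentiable_partials(2,3)[OF smooth_on_differentiable[OF assms]] by auto

lemma smooth_on_real_partials:
  fixes g :: "real \<times> real \<Rightarrow> real"
  assumes "smooth_on S g" "(u, v) \<in> S"
  shows "((\<lambda>t. g (t, v)) has_real_derivative Du g (u, v)) (at u)"
    and "((\<lambda>t. g (u, t)) has_real_derivative Dv g (u, v)) (at v)"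
  using smooth_on_partials[OF assms] by (simp_all add: has_real_derivative_iff_has_vector_derivative)

lemma Du_real_eqI:
  "((\<lambda>t. g (t, v)) has_real_derivative d) (at u) \<Longrightarrow> Du g (u, v) = d"
  by (auto intro!: Du_eqI simp: has_real_derivative_iff_has_vector_derivative)

lemma Dv_real_eqI:
  "((\<lambda>t. g (u, t)) has_real_derivative d) (at v) \<Longrightarrow> Dv g (u, v) = d"
  by (auto intro!: Dv_eqI simp: has_real_derivative_iff_has_vector_derivative)

text \<open>Bootstrapping: both partial derivatives are smooth operators applied to
  \<open>Y\<close>, so each class reached by \<open>Y\<close> is also reached by its
  derivatives.\<close>

lemma smooth_on_total_system:
  assumes "open S" "\<And>p. p \<in> S \<Longrightarrow> Y differentiable (at p)"
    and "smooth_on S A" "smooth_on S B"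
    and "\<And>p. p \<in> S \<Longrightarrow> Du Y p = blinfun_apply (A p) (Y p)"
    and "\<And>p. p \<in> S \<Longrightarrow> Dv Y p = blinfun_apply (B p) (Y p)"
  shows "smooth_on S Y"
  unfolding smooth_on_def
proof
  fix k show "Ck_on k S Y"
  proof (induction k)
    case 0
    then show ?case using assms(2) by (simp add: differentiable_at_imp_continuous_on)
  next
    case (Suc k)
    have "Ck_on k S (Du Y)"
      by (rule Ck_on_cong[OF assms(1), of "\<lambda>p. blinfun_apply (A p) (Y p)"])
         (use assms Suc in \<open>auto intro!: Ck_on_blinfun_apply simp: smooth_on_def\<close>)
    moreover have "Ck_on k S (Dv Y)"
      by (rule Ck_on_cong[OF assms(1), of "\<lambda>p. blinfun_apply (B p) (Y p)"])
         (use assms Suc in \<open>auto intro!: Ck_on_blinfun_apply simp: smooth_on_def\<close>)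
    ultimately show ?case using assms(2) by simp
  qed
qed

subsection \<open>Linear total differential systems\<close>

text \<open>Moves the variable endpoint into the integrand. Joint continuity in the endpoint and a
  parameter then reduces to the continuity of parameter integrals over a fixed interval.\<close>

lemma integral_rescale_unit:
  fixes h :: "real \<Rightarrow> 'a::banach"
  assumes "c \<le> v" "continuous_on {c..v} h"
  shows "integral {c..v} h = (v - c) *\<^sub>R integral {0..1} (\<lambda>\<tau>. h (c + \<tau> * (v - c)))"
proof (cases "c = v")
  case False
  with assms have pos: "0 < v - c" by simp
  have "(h has_integral integral {c..v} h) (cbox c v)"
    using integrable_integral[OF integrable_continuous_real[OF assms(2)]] by simp
  from has_integral_affinity'[OF this pos, of c] pos
  have "((\<lambda>x. h ((v - c) * x + c)) has_integral integral {c..v} h /\<^sub>R (v - c)) {0..1}" by simp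
  then have "integral {0..1} (\<lambda>x. h ((v - c) * x + c)) = integral {c..v} h /\<^sub>R (v - c)"
    by (rule integral_unique)
  moreover have "(\<lambda>x. h ((v - c) * x + c)) = (\<lambda>\<tau>. h (c + \<tau> * (v - c)))" by (simp add: ac_simps)
  ultimately show ?thesis using pos by simp
qed simp

lemma continuous_on_indefinite_integral_snd:
  fixes g :: "real \<times> real \<Rightarrow> 'a::banach"
  assumes g: "continuous_on ({c1..d1} \<times> {c2..d2}) g"
  shows "continuous_on ({c1..d1} \<times> {c2..d2}) (\<lambda>p. integral {c2..snd p} (\<lambda>s. g (fst p, s)))"
proof -
  let ?Q = "{c1..d1} \<times> {c2..d2}"
  have mem: "c2 + t * (v - c2) \<in> {c2..d2}" if "v \<in> {c2..d2}" "t \<in> {0..1}" for t v :: real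
  proof -
    have "0 \<le> t * (v - c2)" "t * (v - c2) \<le> v - c2"
      using that mult_left_le_one_le[of "v - c2" t] by auto
    with that show ?thesis by auto
  qed
  have "continuous_on (?Q \<times> cbox 0 1) (\<lambda>(p, t). g (fst p, c2 + t * (snd p - c2)))"
    unfolding case_prod_beta
    by (rule continuous_on_compose2[OF g]) (use mem in \<open>auto intro!: continuous_intros\<close>)
  from integral_continuous_on_param[OF this]
  have "continuous_on ?Q (\<lambda>p. (snd p - c2) *\<^sub>R integral {0..1} (\<lambda>t. g (fst p, c2 + t * (snd p - c2))))"
    by (auto intro!: continuous_intros)
  moreover have "integral {c2..snd p} (\<lambda>s. g (fst p, s))
      = (snd p - c2) *\<^sub>R integral {0..1} (\<lambda>t. g (fst p, c2 + t * (snd p - c2)))" if "p \<in> ?Q" for p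
    using that by (intro integral_rescale_unit continuous_on_compose2[OF g]) (auto intro!: continuous_intros)
  ultimately show ?thesis using continuous_on_cong[of ?Q ?Q] by simp
qed

lemma continuous_on_indefinite_integral_fst:
  fixes g :: "real \<times> real \<Rightarrow> 'a::banach"
  assumes g: "continuous_on ({c1..d1} \<times> {c2..d2}) g"
  shows "continuous_on ({c1..d1} \<times> {c2..d2}) (\<lambda>p. integral {c1..fst p} (\<lambda>t. g (t, snd p)))"
proof -
  have "continuous_on ({c2..d2} \<times> {c1..d1}) (\<lambda>p. g (snd p, fst p))"
    by (rule continuous_on_compose2[OF g]) (auto intro!: continuous_intros)
  from continuous_on_indefinite_integral_snd[OF this]
  have "continuous_on ({c2..d2} \<times> {c1..d1}) (\<lambda>p. integral {c1..snd p} (\<lambda>s. g (s, fst p)))" by simp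
  moreover have "continuous_on ({c1..d1} \<times> {c2..d2}) (\<lambda>p. (snd p, fst p))"
    by (intro continuous_intros)
  ultimately show ?thesis
    using continuous_on_compose2[of "{c2..d2} \<times> {c1..d1}" _ "{c1..d1} \<times> {c2..d2}" "\<lambda>p. (snd p, fst p)"]
    by force
qed

text \<open>The initial value is prescribed at a corner, so that only integrals over intervals starting
  at the corner occur.\<close>

lemma linear_system_small_rectangle:
  fixes A B Av Bu :: "real \<times> real \<Rightarrow> 'b::banach \<Rightarrow>\<^sub>L 'b" and c1 d1 c2 d2 C l :: real
  defines "Q \<equiv> {c1..d1} \<times> {c2..d2}"
  assumes ord: "c1 \<le> d1" "c2 \<le> d2"
    and cont: "continuous_on Q A" "continuous_on Q B" "continuous_on Q Bu"
    and Av: "\<And>u v. (u, v) \<in> Q \<Longrightarrow> ((\<lambda>t. A (u, t)) has_vector_derivative Av (u, v)) (at v within {c2..d2})"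
    and Bu: "\<And>u v. (u, v) \<in> Q \<Longrightarrow> ((\<lambda>t. B (t, v)) has_vector_derivative Bu (u, v)) (at u within {c1..d1})"
    and flat: "\<And>p. p \<in> Q \<Longrightarrow> Av p + (A p o\<^sub>L B p) = Bu p + (B p o\<^sub>L A p)"
    and bound: "\<And>p. p \<in> Q \<Longrightarrow> norm (A p) \<le> C" "\<And>p. p \<in> Q \<Longrightarrow> norm (B p) \<le> C"
      "\<And>p. p \<in> Q \<Longrightarrow> norm (Bu p) \<le> C"
    and small: "d1 - c1 \<le> l" "d2 - c2 \<le> l" "2 * C * l \<le> 1/2" "l \<le> 1"
  obtains W where "W (c1, c2) = y0"
    and "\<And>p. p \<in> Q \<Longrightarrow> (W has_derivative (\<lambda>h. fst h *\<^sub>R A p (W p) + snd h *\<^sub>R B p (W p))) (at p within Q)"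
proof -
  have Qc: "Q = cbox (c1, c2) (d1, d2)" by (simp add: Q_def cbox_Pair_eq)
  have l0: "0 \<le> l" using small ord by linarith
  have C0: "0 \<le> C" using order_trans[OF norm_ge_zero bound(1)[of "(c1, c2)"]] ord by (simp add: Q_def)
  note app = bounded_bilinear.continuous_on[OF bounded_bilinear_blinfun_apply]
  have comp1: "continuous_on {c1..d1} (\<lambda>t. g (t, v))" if "continuous_on Q g" "v \<in> {c2..d2}"
    for g :: "real \<times> real \<Rightarrow> 'c::topological_space" and v
    by (rule continuous_on_compose2[OF that(1)]) (use that in \<open>auto simp: Q_def intro!: continuous_intros\<close>)
  have comp2: "continuous_on {c2..d2} (\<lambda>t. g (u, t))" if "continuous_on Q g" "u \<in> {c1..d1}"
    for g :: "real \<times> real \<Rightarrow> 'c::topological_space" and u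
    by (rule continuous_on_compose2[OF that(1)]) (use that in \<open>auto simp: Q_def intro!: continuous_intros\<close>)
  \<comment> \<open>Integration from the corner along the lower edge and then vertically. A fixed
    point satisfies the \<open>v\<close>-equation on all of \<open>Q\<close>, but the
    \<open>u\<close>-equation only on the edge \<open>v = c2\<close>.\<close>
  define F where "F W p = y0 + integral {c1..fst p} (\<lambda>t. A (t, c2) (W (t, c2)))
      + integral {c2..snd p} (\<lambda>s. B (fst p, s) (W (fst p, s)))" for W p
  have contF: "continuous_on Q (F W)" if W: "continuous_on Q W" for W
  proof -
    have "continuous_on Q (\<lambda>p. A (fst p, c2) (W (fst p, c2)))"
      by (rule app; rule continuous_on_compose2[of Q _ Q "\<lambda>p. (fst p, c2)"])
         (use W cont ord in \<open>auto simp: Q_def intro!: continuous_intros\<close>)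
    from continuous_on_indefinite_integral_fst[OF this[unfolded Q_def]]
      continuous_on_indefinite_integral_snd[OF app[OF cont(2) W, unfolded Q_def]]
    show ?thesis unfolding F_def Q_def by (auto intro!: continuous_intros)
  qed
  \<comment> \<open>Clamping to the rectangle extends \<open>F W\<close> to a bounded continuous
    function on the whole plane, so that the fixed point theorem can be applied in a complete space
    of such functions.\<close>
  have "\<exists>H. \<forall>p. apply_bcontfun H p = F (apply_bcontfun G) (clamp (c1, c2) (d1, d2) p)" for G
  proof -
    have "continuous_on (cbox (c1, c2) (d1, d2)) (F (apply_bcontfun G))"
      unfolding Qc[symmetric] by (rule contF) (rule continuous_on_subset[OF continuous_on_apply_bcontfun subset_UNIV])
    from continuous_on_cbox_bcontfunE[OF this] show ?thesis by metis
  qed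
  then obtain T where T: "apply_bcontfun (T G) p = F (apply_bcontfun G) (clamp (c1, c2) (d1, d2) p)" for G p
    by metis
  \<comment> \<open>Two path segments of length at most \<open>l\<close> and operators of norm at
    most \<open>C\<close> give the Lipschitz constant \<open>2 * C * l\<close>.\<close>
  have "dist (T G) (T H) \<le> 1/2 * dist G H" for G H
  proof (rule dist_bound)
    fix p
    obtain u v where q: "clamp (c1, c2) (d1, d2) p = (u, v)" by fastforce
    have "(u, v) \<in> Q" unfolding Qc q[symmetric] by (rule clamp_in_interval) (use ord in \<open>auto simp: Basis_prod_def\<close>)
    then have uv: "u \<in> {c1..d1}" "v \<in> {c2..d2}" by (auto simp: Q_def)
    have cG: "continuous_on Q (apply_bcontfun G)" for G :: "(real \<times> real) \<Rightarrow>\<^sub>C 'b"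
      by (rule continuous_on_subset[OF continuous_on_apply_bcontfun subset_UNIV])
    have sub: "{c1..u} \<subseteq> {c1..d1}" "{c2..v} \<subseteq> {c2..d2}" using uv by auto
    have c2: "c2 \<in> {c2..d2}" using ord by simp
    note i1 = continuous_on_subset[OF comp1[OF app[OF cont(1) cG] c2] sub(1)]
    note i2 = continuous_on_subset[OF comp2[OF app[OF cont(2) cG] uv(1)] sub(2)]
    have est: "norm (blinfun_apply (E q) (apply_bcontfun G q) - blinfun_apply (E q) (apply_bcontfun H q)) \<le> C * dist G H"
      if "norm (E q) \<le> C" for E :: "real \<times> real \<Rightarrow> 'b \<Rightarrow>\<^sub>L 'b" and q
    proof -
      have "norm (E q (apply_bcontfun G q - apply_bcontfun H q)) \<le> norm (E q) * norm (apply_bcontfun G q - apply_bcontfun H q)"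
        by (rule norm_blinfun)
      also have "\<dots> \<le> C * dist G H"
        using that C0 dist_bounded[of G q H] by (intro mult_mono) (auto simp: dist_norm)
      finally show ?thesis by (simp add: blinfun.diff_right)
    qed
    have "F (apply_bcontfun G) (u, v) - F (apply_bcontfun H) (u, v) = integral {c1..u} (\<lambda>t. A (t, c2) (apply_bcontfun G (t, c2)) - A (t, c2) (apply_bcontfun H (t, c2)))
        + integral {c2..v} (\<lambda>s. B (u, s) (apply_bcontfun G (u, s)) - B (u, s) (apply_bcontfun H (u, s)))"
      unfolding F_def by (simp add: integral_diff integrable_continuous_real i1 i2)
    also have "norm \<dots> \<le> C * dist G H * (u - c1) + C * dist G H * (v - c2)"
      by (intro norm_triangle_le add_mono integral_bound continuous_intros i1 i2 est)
         (use uv bound ord in \<open>auto simp: Q_def\<close>)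
    also have "\<dots> \<le> C * dist G H * l + C * dist G H * l"
      using uv small C0 by (intro add_mono mult_left_mono) auto
    also have "\<dots> = (2 * C * l) * dist G H" by simp
    also have "\<dots> \<le> 1/2 * dist G H" by (rule mult_right_mono) (use small in auto)
    finally show "dist (apply_bcontfun (T G) p) (apply_bcontfun (T H) p) \<le> 1/2 * dist G H"
      by (simp add: T q dist_norm)
  qed
  then obtain G where G: "T G = G" using banach_fix_type[of "1/2" T] by auto
  define W where "W = apply_bcontfun G"
  have W: "W p = F W p" if "p \<in> Q" for p
    using T[of G p] that by (simp add: G W_def Qc clamp_cancel_cbox)
  have contW: "continuous_on Q W"
    unfolding W_def by (rule continuous_on_subset[OF continuous_on_apply_bcontfun subset_UNIV])
  have W0: "W (c1, c2) = y0" using W[of "(c1, c2)"] ord by (simp add: F_def Q_def)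

  have Wv: "((\<lambda>t. W (u, t)) has_vector_derivative B (u, v) (W (u, v))) (at v within {c2..d2})"
    if "(u, v) \<in> Q" for u v
  proof -
    have uv: "u \<in> {c1..d1}" "v \<in> {c2..d2}" using that by (auto simp: Q_def)
    have "((\<lambda>t. y0 + integral {c1..u} (\<lambda>t. A (t, c2) (W (t, c2))) + integral {c2..t} (\<lambda>s. B (u, s) (W (u, s))))
      has_vector_derivative 0 + B (u, v) (W (u, v))) (at v within {c2..d2})"
      by (intro has_vector_derivative_add has_vector_derivative_const integral_has_vector_derivative
            comp2[OF app[OF cont(2) contW]] uv)
    from has_vector_derivative_transform[OF uv(2) _ this] show ?thesis
      using uv W  by (auto simp: Q_def F_def)
  qed
  have Wu0: "((\<lambda>t. W (t, c2)) has_vector_derivative A (u, c2) (W (u, c2))) (at u within {c1..d1})"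
    if u: "u \<in> {c1..d1}" for u
  proof -
    have "((\<lambda>t. y0 + integral {c1..t} (\<lambda>t. A (t, c2) (W (t, c2))))
      has_vector_derivative 0 + A (u, c2) (W (u, c2))) (at u within {c1..d1})"
      by (intro has_vector_derivative_add has_vector_derivative_const integral_has_vector_derivative
            comp1[OF app[OF cont(1) contW]] u) (use ord in auto)
    from has_vector_derivative_transform[OF u _ this] show ?thesis
      using ord W u by (auto simp: Q_def F_def)
  qed

  \<comment> \<open>\<open>Z\<close> is the intended value of \<open>W_u\<close>; what remains is to
    show that it is the derivative.\<close>
  define Z where "Z p = A p (W p)" for p
  have contZ: "continuous_on Q Z" unfolding Z_def by (intro app cont contW)
  \<comment> \<open>Flatness enters here: it replaces \<open>A_v W + A B W\<close> by
    \<open>B_u W + B A W\<close>, which is the expression obtained by differentiating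
    \<open>B W\<close> in \<open>u\<close> as if \<open>W_u = Z\<close> held.\<close>
  define Zv where "Zv p = Bu p (W p) + B p (Z p)" for p
  have contZv: "continuous_on Q Zv" unfolding Zv_def by (intro continuous_intros app cont contW contZ)
  have Zv: "((\<lambda>t. Z (u, t)) has_vector_derivative Zv (u, v)) (at v within {c2..d2})" if "(u, v) \<in> Q" for u v
  proof -
    have "((\<lambda>t. Z (u, t)) has_vector_derivative A (u, v) (B (u, v) (W (u, v))) + Av (u, v) (W (u, v))) (at v within {c2..d2})"
      unfolding Z_def
      by (rule bounded_bilinear.has_vector_derivative[OF bounded_bilinear_blinfun_apply Av[OF that] Wv[OF that]])
    moreover have "A (u, v) (B (u, v) (W (u, v))) + Av (u, v) (W (u, v)) = Zv (u, v)"
      using arg_cong[OF flat[OF that], of "\<lambda>X. X (W (u, v))"]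
      by (simp add: Zv_def Z_def blinfun.add_left add.commute)
    ultimately show ?thesis by simp
  qed
  \<comment> \<open>\<open>P\<close> has \<open>u\<close>-derivative \<open>Z\<close> by
    construction and agrees with \<open>W\<close> on the left edge, so the \<open>u\<close>-equation
    amounts to \<open>W = P\<close>.\<close>
  define P where "P p = W (c1, snd p) + integral {c1..fst p} (\<lambda>t. Z (t, snd p))" for p
  have "continuous_on Q (\<lambda>p. W (c1, snd p))"
    by (rule continuous_on_compose2[OF contW]) (use ord in \<open>auto simp: Q_def intro!: continuous_intros\<close>)
  with continuous_on_indefinite_integral_fst[OF contZ[unfolded Q_def]]
  have contP: "continuous_on Q P" unfolding P_def Q_def by (intro continuous_intros)
  have Pu: "((\<lambda>t. P (t, v)) has_vector_derivative Z (u, v)) (at u within {c1..d1})" if "(u, v) \<in> Q" for u v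
  proof -
    have "((\<lambda>t. W (c1, v) + integral {c1..t} (\<lambda>t. Z (t, v))) has_vector_derivative 0 + Z (u, v)) (at u within {c1..d1})"
      by (intro has_vector_derivative_add has_vector_derivative_const integral_has_vector_derivative comp1[OF contZ])
         (use that in \<open>auto simp: Q_def\<close>)
    then show ?thesis by (simp add: P_def)
  qed
  define V where "V p = W p - P p" for p
  have contV: "continuous_on Q V" unfolding V_def by (intro continuous_intros contW contP)
  \<comment> \<open>The defect \<open>V = W - P\<close> obeys a homogeneous linear equation in
    \<open>v\<close> with an additional integral term in \<open>u\<close>, and it vanishes on the
    lower edge.\<close>
  define Vv where "Vv p = B p (V p) - integral {c1..fst p} (\<lambda>t. Bu (t, snd p) (V (t, snd p)))" for p
  have Vv: "((\<lambda>t. V (u, t)) has_vector_derivative Vv (u, v)) (at v within {c2..d2})" if "(u, v) \<in> Q" for u v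
  proof -
    have uv: "u \<in> {c1..d1}" "v \<in> {c2..d2}" using that by (auto simp: Q_def)
    have sub: "{c1..u} \<subseteq> {c1..d1}" using uv by auto
    have "((\<lambda>t. integral (cbox c1 u) (\<lambda>s. Z (s, t))) has_vector_derivative integral (cbox c1 u) (\<lambda>s. Zv (s, v)))
       (at v within {c2..d2})"
    proof (rule leibniz_rule_vector_derivative)
      show "((\<lambda>x. Z (t, x)) has_vector_derivative Zv (t, x)) (at x within {c2..d2})"
        if "x \<in> {c2..d2}" "t \<in> cbox c1 u" for x t
        by (rule Zv) (use that uv in \<open>auto simp: Q_def\<close>)
      show "(\<lambda>s. Z (s, x)) integrable_on cbox c1 u" if "x \<in> {c2..d2}" for x
        using integrable_continuous_real[OF continuous_on_subset[OF comp1[OF contZ that] sub]] by simp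
      show "continuous_on ({c2..d2} \<times> cbox c1 u) (\<lambda>(x, t). Zv (t, x))"
        unfolding case_prod_beta
        by (rule continuous_on_compose2[OF contZv]) (use uv in \<open>auto simp: Q_def intro!: continuous_intros\<close>)
    qed (use uv in auto)
    moreover have "((\<lambda>t. W (c1, t)) has_vector_derivative B (c1, v) (W (c1, v))) (at v within {c2..d2})"
      by (rule Wv) (use uv in \<open>auto simp: Q_def\<close>)
    ultimately have "((\<lambda>t. W (u, t) - (W (c1, t) + integral {c1..u} (\<lambda>s. Z (s, t)))) has_vector_derivative
        B (u, v) (W (u, v)) - (B (c1, v) (W (c1, v)) + integral {c1..u} (\<lambda>s. Zv (s, v)))) (at v within {c2..d2})"
      by (intro has_vector_derivative_diff has_vector_derivative_add Wv[OF that]) auto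
    \<comment> \<open>Integration by parts: \<open>B Z + B_u P\<close> is the
      \<open>u\<close>-derivative of \<open>B P\<close>. Since \<open>Zv\<close> contains
      \<open>B_u W\<close> instead of \<open>B_u P\<close>, the integral of \<open>B_u V\<close> is
      left over.\<close>
    moreover have "integral {c1..u} (\<lambda>s. Zv (s, v)) = B (u, v) (P (u, v)) - B (c1, v) (W (c1, v))
        + integral {c1..u} (\<lambda>t. Bu (t, v) (V (t, v)))"
    proof -
      have "((\<lambda>t. B (t, v) (Z (t, v)) + Bu (t, v) (P (t, v))) has_integral
          B (u, v) (P (u, v)) - B (c1, v) (P (c1, v))) {c1..u}"
      proof (rule fundamental_theorem_of_calculus)
        fix t assume "t \<in> {c1..u}"
        then have "(t, v) \<in> Q" using uv by (auto simp: Q_def)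
        show "((\<lambda>t. B (t, v) (P (t, v))) has_vector_derivative B (t, v) (Z (t, v)) + Bu (t, v) (P (t, v)))
          (at t within {c1..u})"
          by (rule has_vector_derivative_within_subset[OF
             bounded_bilinear.has_vector_derivative[OF bounded_bilinear_blinfun_apply Bu[OF \<open>(t, v) \<in> Q\<close>] Pu[OF \<open>(t, v) \<in> Q\<close>]] sub])
      qed (use uv in auto)
      moreover have "((\<lambda>t. Bu (t, v) (V (t, v))) has_integral integral {c1..u} (\<lambda>t. Bu (t, v) (V (t, v)))) {c1..u}"
        by (intro integrable_integral integrable_continuous_real continuous_on_subset[OF comp1[OF app[OF cont(3) contV] uv(2)] sub])
      ultimately have "((\<lambda>t. (B (t, v) (Z (t, v)) + Bu (t, v) (P (t, v))) + Bu (t, v) (V (t, v))) has_integral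
          (B (u, v) (P (u, v)) - B (c1, v) (P (c1, v))) + integral {c1..u} (\<lambda>t. Bu (t, v) (V (t, v)))) {c1..u}"
        by (rule has_integral_add)
      then show ?thesis
        by (intro integral_unique) (simp add: V_def Zv_def P_def blinfun.diff_right algebra_simps)
    qed
    ultimately show ?thesis by (simp add: V_def[abs_def] Vv_def P_def blinfun.diff_right algebra_simps)
  qed
  have V0: "V (u, c2) = 0" if u: "u \<in> {c1..d1}" for u
  proof -
    have "((\<lambda>t. Z (t, c2)) has_integral W (u, c2) - W (c1, c2)) {c1..u}"
      by (rule fundamental_theorem_of_calculus)
         (use u in \<open>auto simp: Z_def intro!: has_vector_derivative_within_subset[OF Wu0]\<close>)
    then show ?thesis by (simp add: V_def P_def integral_unique)
  qed
  \<comment> \<open>A maximum argument: if \<open>M\<close> is the largest norm of \<open>V\<close>,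
    then \<open>V_v\<close> is bounded by \<open>2 * C * M\<close>, where \<open>l \<le> 1\<close>
    absorbs the length of the inner integral. Integrating from the lower edge gives
    \<open>M \<le> 2 * C * l * M \<le> M / 2\<close>.\<close>
  have V: "V p = 0" if "p \<in> Q" for p
  proof -
    have "compact Q" unfolding Qc by simp
    moreover have "Q \<noteq> {}" using ord by (auto simp: Q_def)
    ultimately obtain q where q: "q \<in> Q" "\<And>p. p \<in> Q \<Longrightarrow> norm (V p) \<le> norm (V q)"
      using continuous_attains_sup[OF _ _ continuous_on_norm[OF contV]] by blast
    define M where "M = norm (V q)"
    obtain u v where uv: "q = (u, v)" "u \<in> {c1..d1}" "v \<in> {c2..d2}" using q(1) by (auto simp: Q_def)
    have bnd: "norm (Vv (u, t)) \<le> 2 * C * M" if t: "t \<in> {c2..d2}" for t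
    proof -
      have "norm (integral {c1..u} (\<lambda>s. Bu (s, t) (V (s, t)))) \<le> C * M * (u - c1)"
      proof (rule integral_bound)
        show "continuous_on {c1..u} (\<lambda>s. Bu (s, t) (V (s, t)))"
          by (rule continuous_on_subset[OF comp1[OF app[OF cont(3) contV] t]]) (use uv in auto)
        show "norm (Bu (s, t) (V (s, t))) \<le> C * M" if "s \<in> {c1..u}" for s
        proof -
          have "(s, t) \<in> Q" using that t uv by (auto simp: Q_def)
          have "norm (Bu (s, t) (V (s, t))) \<le> norm (Bu (s, t)) * norm (V (s, t))" by (rule norm_blinfun)
          also have "\<dots> \<le> C * M" unfolding M_def by (intro mult_mono bound q \<open>(s, t) \<in> Q\<close> C0) auto
          finally show ?thesis .
        qed
      qed (use uv in auto)
      also have "\<dots> \<le> C * M * 1"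
        using uv small C0 by (intro mult_left_mono) (auto simp: M_def)
      finally have 1: "norm (integral {c1..u} (\<lambda>s. Bu (s, t) (V (s, t)))) \<le> C * M" by simp
      have "(u, t) \<in> Q" using t uv by (auto simp: Q_def)
      have "norm (B (u, t) (V (u, t))) \<le> norm (B (u, t)) * norm (V (u, t))" by (rule norm_blinfun)
      also have "\<dots> \<le> C * M" unfolding M_def by (intro mult_mono bound q \<open>(u, t) \<in> Q\<close> C0) auto
      finally show ?thesis using 1 norm_triangle_ineq4[of "B (u, t) (V (u, t))" "integral {c1..u} (\<lambda>s. Bu (s, t) (V (s, t)))"]
        by (simp add: Vv_def)
    qed
    have "((\<lambda>t. Vv (u, t)) has_integral V (u, v) - V (u, c2)) {c2..v}"
      by (rule fundamental_theorem_of_calculus)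
         (use uv in \<open>auto simp: Q_def intro!: has_vector_derivative_within_subset[OF Vv]\<close>)
    then have hi: "((\<lambda>t. Vv (u, t)) has_integral V (u, v)) (cbox c2 v)" using V0 uv by simp
    have CM: "0 \<le> 2 * C * M" using C0 by (simp add: M_def)
    have "norm (V (u, v)) \<le> 2 * C * M * measure lborel (cbox c2 v)"
      by (rule has_integral_bound[OF CM hi]) (use bnd uv in auto)
    also have "\<dots> \<le> 2 * C * M * l" using uv small C0 by (intro mult_left_mono) (auto simp: M_def)
    also have "\<dots> = (2 * C * l) * M" by simp
    also have "\<dots> \<le> 1/2 * M" by (rule mult_right_mono) (use small in \<open>auto simp: M_def\<close>)
    finally have "M \<le> 1/2 * M" by (simp add: M_def uv)
    then have "M = 0" by (simp add: M_def)
    then show ?thesis using q(2)[OF that] by (simp add: M_def)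
  qed
  have Wu: "((\<lambda>t. W (t, v)) has_vector_derivative A (u, v) (W (u, v))) (at u within {c1..d1})" if "(u, v) \<in> Q" for u v
  proof -
    have "W (t, v) = P (t, v)" if "t \<in> {c1..d1}" for t
      using V[of "(t, v)"] \<open>(u, v) \<in> Q\<close> that by (auto simp: V_def Q_def)
    then show ?thesis
      using has_vector_derivative_transform[OF _ _ Pu[OF that], of "\<lambda>t. W (t, v)"] that by (auto simp: Q_def Z_def)
  qed
  \<comment> \<open>Partial derivatives alone do not give a total derivative; the continuity of the
    \<open>v\<close>-derivative \<open>B W\<close> on \<open>Q\<close> closes this gap.\<close>
  have "(W has_derivative (\<lambda>h. fst h *\<^sub>R A p (W p) + snd h *\<^sub>R B p (W p))) (at p within Q)" if "p \<in> Q" for p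
  proof -
    obtain u v where p: "p = (u, v)" by fastforce
    have c: "continuous_on Q (\<lambda>p. blinfun_scaleR_left (B p (W p)))"
      by (intro bounded_linear.continuous_on[OF bounded_linear_blinfun_scaleR_left] app cont contW)
    have "((\<lambda>(x, y). W (x, y)) has_derivative (\<lambda>(tx, ty). tx *\<^sub>R A (u, v) (W (u, v)) + blinfun_scaleR_left (B (u, v) (W (u, v))) ty))
        (at (u, v) within {c1..d1} \<times> {c2..d2})"
    proof (rule has_derivative_partialsI)
      show "((\<lambda>x. W (x, v)) has_derivative (\<lambda>tx. tx *\<^sub>R A (u, v) (W (u, v)))) (at u within {c1..d1})"
        using Wu[of u v] that p by (simp add: has_vector_derivative_def)
      show "((\<lambda>y. W (x, y)) has_derivative blinfun_apply (blinfun_scaleR_left (B (x, y) (W (x, y))))) (at y within {c2..d2})"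
        if "x \<in> {c1..d1}" "y \<in> {c2..d2}" for x y
        using Wv[of x y] that by (simp add: has_vector_derivative_def Q_def)
      show "continuous (at (u, v) within {c1..d1} \<times> {c2..d2}) (\<lambda>(x, y). blinfun_scaleR_left (B (x, y) (W (x, y))))"
        using c that p unfolding Q_def continuous_on_eq_continuous_within case_prod_beta' prod.collapse by blast
    qed (use that p in \<open>auto simp: Q_def\<close>)
    then show ?thesis by (simp add: p Q_def case_prod_beta')
  qed
  with W0 show ?thesis by (rule that)
qed

text \<open>The point \<open>p0\<close> is the centre of a small square, while the value
  \<open>y0\<close> is prescribed at its lower left corner. This is enough for existence, since the
  position of the surface and its frame may be chosen freely at any one point.\<close>

lemma total_linear_system_local_solution:
  fixes A B :: "real \<times> real \<Rightarrow> 'b::banach \<Rightarrow>\<^sub>L 'b"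
  assumes S: "open S" "p0 \<in> S" and smooth: "smooth_on S A" "smooth_on S B"
    and flat: "\<And>p. p \<in> S \<Longrightarrow> Dv A p + (A p o\<^sub>L B p) = Du B p + (B p o\<^sub>L A p)"
  obtains c d W where "p0 \<in> box c d" "cbox c d \<subseteq> S" "W c = y0"
    and "\<And>p. p \<in> cbox c d \<Longrightarrow>
      (W has_derivative (\<lambda>h. fst h *\<^sub>R A p (W p) + snd h *\<^sub>R B p (W p))) (at p within cbox c d)"
proof -
  obtain u0 v0 where p0: "p0 = (u0, v0)" by fastforce
  obtain U V where UV: "open U" "open V" "u0 \<in> U" "v0 \<in> V" "U \<times> V \<subseteq> S"
    using open_prod_elim[OF S] p0 by (metis mem_Times_iff fst_conv snd_conv)
  obtain e1 e2 where e: "e1 > 0" "cball u0 e1 \<subseteq> U" "e2 > 0" "cball v0 e2 \<subseteq> V"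
    using UV(1-4) open_contains_cball by metis
  define r where "r = min e1 e2"
  let ?R = "{u0 - r..u0 + r} \<times> {v0 - r..v0 + r}"
  have "?R \<subseteq> cball u0 e1 \<times> cball v0 e2" by (auto simp: r_def cball_eq_atLeastAtMost)
  also have "\<dots> \<subseteq> U \<times> V" using e by (intro Sigma_mono) auto
  finally have r: "r > 0" "?R \<subseteq> S" using e UV(5) by (simp_all add: r_def)
  have "compact ?R" by (intro compact_Times) auto
  note cont = smooth[THEN smooth_on_continuous] smooth(2)[THEN smooth_on_Du, THEN smooth_on_continuous]
  have "\<exists>C. \<forall>p\<in>?R. norm (g p) \<le> C" if "continuous_on S g" for g :: "real \<times> real \<Rightarrow> 'b \<Rightarrow>\<^sub>L 'b"
    using compact_imp_bounded[OF compact_continuous_image[OF continuous_on_subset[OF that r(2)] \<open>compact ?R\<close>]]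
    by (auto simp: bounded_iff)
  then obtain C1 C2 C3 where C123: "\<And>p. p \<in> ?R \<Longrightarrow> norm (A p) \<le> C1"
    "\<And>p. p \<in> ?R \<Longrightarrow> norm (B p) \<le> C2" "\<And>p. p \<in> ?R \<Longrightarrow> norm (Du B p) \<le> C3"
    using cont by metis
  define C where "C = max 1 (max C1 (max C2 C3))"
  have C: "1 \<le> C" "\<And>p. p \<in> ?R \<Longrightarrow> norm (A p) \<le> C"
    "\<And>p. p \<in> ?R \<Longrightarrow> norm (B p) \<le> C" "\<And>p. p \<in> ?R \<Longrightarrow> norm (Du B p) \<le> C"
    using C123 by (force simp: C_def)+
  \<comment> \<open>The square has side \<open>l = 2 * \<epsilon>\<close>, so the contraction
    condition \<open>2 * C * l \<le> 1/2\<close> reads \<open>8 * C * \<epsilon> \<le> 1\<close>.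
    Having taken \<open>C\<close> at least \<open>1\<close>, this also gives
    \<open>l \<le> 1\<close>.\<close>
  define \<epsilon> where "\<epsilon> = min r (1 / (8 * C))"
  have eps: "0 < \<epsilon>" "\<epsilon> \<le> r" "8 * C * \<epsilon> \<le> 1"
  proof -
    show "0 < \<epsilon>" "\<epsilon> \<le> r" using r C(1) by (auto simp: \<epsilon>_def)
    have "\<epsilon> \<le> 1 / (8 * C)" by (simp add: \<epsilon>_def)
    then show "8 * C * \<epsilon> \<le> 1" using C(1) by (simp add: pos_le_divide_eq mult.commute)
  qed
  have eps1: "8 * \<epsilon> \<le> 1" 
  proof -
    have "1 * (8 * \<epsilon>) \<le> C * (8 * \<epsilon>)" using eps C(1) by (intro mult_right_mono) auto
    also have "\<dots> = 8 * C * \<epsilon>" by simp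
    finally show ?thesis using eps(3) by simp
  qed
  let ?Q = "{u0 - \<epsilon>..u0 + \<epsilon>} \<times> {v0 - \<epsilon>..v0 + \<epsilon>}"
  have QR: "?Q \<subseteq> ?R" using eps by auto
  obtain W where W: "W (u0 - \<epsilon>, v0 - \<epsilon>) = y0" "\<And>p. p \<in> ?Q \<Longrightarrow>
      (W has_derivative (\<lambda>h. fst h *\<^sub>R A p (W p) + snd h *\<^sub>R B p (W p))) (at p within ?Q)"
  proof (rule linear_system_small_rectangle[of "u0 - \<epsilon>" "u0 + \<epsilon>" "v0 - \<epsilon>" "v0 + \<epsilon>" A B "Du B" "Dv A" C "2 * \<epsilon>" y0])
    show "((\<lambda>t. A (u, t)) has_vector_derivative Dv A (u, v)) (at v within {v0 - \<epsilon>..v0 + \<epsilon>})"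
      if "(u, v) \<in> ?Q" for u v
      by (rule has_vector_derivative_at_within, rule smooth_on_partials(2)[OF smooth(1)]) (use that QR r in blast)
    show "((\<lambda>t. B (t, v)) has_vector_derivative Du B (u, v)) (at u within {u0 - \<epsilon>..u0 + \<epsilon>})"
      if "(u, v) \<in> ?Q" for u v
      by (rule has_vector_derivative_at_within, rule smooth_on_partials(1)[OF smooth(2)]) (use that QR r in blast)
    show "continuous_on ?Q A" "continuous_on ?Q B" "continuous_on ?Q (Du B)"
      using QR r by (auto intro: continuous_on_subset[OF cont(1)] continuous_on_subset[OF cont(2)] continuous_on_subset[OF cont(3)])
    show "norm (A p) \<le> C" "norm (B p) \<le> C" "norm (Du B p) \<le> C" if "p \<in> ?Q" for p
      using C(2-4) that QR by blast+
    show "Dv A p + (A p o\<^sub>L B p) = Du B p + (B p o\<^sub>L A p)" if "p \<in> ?Q" for p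
      using flat that QR r by blast
  qed (use eps eps1 in auto)
  have Q: "?Q = cbox (u0 - \<epsilon>, v0 - \<epsilon>) (u0 + \<epsilon>, v0 + \<epsilon>)" by (simp add: cbox_Pair_eq)
  show ?thesis
  proof (rule that[where W = W])
    show "p0 \<in> box (u0 - \<epsilon>, v0 - \<epsilon>) (u0 + \<epsilon>, v0 + \<epsilon>)"
      using eps by (auto simp: p0 box_def Basis_prod_def inner_Pair)
    show "cbox (u0 - \<epsilon>, v0 - \<epsilon>) (u0 + \<epsilon>, v0 + \<epsilon>) \<subseteq> S" using Q QR r by blast
  qed (use W(1) W(2)[unfolded Q] in auto)
qed

subsection \<open>Lorentzian orthonormal frames\<close>

lemma lorentz_add_left: "lorentz (x + y) z = lorentz x z + lorentz y z"
  and lorentz_add_right: "lorentz x (y + z) = lorentz x y + lorentz x z"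
  and lorentz_scaleR_left: "lorentz (c *\<^sub>R x) y = c * lorentz x y"
  and lorentz_scaleR_right: "lorentz x (c *\<^sub>R y) = c * lorentz x y"
  and lorentz_diff_left: "lorentz (x - y) z = lorentz x z - lorentz y z"
  and lorentz_diff_right: "lorentz x (y - z) = lorentz x y - lorentz x z"
  and lorentz_minus_left: "lorentz (- x) y = - lorentz x y"
  and lorentz_minus_right: "lorentz x (- y) = - lorentz x y"
  and lorentz_zero_left: "lorentz 0 y = 0"
  and lorentz_zero_right: "lorentz x 0 = 0"
  by (simp_all add: lorentz_def algebra_simps)

lemmas lorentz_simps = lorentz_add_left lorentz_add_right lorentz_scaleR_left lorentz_scaleR_right
  lorentz_diff_left lorentz_diff_right lorentz_minus_left lorentz_minus_right
  lorentz_zero_left lorentz_zero_right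

lemma lorentz_commute: "lorentz x y = lorentz y x" by (simp add: lorentz_def)

lemma bounded_bilinear_lorentz: "bounded_bilinear lorentz"
proof -
  have "norm (lorentz x y) \<le> norm x * norm y * 3" for x y
  proof -
    have c: "\<bar>x $ i * y $ i\<bar> \<le> norm x * norm y" for i
      unfolding abs_mult by (intro mult_mono component_le_norm_cart) auto
    show ?thesis using c[of 1] c[of 2] c[of 3] by (auto simp: lorentz_def)
  qed
  then show ?thesis by (intro bounded_bilinear.intro) (auto simp: lorentz_simps)
qed

text \<open>The Euclidean cross product with its third component negated. This sign compensates the
  one in the metric, which makes the product dual to the ordinary determinant.\<close>

definition lorentz_cross :: "real^3 \<Rightarrow> real^3 \<Rightarrow> real^3" where
  "lorentz_cross x y = vector [x $ 2 * y $ 3 - x $ 3 * y $ 2, x $ 3 * y $ 1 - x $ 1 * y $ 3,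
     x $ 2 * y $ 1 - x $ 1 * y $ 2]"

lemma lorentz_lorentz_cross: "lorentz (lorentz_cross x y) w = det (vector [x, y, w] :: real^3^3)"
  by (simp add: lorentz_def lorentz_cross_def det_3 algebra_simps)

lemma bounded_bilinear_lorentz_cross: "bounded_bilinear lorentz_cross"
proof -
  have lin: "lorentz_cross (x + x') y = lorentz_cross x y + lorentz_cross x' y"
    "lorentz_cross x (y + y') = lorentz_cross x y + lorentz_cross x y'"
    "lorentz_cross (c *\<^sub>R x) y = c *\<^sub>R lorentz_cross x y"
    "lorentz_cross x (c *\<^sub>R y) = c *\<^sub>R lorentz_cross x y" for x x' y y' c
    by (simp_all add: lorentz_cross_def vec_eq_iff forall_3 algebra_simps)
  then have "bilinear lorentz_cross" by (auto simp: bilinear_def intro!: linearI)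
  then show ?thesis by (simp add: bilinear_conv_bounded_bilinear)
qed

text \<open>The time-like vector is put second because it comes from \<open>z_v\<close>. The
  determinant is only asked to be positive; the Gram conditions then force the value
  \<open>1\<close>.\<close>

definition lorentz_frame :: "real^3 \<Rightarrow> real^3 \<Rightarrow> real^3 \<Rightarrow> bool" where
  "lorentz_frame e1 e2 n \<longleftrightarrow> lorentz e1 e1 = 1 \<and> lorentz e2 e2 = -1 \<and> lorentz n n = 1
     \<and> lorentz e1 e2 = 0 \<and> lorentz e1 n = 0 \<and> lorentz e2 n = 0
     \<and> det (vector [e1, e2, n] :: real^3^3) > 0"

lemma lorentz_frameD:
  assumes "lorentz_frame e1 e2 n"
  shows "lorentz e1 e1 = 1" "lorentz e2 e2 = -1" "lorentz n n = 1"
    "lorentz e1 e2 = 0" "lorentz e1 n = 0" "lorentz e2 n = 0"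
    "lorentz e2 e1 = 0" "lorentz n e1 = 0" "lorentz n e2 = 0"
  using assms by (simp_all add: lorentz_frame_def lorentz_commute)

text \<open>With \<open>X\<close> the matrix of rows \<open>e1, e2, n\<close>, this is
  \<open>J * transpose X * S\<close> for \<open>J = diag (1, 1, -1)\<close> and
  \<open>S = diag (1, -1, 1)\<close>: the candidate for the inverse of \<open>X\<close> in
  Lorentzian geometry.\<close>

definition lorentz_dual_matrix :: "real^3 \<Rightarrow> real^3 \<Rightarrow> real^3 \<Rightarrow> real^3^3" where
  "lorentz_dual_matrix e1 e2 n =
     vector [vector [e1 $ 1, - e2 $ 1, n $ 1], vector [e1 $ 2, - e2 $ 2, n $ 2],
       vector [- e1 $ 3, e2 $ 3, - n $ 3]]"

lemma gram_iff_right_inverse: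
  "(lorentz e1 e1 = 1 \<and> lorentz e2 e2 = -1 \<and> lorentz n n = 1
     \<and> lorentz e1 e2 = 0 \<and> lorentz e1 n = 0 \<and> lorentz e2 n = 0)
   \<longleftrightarrow> (vector [e1, e2, n] :: real^3^3) ** lorentz_dual_matrix e1 e2 n = mat 1"
  by (auto simp: lorentz_dual_matrix_def vec_eq_iff forall_3 matrix_matrix_mult_def sum_3 mat_def
      lorentz_def algebra_simps)

lemma completeness_iff_left_inverse:
  "(\<forall>i j. e1 $ i * e1 $ j - e2 $ i * e2 $ j + n $ i * n $ j = (if i = j then if i = 3 then -1 else 1 else 0))
   \<longleftrightarrow> lorentz_dual_matrix e1 e2 n ** (vector [e1, e2, n] :: real^3^3) = mat 1"
  by (auto simp: lorentz_dual_matrix_def vec_eq_iff forall_3 matrix_matrix_mult_def sum_3 mat_def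
      algebra_simps)

text \<open>Orthonormality says that the dual matrix is a right inverse, completeness that it is a
  left inverse, and for square matrices these coincide. The second form expands vectors in the frame
  and is the one preserved termwise by the frame equations.\<close>

lemma gram_iff_completeness:
  "(lorentz e1 e1 = 1 \<and> lorentz e2 e2 = -1 \<and> lorentz n n = 1
     \<and> lorentz e1 e2 = 0 \<and> lorentz e1 n = 0 \<and> lorentz e2 n = 0)
   \<longleftrightarrow> (\<forall>i j. e1 $ i * e1 $ j - e2 $ i * e2 $ j + n $ i * n $ j = (if i = j then if i = 3 then -1 else 1 else 0))"
  unfolding gram_iff_right_inverse completeness_iff_left_inverse by (rule matrix_left_right_inverse)

lemma lorentz_frame_expansion:
  assumes "lorentz_frame e1 e2 n"
  shows "x = lorentz e1 x *\<^sub>R e1 - lorentz e2 x *\<^sub>R e2 + lorentz n x *\<^sub>R n"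
proof -
  have c: "e1 $ i * e1 $ j - e2 $ i * e2 $ j + n $ i * n $ j = (if i = j then if i = 3 then -1 else 1 else 0)" for i j
    using assms gram_iff_completeness[of e1 e2 n] by (auto simp: lorentz_frame_def)
  have "x $ i = (lorentz e1 x *\<^sub>R e1 - lorentz e2 x *\<^sub>R e2 + lorentz n x *\<^sub>R n) $ i" for i
  proof -
    have "(lorentz e1 x *\<^sub>R e1 - lorentz e2 x *\<^sub>R e2 + lorentz n x *\<^sub>R n) $ i
       = x $ 1 * (e1 $ 1 * e1 $ i - e2 $ 1 * e2 $ i + n $ 1 * n $ i)
       + x $ 2 * (e1 $ 2 * e1 $ i - e2 $ 2 * e2 $ i + n $ 2 * n $ i)
       - x $ 3 * (e1 $ 3 * e1 $ i - e2 $ 3 * e2 $ i + n $ 3 * n $ i)"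
      by (simp add: lorentz_def algebra_simps)
    then show ?thesis unfolding c using exhaust_3[of i] by auto
  qed
  then show ?thesis by (simp add: vec_eq_iff)
qed

lemma lorentz_frame_parseval:
  assumes "lorentz_frame e1 e2 n"
  shows "lorentz x y = lorentz e1 x * lorentz e1 y - lorentz e2 x * lorentz e2 y + lorentz n x * lorentz n y"
  by (subst lorentz_frame_expansion[OF assms, of x]) (simp add: lorentz_simps)

text \<open>Both sign matrices hidden in the dual matrix have determinant \<open>-1\<close>, so it
  has the same determinant as the frame, and the product of the two is \<open>1\<close>.\<close>

lemma gram_det_sq:
  assumes "lorentz e1 e1 = 1" "lorentz e2 e2 = -1" "lorentz n n = 1"
    "lorentz e1 e2 = 0" "lorentz e1 n = 0" "lorentz e2 n = 0"
  shows "(det (vector [e1, e2, n] :: real^3^3))\<^sup>2 = 1"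
proof -
  let ?M = "vector [e1, e2, n] :: real^3^3"
  have "det ?M * det (lorentz_dual_matrix e1 e2 n) = 1"
    using arg_cong[OF iffD1[OF gram_iff_right_inverse], of e1 e2 n det] assms by (simp add: det_mul)
  moreover have "det (lorentz_dual_matrix e1 e2 n) = det ?M"
    by (simp add: lorentz_dual_matrix_def det_3 algebra_simps)
  ultimately show ?thesis by (simp add: power2_eq_square)
qed

lemma lorentz_frame_det:
  assumes "lorentz_frame e1 e2 n" shows "det (vector [e1, e2, n] :: real^3^3) = 1"
  using gram_det_sq[of e1 e2 n] assms by (auto simp: lorentz_frame_def power2_eq_1_iff)

text \<open>The Lorentzian Lagrange identity \<open>lag\<close> has the opposite sign to the
  Euclidean one, so a space-like and a time-like unit vector that are orthogonal have a space-like
  unit product. Its square is at the same time the determinant of the triple, whence the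
  orientation.\<close>

lemma lorentz_frame_cross:
  assumes "lorentz e1 e1 = 1" "lorentz e2 e2 = -1" "lorentz e1 e2 = 0"
  shows "lorentz_frame e1 e2 (lorentz_cross e1 e2)"
proof -
  have lag: "lorentz (lorentz_cross x y) (lorentz_cross x y) = (lorentz x y)\<^sup>2 - lorentz x x * lorentz y y" for x y
    by (simp add: lorentz_def lorentz_cross_def power2_eq_square algebra_simps)
  have "lorentz e1 (lorentz_cross e1 e2) = 0" "lorentz e2 (lorentz_cross e1 e2) = 0"
    unfolding lorentz_commute[of _ "lorentz_cross e1 e2"]
    by (simp_all add: lorentz_lorentz_cross det_3)
  with assms show ?thesis by (simp add: lorentz_frame_def flip: lorentz_lorentz_cross) (simp add: lag)
qed

text \<open>\<open>A\<close> takes each vector of the first frame to its counterpart in the second;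
  the minus sign reflects that \<open>e2\<close> is time-like. Its determinant is the quotient of
  two frame determinants, both equal to \<open>1\<close>.\<close>

lemma lorentz_frame_change:
  fixes e1 e2 n e1' e2' n' :: "real^3"
  defines "A \<equiv> \<lambda>x. lorentz e1 x *\<^sub>R e1' - lorentz e2 x *\<^sub>R e2' + lorentz n x *\<^sub>R n'"
  assumes fr: "lorentz_frame e1 e2 n" "lorentz_frame e1' e2' n'"
  shows "linear A" "lorentz (A x) (A y) = lorentz x y" "det (matrix A) = 1"
proof -
  show lin: "linear A"
    by (intro linearI) (simp_all add: A_def lorentz_simps algebra_simps)
  show "lorentz (A x) (A y) = lorentz x y"
    by (simp add: A_def lorentz_simps lorentz_frameD[OF fr(2)] lorentz_frame_parseval[OF fr(1), of x y])
  have im: "A e1 = e1'" "A e2 = e2'" "A n = n'"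
    by (simp_all add: A_def lorentz_frameD[OF fr(1)])
  have mv: "matrix A *v x = A x" for x using matrix_vector_mul(2)[OF lin] by metis
  have "matrix A ** transpose (vector [e1, e2, n] :: real^3^3)
      = transpose (vector [matrix A *v e1, matrix A *v e2, matrix A *v n] :: real^3^3)"
    by (simp add: vec_eq_iff forall_3 matrix_matrix_mult_def matrix_vector_mult_def transpose_def sum_3)
  from arg_cong[OF this, of det] show "det (matrix A) = 1"
    by (simp add: det_mul det_transpose lorentz_frame_det[OF fr(1)] lorentz_frame_det[OF fr(2)] mv im)
qed

text \<open>In the applications \<open>w\<^sup>2 = 1 + a\<^sup>2\<close>, so that \<open>y\<close> has scalar square \<open>- \<psi>\<^sup>2\<close>.\<close>

lemma adapted_frame_normal_unique:
  assumes fr: "lorentz_frame e1 e2 n" and pos: "\<phi> > 0" "\<psi> > 0" "w > 0"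
    and xy: "x = \<phi> *\<^sub>R e1" "y = \<psi> *\<^sub>R (a *\<^sub>R e1 + w *\<^sub>R e2)"
  shows "(THE n. lorentz n n = 1 \<and> lorentz n x = 0 \<and> lorentz n y = 0
     \<and> det (vector [x, y, n] :: real^3^3) > 0) = n"
proof (rule the_equality)
  \<comment> \<open>The \<open>e1\<close>-part of \<open>y\<close> drops out of the determinant,
    which thus only picks up the positive factor \<open>\<phi> * \<psi> * w\<close>.\<close>
  have d: "det (vector [x, y, c *\<^sub>R n] :: real^3^3) = \<phi> * \<psi> * w * c * det (vector [e1, e2, n] :: real^3^3)" for c
    by (simp add: xy det_3 algebra_simps)
  show "lorentz n n = 1 \<and> lorentz n x = 0 \<and> lorentz n y = 0 \<and> det (vector [x, y, n] :: real^3^3) > 0"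
    using d[of 1] pos by (simp add: xy lorentz_simps lorentz_frameD[OF fr] lorentz_frame_det[OF fr])
  fix m assume m: "lorentz m m = 1 \<and> lorentz m x = 0 \<and> lorentz m y = 0 \<and> det (vector [x, y, m] :: real^3^3) > 0"
  then have "lorentz e1 m = 0" "lorentz e2 m = 0"
    using pos by (auto simp: xy lorentz_simps lorentz_commute)
  with lorentz_frame_expansion[OF fr, of m] have m': "m = lorentz n m *\<^sub>R n" by simp
  have "(lorentz n m)\<^sup>2 = 1"
    using m by (subst (asm) (1 2) m') (simp add: lorentz_simps lorentz_frameD[OF fr] power2_eq_square)
  moreover have "lorentz n m > 0"
  proof -
    have "0 < (\<phi> * \<psi> * w) * lorentz n m"
      using m d[of "lorentz n m"] unfolding m'[symmetric] by (simp add: lorentz_frame_det[OF fr])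
    moreover have "0 < \<phi> * \<psi> * w" using pos by simp
    ultimately show ?thesis by (rule zero_less_mult_pos)
  qed
  ultimately have "lorentz n m = 1" by (simp add: power2_eq_1_iff)
  with m' show "m = n" by simp
qed

text \<open>Pairing with \<open>e2\<close> kills \<open>x\<close> but not \<open>y\<close>, which
  separates the two vectors. Anything orthogonal to both has only an \<open>n\<close>-component, and
  \<open>n\<close> is space-like.\<close>

lemma adapted_frame_timelike:
  assumes fr: "lorentz_frame e1 e2 n" and pos: "\<phi> > 0" "\<psi> > 0" "w > 0"
    and xy: "x = \<phi> *\<^sub>R e1" "y = \<psi> *\<^sub>R (a *\<^sub>R e1 + w *\<^sub>R e2)"
  shows "x \<noteq> y" "independent {x, y}"
    and "m \<noteq> 0 \<Longrightarrow> lorentz m x = 0 \<Longrightarrow> lorentz m y = 0 \<Longrightarrow> lorentz m m > 0"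
proof -
  have e2: "lorentz e2 x = 0" "lorentz e2 y = - (\<psi> * w)" "lorentz e1 x = \<phi>"
    by (simp_all add: xy lorentz_simps lorentz_frameD[OF fr])
  then show "x \<noteq> y" using pos by auto
  have "x \<noteq> 0" using e2 pos by (auto simp: lorentz_simps)
  moreover have "x = 0" if "x = k *\<^sub>R y" for k
  proof -
    have "0 = k * lorentz e2 y" using e2(1) by (subst (asm) that) (simp add: lorentz_simps)
    then have "k = 0" using e2(2) pos by simp
    with that show ?thesis by simp
  qed
  moreover have "y \<noteq> 0" using e2 pos by (auto simp: lorentz_simps)
  ultimately show "independent {x, y}"
    by (auto simp: independent_insert span_singleton)
  assume m: "m \<noteq> 0" "lorentz m x = 0" "lorentz m y = 0"
  then have "lorentz e1 m = 0" "lorentz e2 m = 0"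
    using pos by (auto simp: xy lorentz_simps lorentz_commute)
  with lorentz_frame_expansion[OF fr, of m] lorentz_frame_parseval[OF fr, of m m]
  have "m = lorentz n m *\<^sub>R n" "lorentz m m = (lorentz n m)\<^sup>2" by (auto simp: power2_eq_square)
  then show "lorentz m m > 0" using m(1) by (metis scaleR_zero_left zero_less_power2)
qed

text \<open>Gram-Schmidt for a space-like \<open>x\<close> and a time-like \<open>y\<close>. The
  vector \<open>y / \<psi> - a e1\<close> has square \<open>- 1 - a * a\<close>, which is why
  \<open>w\<close> normalizes it; the sign makes the construction work for every value of
  \<open>a\<close>.\<close>

lemma adapted_frame_exists:
  fixes x y :: "real^3"
  assumes E: "lorentz x x > 0" and G: "lorentz y y < 0"
  defines "\<phi> \<equiv> sqrt (lorentz x x)" and "\<psi> \<equiv> sqrt (- lorentz y y)"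
  defines "a \<equiv> lorentz x y / (\<phi> * \<psi>)"
  defines "w \<equiv> sqrt (1 + a\<^sup>2)"
  defines "e1 \<equiv> (1 / \<phi>) *\<^sub>R x"
  defines "e2 \<equiv> (1 / w) *\<^sub>R ((1 / \<psi>) *\<^sub>R y - a *\<^sub>R e1)"
  shows "\<phi> > 0" "\<psi> > 0" "w > 0" "x = \<phi> *\<^sub>R e1" "y = \<psi> *\<^sub>R (a *\<^sub>R e1 + w *\<^sub>R e2)"
    and "lorentz_frame e1 e2 (lorentz_cross e1 e2)"
proof -
  show pos: "\<phi> > 0" "\<psi> > 0" "w > 0"
    using E G by (auto simp: \<phi>_def \<psi>_def w_def add_pos_nonneg)
  show "x = \<phi> *\<^sub>R e1" "y = \<psi> *\<^sub>R (a *\<^sub>R e1 + w *\<^sub>R e2)"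
    using pos by (simp_all add: e1_def e2_def)
  have sq: "lorentz x x = \<phi> * \<phi>" "lorentz y y = - (\<psi> * \<psi>)" "w * w = 1 + a * a" "lorentz x y = a * \<phi> * \<psi>"
    using E G pos by (auto simp: \<phi>_def \<psi>_def w_def a_def power2_eq_square add_nonneg_nonneg)
  let ?Y = "(1 / \<psi>) *\<^sub>R y"
  have Y: "lorentz ?Y ?Y = -1" "lorentz e1 ?Y = a" "lorentz e1 e1 = 1"
    using pos by (simp_all add: e1_def lorentz_simps sq)
  have "lorentz e2 e2 = (1 / (w * w)) * (lorentz ?Y ?Y - 2 * a * lorentz e1 ?Y + a * a * lorentz e1 e1)"
    by (simp add: e2_def lorentz_diff_left lorentz_diff_right lorentz_scaleR_left[of "1/w"] lorentz_scaleR_right[of _ "1/w"]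
        lorentz_scaleR_left[of a] lorentz_scaleR_right[of _ a] lorentz_commute[of ?Y e1])
       (use pos in \<open>simp add: field_simps\<close>)
  also have "\<dots> = (1 / (w * w)) * (- (w * w))" unfolding Y sq(3) by (simp add: algebra_simps)
  also have "\<dots> = -1" using pos by simp
  finally have 2: "lorentz e2 e2 = -1" .
  have "lorentz e1 e2 = (1 / w) * (lorentz e1 ?Y - a * lorentz e1 e1)"
    by (simp only: e2_def lorentz_diff_right lorentz_scaleR_right[of _ "1/w"] lorentz_scaleR_right[of _ a])
  then have "lorentz e1 e2 = 0" by (simp add: Y)
  with Y 2 show "lorentz_frame e1 e2 (lorentz_cross e1 e2)" by (intro lorentz_frame_cross)
qed

subsection \<open>Integration of the structure equations\<close>

lemma has_derivative_comp_vec_nth: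
  "(f has_derivative f') F \<Longrightarrow> ((\<lambda>x. f x $ i) has_derivative (\<lambda>h. f' h $ i)) F"
  by (rule bounded_linear.has_derivative[OF bounded_linear_vec_nth])

text \<open>In the derivative of each entry of the completeness relation the terms cancel in pairs,
  because the connection matrices are infinitesimal isometries. The entries are therefore constant
  on the convex set. The orientation persists because the determinant is continuous on a connected
  set and takes only the values \<open>1\<close> and \<open>-1\<close>.\<close>

lemma frame_system_completeness:
  assumes "convex Q" "c \<in> Q"
    and e1: "\<And>x. x \<in> Q \<Longrightarrow> (e1 has_derivative (\<lambda>h. fst h *\<^sub>R (p x *\<^sub>R e2 x) + snd h *\<^sub>R (q x *\<^sub>R e2 x + m x *\<^sub>R n x))) (at x within Q)"
    and e2: "\<And>x. x \<in> Q \<Longrightarrow> (e2 has_derivative (\<lambda>h. fst h *\<^sub>R (p x *\<^sub>R e1 x + r x *\<^sub>R n x) + snd h *\<^sub>R (q x *\<^sub>R e1 x + k x *\<^sub>R n x))) (at x within Q)"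
    and n: "\<And>x. x \<in> Q \<Longrightarrow> (n has_derivative (\<lambda>h. fst h *\<^sub>R (r x *\<^sub>R e2 x) + snd h *\<^sub>R (k x *\<^sub>R e2 x - m x *\<^sub>R e1 x))) (at x within Q)"
    and fr: "lorentz_frame (e1 c) (e2 c) (n c)"
    and x: "x \<in> Q"
  shows "lorentz_frame (e1 x) (e2 x) (n x :: real^3)"
proof -
  have gram: "lorentz (e1 y) (e1 y) = 1 \<and> lorentz (e2 y) (e2 y) = -1 \<and> lorentz (n y) (n y) = 1
     \<and> lorentz (e1 y) (e2 y) = 0 \<and> lorentz (e1 y) (n y) = 0 \<and> lorentz (e2 y) (n y) = 0" if y: "y \<in> Q" for y
  proof (subst gram_iff_completeness, intro allI)
    fix i j
    let ?h = "\<lambda>x. e1 x $ i * e1 x $ j - e2 x $ i * e2 x $ j + n x $ i * n x $ j"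
    have "(?h has_derivative (\<lambda>_. 0)) (at x within Q)" if "x \<in> Q" for x
      by (rule derivative_eq_intros has_derivative_comp_vec_nth e1[OF that] e2[OF that] n[OF that] refl)+
         (simp add: fun_eq_iff algebra_simps)
    from has_derivative_zero_unique[OF assms(1) this y assms(2)]
    have "?h y = ?h c" by simp
    also have "\<dots> = (if i = j then if i = 3 then -1 else 1 else 0)"
      using gram_iff_completeness[of "e1 c" "e2 c" "n c"] fr by (auto simp: lorentz_frame_def)
    finally show "?h y = (if i = j then if i = 3 then -1 else 1 else 0)" .
  qed
  let ?d = "\<lambda>y. det (vector [e1 y, e2 y, n y] :: real^3^3)"
  have sq: "?d y = 1 \<or> ?d y = -1" if "y \<in> Q" for y
    using gram_det_sq[of "e1 y" "e2 y" "n y"] gram[OF that] by (simp add: power2_eq_1_iff)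
  have c: "continuous_on Q e1" "continuous_on Q e2" "continuous_on Q n"
    by (rule has_derivative_continuous_on, erule e1 e2 n)+
  have "continuous_on Q ?d"
    unfolding det_3 by (simp, intro continuous_intros c)
  from connected_continuous_image[OF this convex_connected[OF assms(1)]]
  have conn: "connected (?d ` Q)" .
  have "?d x \<noteq> -1"
  proof
    assume "?d x = -1"
    then have "?d x \<le> 0" "0 \<le> ?d c" by (simp_all add: lorentz_frame_det[OF fr])
    with connectedD_interval[OF conn imageI[OF x] imageI[OF assms(2)]] have "0 \<in> ?d ` Q" .
    then obtain y where "y \<in> Q" "?d y = 0" by force
    with sq[OF \<open>y \<in> Q\<close>] show False by simp
  qed
  with sq[OF x] gram[OF x] show ?thesis by (simp add: lorentz_frame_def)
qed

text \<open>The premises \<open>closed\<close> are the \<open>e1\<close>-, \<open>e2\<close>- and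
  \<open>n\<close>-components of \<open>z_uv = z_vu\<close>. The premises \<open>gauss\<close> and
  \<open>codazzi\<close> are the components of the corresponding identities for the frame; together
  they say that the linear system for \<open>(z, e1, e2, n)\<close> is flat.\<close>

lemma frame_system_solution:
  fixes \<Phi> b1 b2 p q r m k :: "real \<times> real \<Rightarrow> real"
  assumes S: "open S" "p0 \<in> S"
    and sm: "smooth_on S \<Phi>" "smooth_on S b1" "smooth_on S b2" "smooth_on S p" "smooth_on S q"
      "smooth_on S r" "smooth_on S m" "smooth_on S k"
    and closed: "\<And>x. x \<in> S \<Longrightarrow> Dv \<Phi> x = Du b1 x + b2 x * p x"
      "\<And>x. x \<in> S \<Longrightarrow> \<Phi> x * q x = b1 x * p x + Du b2 x"
      "\<And>x. x \<in> S \<Longrightarrow> \<Phi> x * m x = b2 x * r x"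
    and gauss: "\<And>x. x \<in> S \<Longrightarrow> Dv p x = Du q x + m x * r x"
    and codazzi: "\<And>x. x \<in> S \<Longrightarrow> Du m x = p x * k x - q x * r x"
      "\<And>x. x \<in> S \<Longrightarrow> Dv r x = Du k x - p x * m x"
  obtains c d z e1 e2 n where "p0 \<in> box c d" "box c d \<subseteq> S"
    and "\<And>x. x \<in> box c d \<Longrightarrow> lorentz_frame (e1 x) (e2 x) (n x)"
    and "smooth_on (box c d) z" "smooth_on (box c d) e1" "smooth_on (box c d) e2" "smooth_on (box c d) n"
    and "\<And>x. x \<in> box c d \<Longrightarrow> Du z x = \<Phi> x *\<^sub>R e1 x"
    and "\<And>x. x \<in> box c d \<Longrightarrow> Dv z x = b1 x *\<^sub>R e1 x + b2 x *\<^sub>R e2 x"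
    and "\<And>x. x \<in> box c d \<Longrightarrow> Du e1 x = p x *\<^sub>R e2 x"
    and "\<And>x. x \<in> box c d \<Longrightarrow> Dv e1 x = q x *\<^sub>R e2 x + m x *\<^sub>R n x"
    and "\<And>x. x \<in> box c d \<Longrightarrow> Dv e2 x = q x *\<^sub>R e1 x + k x *\<^sub>R n x"
proof -
  \<comment> \<open>The generators of the system: \<open>t1\<close> and \<open>t2\<close> feed
    \<open>e1\<close> and \<open>e2\<close> into the derivative of \<open>z\<close>,
    \<open>t3\<close> and \<open>t4\<close> are hyperbolic rotations in the planes of
    \<open>e1, e2\<close> and \<open>e2, n\<close>, and \<open>t5\<close> is the Euclidean rotation
    in the plane of \<open>e1, n\<close>. All dependence on the point sits in scalar
    coefficients.\<close>
  define t1 :: "(real^3) \<times> (real^3) \<times> (real^3) \<times> (real^3) \<Rightarrow> (real^3) \<times> (real^3) \<times> (real^3) \<times> (real^3)"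
    where "t1 = (\<lambda>(z, x, y, n). (x, 0, 0, 0))"
  define t2 :: "(real^3) \<times> (real^3) \<times> (real^3) \<times> (real^3) \<Rightarrow> (real^3) \<times> (real^3) \<times> (real^3) \<times> (real^3)"
    where "t2 = (\<lambda>(z, x, y, n). (y, 0, 0, 0))"
  define t3 :: "(real^3) \<times> (real^3) \<times> (real^3) \<times> (real^3) \<Rightarrow> (real^3) \<times> (real^3) \<times> (real^3) \<times> (real^3)"
    where "t3 = (\<lambda>(z, x, y, n). (0, y, x, 0))"
  define t4 :: "(real^3) \<times> (real^3) \<times> (real^3) \<times> (real^3) \<Rightarrow> (real^3) \<times> (real^3) \<times> (real^3) \<times> (real^3)"
    where "t4 = (\<lambda>(z, x, y, n). (0, 0, n, y))"
  define t5 :: "(real^3) \<times> (real^3) \<times> (real^3) \<times> (real^3) \<Rightarrow> (real^3) \<times> (real^3) \<times> (real^3) \<times> (real^3)"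
    where "t5 = (\<lambda>(z, x, y, n). (0, n, 0, - x))"
  have t_simps: "t1 (z, x, y, n) = (x, 0, 0, 0)" "t2 (z, x, y, n) = (y, 0, 0, 0)"
    "t3 (z, x, y, n) = (0, y, x, 0)" "t4 (z, x, y, n) = (0, 0, n, y)" "t5 (z, x, y, n) = (0, n, 0, - x)"
    for z x y n by (simp_all add: t1_def t2_def t3_def t4_def t5_def)
  have bl: "bounded_linear t1" "bounded_linear t2" "bounded_linear t3" "bounded_linear t4" "bounded_linear t5"
    unfolding linear_conv_bounded_linear[symmetric]
    by (auto intro!: linearI simp: t1_def t2_def t3_def t4_def t5_def split: prod.splits)
  define T1 where "T1 = Blinfun t1" define T2 where "T2 = Blinfun t2"
  define T3 where "T3 = Blinfun t3" define T4 where "T4 = Blinfun t4"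
  define T5 where "T5 = Blinfun t5"
  have T: "blinfun_apply T1 = t1" "blinfun_apply T2 = t2" "blinfun_apply T3 = t3"
    "blinfun_apply T4 = t4" "blinfun_apply T5 = t5"
    by (simp_all add: T1_def T2_def T3_def T4_def T5_def bounded_linear_Blinfun_apply bl)
  define A where "A x = \<Phi> x *\<^sub>R T1 + p x *\<^sub>R T3 + r x *\<^sub>R T4" for x
  define B where "B x = b1 x *\<^sub>R T1 + b2 x *\<^sub>R T2 + q x *\<^sub>R T3 + m x *\<^sub>R T5 + k x *\<^sub>R T4" for x
  have smA: "smooth_on S A" and smB: "smooth_on S B"
    unfolding A_def B_def by (intro smooth_on_add smooth_on_scaleR S sm smooth_on_const)+
  have A: "A x (z, e, f, n) = (\<Phi> x *\<^sub>R e, p x *\<^sub>R f, p x *\<^sub>R e + r x *\<^sub>R n, r x *\<^sub>R f)" for x z e f n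
    by (simp add: A_def blinfun.add_left blinfun.scaleR_left T t_simps)
  have B: "B x (z, e, f, n) = (b1 x *\<^sub>R e + b2 x *\<^sub>R f, q x *\<^sub>R f + m x *\<^sub>R n, q x *\<^sub>R e + k x *\<^sub>R n, k x *\<^sub>R f - m x *\<^sub>R e)" for x z e f n
    by (simp add: B_def blinfun.add_left blinfun.scaleR_left T t_simps algebra_simps)
  have flat: "Dv A x + (A x o\<^sub>L B x) = Du B x + (B x o\<^sub>L A x)" if x: "x \<in> S" for x
  proof -
    note d = sm[THEN smooth_on_differentiable, OF x, THEN differentiable_partials(1)]
    have "(A has_derivative (\<lambda>h. (fst h *\<^sub>R Du \<Phi> x + snd h *\<^sub>R Dv \<Phi> x) *\<^sub>R T1
       + (fst h *\<^sub>R Du p x + snd h *\<^sub>R Dv p x) *\<^sub>R T3 + (fst h *\<^sub>R Du r x + snd h *\<^sub>R Dv r x) *\<^sub>R T4)) (at x)"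
      unfolding A_def by (intro has_derivative_add has_derivative_scaleR_left d)
    from has_derivative_Dv[OF this]
    have Av: "Dv A x = Dv \<Phi> x *\<^sub>R T1 + Dv p x *\<^sub>R T3 + Dv r x *\<^sub>R T4" by simp
    have "(B has_derivative (\<lambda>h. (fst h *\<^sub>R Du b1 x + snd h *\<^sub>R Dv b1 x) *\<^sub>R T1
       + (fst h *\<^sub>R Du b2 x + snd h *\<^sub>R Dv b2 x) *\<^sub>R T2
       + (fst h *\<^sub>R Du q x + snd h *\<^sub>R Dv q x) *\<^sub>R T3 + (fst h *\<^sub>R Du m x + snd h *\<^sub>R Dv m x) *\<^sub>R T5
       + (fst h *\<^sub>R Du k x + snd h *\<^sub>R Dv k x) *\<^sub>R T4)) (at x)"
      unfolding B_def by (intro has_derivative_add has_derivative_scaleR_left d)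
    from has_derivative_Du[OF this]
    have Bu: "Du B x = Du b1 x *\<^sub>R T1 + Du b2 x *\<^sub>R T2 + Du q x *\<^sub>R T3 + Du m x *\<^sub>R T5 + Du k x *\<^sub>R T4" by simp
    have b2u: "Du b2 x = \<Phi> x * q x - b1 x * p x" using closed(2)[OF x] by simp
    show ?thesis
    proof (rule blinfun_eqI)
      fix y :: "(real^3) \<times> (real^3) \<times> (real^3) \<times> (real^3)"
      obtain z e f n where y: "y = (z, e, f, n)" by (metis prod.exhaust)
      have "(\<Phi> x * m x) *\<^sub>R n = (b2 x * r x) *\<^sub>R n" by (simp add: closed(3)[OF x])
      then show "(Dv A x + (A x o\<^sub>L B x)) y = (Du B x + (B x o\<^sub>L A x)) y"
        by (simp add: y blinfun.add_left blinfun.scaleR_left A B Av Bu T t_simps b2u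
            closed(1)[OF x] gauss[OF x] codazzi[OF x]) (simp add: algebra_simps)
    qed
  qed
  \<comment> \<open>The initial frame must have its time-like vector in second place, hence the
    third coordinate axis there; the minus sign on the last vector makes the determinant
    positive.\<close>
  obtain c d Y where cd: "p0 \<in> box c d" "cbox c d \<subseteq> S"
    and Y0: "Y c = (0, axis 1 1, axis 3 1, - axis 2 1)"
    and Y: "\<And>x. x \<in> cbox c d \<Longrightarrow>
      (Y has_derivative (\<lambda>h. fst h *\<^sub>R A x (Y x) + snd h *\<^sub>R B x (Y x))) (at x within cbox c d)"
  proof (rule total_linear_system_local_solution[OF S smA smB flat, where ?y0.0 = "(0, axis 1 1, axis 3 1, - axis 2 1)"], goal_cases)
    case (2 c d W)
    show thesis by (rule 2(1)[of c d W]) (use 2 in auto)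
  qed
  define z where "z x = fst (Y x)" for x
  define e1 where "e1 x = fst (snd (Y x))" for x
  define e2 where "e2 x = fst (snd (snd (Y x)))" for x
  define n where "n x = snd (snd (snd (Y x)))" for x
  have Yx: "Y x = (z x, e1 x, e2 x, n x)" for x by (simp add: z_def e1_def e2_def n_def)
  have D: "(e1 has_derivative (\<lambda>h. fst h *\<^sub>R (p x *\<^sub>R e2 x) + snd h *\<^sub>R (q x *\<^sub>R e2 x + m x *\<^sub>R n x))) (at x within cbox c d)"
    "(e2 has_derivative (\<lambda>h. fst h *\<^sub>R (p x *\<^sub>R e1 x + r x *\<^sub>R n x) + snd h *\<^sub>R (q x *\<^sub>R e1 x + k x *\<^sub>R n x))) (at x within cbox c d)"
    "(n has_derivative (\<lambda>h. fst h *\<^sub>R (r x *\<^sub>R e2 x) + snd h *\<^sub>R (k x *\<^sub>R e2 x - m x *\<^sub>R e1 x))) (at x within cbox c d)"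
    "(z has_derivative (\<lambda>h. fst h *\<^sub>R (\<Phi> x *\<^sub>R e1 x) + snd h *\<^sub>R (b1 x *\<^sub>R e1 x + b2 x *\<^sub>R e2 x))) (at x within cbox c d)"
    if "x \<in> cbox c d" for x
  proof -
    have Yd: "(Y has_derivative (\<lambda>h. (fst h *\<^sub>R (\<Phi> x *\<^sub>R e1 x) + snd h *\<^sub>R (b1 x *\<^sub>R e1 x + b2 x *\<^sub>R e2 x),
      fst h *\<^sub>R (p x *\<^sub>R e2 x) + snd h *\<^sub>R (q x *\<^sub>R e2 x + m x *\<^sub>R n x),
      fst h *\<^sub>R (p x *\<^sub>R e1 x + r x *\<^sub>R n x) + snd h *\<^sub>R (q x *\<^sub>R e1 x + k x *\<^sub>R n x),
      fst h *\<^sub>R (r x *\<^sub>R e2 x) + snd h *\<^sub>R (k x *\<^sub>R e2 x - m x *\<^sub>R e1 x)))) (at x within cbox c d)"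
      using Y[OF that] by (simp add: Yx A B)
    note s1 = has_derivative_snd[OF Yd] note s2 = has_derivative_snd[OF s1]
    show "(z has_derivative (\<lambda>h. fst h *\<^sub>R (\<Phi> x *\<^sub>R e1 x) + snd h *\<^sub>R (b1 x *\<^sub>R e1 x + b2 x *\<^sub>R e2 x))) (at x within cbox c d)"
      using has_derivative_fst[OF Yd] by (simp add: z_def[abs_def])
    show "(e1 has_derivative (\<lambda>h. fst h *\<^sub>R (p x *\<^sub>R e2 x) + snd h *\<^sub>R (q x *\<^sub>R e2 x + m x *\<^sub>R n x))) (at x within cbox c d)"
      using has_derivative_fst[OF s1] unfolding e1_def[abs_def, symmetric] by simp
    show "(e2 has_derivative (\<lambda>h. fst h *\<^sub>R (p x *\<^sub>R e1 x + r x *\<^sub>R n x) + snd h *\<^sub>R (q x *\<^sub>R e1 x + k x *\<^sub>R n x))) (at x within cbox c d)"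
      using has_derivative_fst[OF s2] unfolding e2_def[abs_def, symmetric] by simp
    show "(n has_derivative (\<lambda>h. fst h *\<^sub>R (r x *\<^sub>R e2 x) + snd h *\<^sub>R (k x *\<^sub>R e2 x - m x *\<^sub>R e1 x))) (at x within cbox c d)"
      using has_derivative_snd[OF s2] unfolding n_def[abs_def, symmetric] by simp
  qed
  have "c \<in> cbox c d" using cd(1) by (fastforce simp: mem_box)
  have init: "lorentz_frame (e1 c) (e2 c) (n c)"
    by (simp add: e1_def e2_def n_def Y0 lorentz_frame_def lorentz_def det_3 axis_def)
  have frame: "lorentz_frame (e1 x) (e2 x) (n x)" if "x \<in> cbox c d" for x
    by (rule frame_system_completeness[OF convex_box(1) \<open>c \<in> cbox c d\<close> D(1) D(2) D(3) init that])
  have sub: "box c d \<subseteq> cbox c d" by (rule box_subset_cbox)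
  have at: "at x within cbox c d = at x" if "x \<in> box c d" for x
    using that by (intro at_within_interior) (simp add: interior_cbox)
  have D': "(Y has_derivative (\<lambda>h. fst h *\<^sub>R A x (Y x) + snd h *\<^sub>R B x (Y x))) (at x)" if "x \<in> box c d" for x
    using Y[of x] at[OF that] that sub by auto
  have smY: "smooth_on (box c d) Y"
  proof (rule smooth_on_total_system)
    show "smooth_on (box c d) A" "smooth_on (box c d) B"
      using smA smB sub cd(2) by (auto intro: smooth_on_subset)
    show "Y differentiable at x" "Du Y x = A x (Y x)" "Dv Y x = B x (Y x)" if "x \<in> box c d" for x
      using D'[OF that] has_derivative_Du[OF D'[OF that]] has_derivative_Dv[OF D'[OF that]]
      by (auto simp: differentiable_def)
  qed (rule open_box)
  have comp: "smooth_on (box c d) (\<lambda>x. L (Y x))" if "bounded_linear L" for L :: "_ \<Rightarrow> real^3"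
    using smY Ck_on_bounded_linear[OF that open_box, of _ c d Y] by (simp add: smooth_on_def)
  show ?thesis
  proof (rule that[of c d e1 e2 n z])
    show "box c d \<subseteq> S" using sub cd by blast
    show "lorentz_frame (e1 x) (e2 x) (n x)" if "x \<in> box c d" for x using frame that sub by blast
    show "smooth_on (box c d) z" "smooth_on (box c d) e1" "smooth_on (box c d) e2" "smooth_on (box c d) n"
      unfolding z_def e1_def e2_def n_def
      by (intro comp bounded_linear_fst bounded_linear_snd
          bounded_linear_compose[OF bounded_linear_fst] bounded_linear_compose[OF bounded_linear_snd])+
    fix x assume x: "x \<in> box c d"
    have xc: "x \<in> cbox c d" using x sub by blast
    note Dx = D[OF xc, unfolded at[OF x]]
    show "Du z x = \<Phi> x *\<^sub>R e1 x" "Dv z x = b1 x *\<^sub>R e1 x + b2 x *\<^sub>R e2 x" "Du e1 x = p x *\<^sub>R e2 x"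
      "Dv e1 x = q x *\<^sub>R e2 x + m x *\<^sub>R n x" "Dv e2 x = q x *\<^sub>R e1 x + k x *\<^sub>R n x"
      using has_derivative_Du[OF Dx(1)] has_derivative_Dv[OF Dx(1)] has_derivative_Dv[OF Dx(2)]
        has_derivative_Du[OF Dx(4)] has_derivative_Dv[OF Dx(4)] by simp_all
  qed (rule cd)
qed

subsection \<open>Surfaces with an adapted frame\<close>

lemma Du_scaleR:
  assumes "f differentiable (at x)" "g differentiable (at x)"
  shows "Du (\<lambda>y. f y *\<^sub>R g y) x = f x *\<^sub>R Du g x + Du f x *\<^sub>R g x"
    and "Dv (\<lambda>y. f y *\<^sub>R g y) x = f x *\<^sub>R Dv g x + Dv f x *\<^sub>R g x"
  using has_derivative_Du[OF has_derivative_scaleR[OF assms[THEN differentiable_partials(1)]]]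
    has_derivative_Dv[OF has_derivative_scaleR[OF assms[THEN differentiable_partials(1)]]] by simp_all

lemma Du_add:
  assumes "f differentiable (at x)" "g differentiable (at x)"
  shows "Du (\<lambda>y. f y + g y) x = Du f x + Du g x"
    and "Dv (\<lambda>y. f y + g y) x = Dv f x + Dv g x"
  using has_derivative_Du[OF has_derivative_add[OF assms[THEN differentiable_partials(1)]]]
    has_derivative_Dv[OF has_derivative_add[OF assms[THEN differentiable_partials(1)]]] by simp_all

text \<open>\<open>L\<close> vanishes because \<open>Du e1\<close> has no normal component. The
  normal component of \<open>z_vv\<close> is \<open>\<Psi> (a m + w k)\<close>, so the premise
  \<open>N\<close> is precisely the second asymptotic condition.\<close>

lemma adapted_surface_coefficients:
  fixes \<Phi> \<Psi> a w :: "real \<times> real \<Rightarrow> real"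
  assumes W: "open W" "x \<in> W"
    and fr: "\<And>y. y \<in> W \<Longrightarrow> lorentz_frame (e1 y) (e2 y) (n y)"
    and zu: "\<And>y. y \<in> W \<Longrightarrow> Du z y = \<Phi> y *\<^sub>R e1 y"
    and zv: "\<And>y. y \<in> W \<Longrightarrow> Dv z y = \<Psi> y *\<^sub>R (a y *\<^sub>R e1 y + w y *\<^sub>R e2 y)"
    and pos: "\<Phi> x > 0" "\<Psi> x > 0" "w x > 0" and w: "(w x)\<^sup>2 = 1 + (a x)\<^sup>2"
    and sm: "smooth_on W \<Phi>" "smooth_on W \<Psi>" "smooth_on W a" "smooth_on W w" "smooth_on W e1" "smooth_on W e2"
    and e: "Du e1 x = p *\<^sub>R e2 x" "Dv e1 x = q *\<^sub>R e2 x + m *\<^sub>R n x" "Dv e2 x = q *\<^sub>R e1 x + k *\<^sub>R n x"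
    and N: "a x * m + w x * k = 0"
  shows "unit_normal z x = n x" "coefE z x = (\<Phi> x)\<^sup>2" "coefF z x = a x * \<Phi> x * \<Psi> x"
    "coefG z x = - (\<Psi> x)\<^sup>2" "coefL z x = 0" "coefM z x = \<Phi> x * m" "coefN z x = 0"
proof -
  note f = lorentz_frameD[OF fr[OF W(2)]]
  show un: "unit_normal z x = n x"
    unfolding unit_normal_def
    by (rule adapted_frame_normal_unique[OF fr[OF W(2)] pos zu[OF W(2)] zv[OF W(2)]])
  show "coefE z x = (\<Phi> x)\<^sup>2" "coefF z x = a x * \<Phi> x * \<Psi> x"
    by (simp_all add: coefE_def coefF_def zu zv W lorentz_simps f power2_eq_square)
  have "coefG z x = (\<Psi> x)\<^sup>2 * ((a x)\<^sup>2 - (w x)\<^sup>2)"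
    by (simp add: coefG_def zv W lorentz_simps f power2_eq_square algebra_simps)
  then show "coefG z x = - (\<Psi> x)\<^sup>2" by (simp add: w)
  have d: "g differentiable (at x)" if "smooth_on W g" for g :: "real \<times> real \<Rightarrow> 'c::real_normed_vector"
    by (rule smooth_on_differentiable[OF that W(2)])
  have c1: "Du (Du z) x = Du (\<lambda>y. \<Phi> y *\<^sub>R e1 y) x" "Dv (Du z) x = Dv (\<lambda>y. \<Phi> y *\<^sub>R e1 y) x"
    by (rule Du_Dv_cong[OF W zu], assumption)+
  have c2: "Dv (Dv z) x = Dv (\<lambda>y. \<Psi> y *\<^sub>R (a y *\<^sub>R e1 y + w y *\<^sub>R e2 y)) x"
    by (rule Du_Dv_cong[OF W zv])
  have s: "smooth_on W (\<lambda>y. a y *\<^sub>R e1 y + w y *\<^sub>R e2 y)"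
    by (intro smooth_on_add smooth_on_scaleR W sm)
  show "coefL z x = 0" "coefM z x = \<Phi> x * m"
    unfolding coefL_def coefM_def un c1 Du_scaleR[OF d[OF sm(1)] d[OF sm(5)]] e
    by (simp_all add: lorentz_simps f)
  have "Dv (\<lambda>y. a y *\<^sub>R e1 y + w y *\<^sub>R e2 y) x
     = (a x *\<^sub>R Dv e1 x + Dv a x *\<^sub>R e1 x) + (w x *\<^sub>R Dv e2 x + Dv w x *\<^sub>R e2 x)"
    by (subst Du_add(2)) (auto intro!: d smooth_on_scaleR W sm simp: Du_scaleR(2)[OF d d] sm)
  then show "coefN z x = 0"
    unfolding coefN_def un c2 Du_scaleR[OF d[OF sm(2)] d[OF s]] e
    using N by (simp add: lorentz_simps f e)
qed

text \<open>Here \<open>g\<close> is the logarithmic derivative of \<open>y\<close>. Using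
  \<open>min\<close> and \<open>max\<close> covers an upper limit on either side of the base
  point.\<close>

lemma interval_integral_eq_ln_diff:
  fixes y g :: "real \<Rightarrow> real"
  assumes "\<And>s. s \<in> {min a b..max a b} \<Longrightarrow> (y has_real_derivative g s * y s) (at s)"
    and "\<And>s. s \<in> {min a b..max a b} \<Longrightarrow> y s > 0"
    and "continuous_on {min a b..max a b} g"
  shows "(LBINT s=a..b. g s) = ln (y b) - ln (y a)"
proof (rule interval_integral_FTC_finite[OF assms(3)])
  fix s assume "min a b \<le> s" "s \<le> max a b"
  then have s: "s \<in> {min a b..max a b}" by simp
  have "((\<lambda>s. ln (y s)) has_real_derivative g s) (at s)"
    using DERIV_chain2[OF DERIV_ln_divide[OF assms(2)[OF s]] assms(1)[OF s]] assms(2)[OF s] by simp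
  then show "((\<lambda>s. ln (y s)) has_vector_derivative g s) (at s within {min a b..max a b})"
    by (auto simp: has_real_derivative_iff_has_vector_derivative intro: has_vector_derivative_at_within)
qed

text \<open>On an axis the system reduces to two linear equations for \<open>x\<close> and \<open>y\<close> with
  \<open>(x - y)' = - L' (x - y)\<close>.\<close>

lemma axis_solutions_agree:
  fixes x y g l L :: "real \<Rightarrow> real"
  assumes t0: "t0 \<in> {a..b}" and t: "t \<in> {a..b}" and g: "continuous_on {a..b} g"
    and x: "\<And>t. t \<in> {a..b} \<Longrightarrow> x t = exp ((LBINT s=t0..t. g s) + c)"
    and y: "\<And>t. t \<in> {a..b} \<Longrightarrow> (y has_real_derivative (g t + l t) * x t - l t * y t) (at t)"
    and L: "\<And>t. t \<in> {a..b} \<Longrightarrow> (L has_real_derivative l t) (at t)"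
    and y0: "y t0 = x t0"
  shows "x t = y t"
proof -
  \<comment> \<open>\<open>exp (L t)\<close> is the integrating factor. The function
    \<open>x\<close> appears through its defining formula and is differentiated within the interval,
    since the formula is known only there.\<close>
  have D: "((\<lambda>t. (exp ((LBINT s=t0..t. g s) + c) - y t) * exp (L t)) has_derivative (\<lambda>_. 0)) (at t within {a..b})"
    if t: "t \<in> {a..b}" for t
  proof -
    have "((\<lambda>t. LBINT s=t0..t. g s) has_real_derivative g t) (at t within {a..b})"
      using interval_integral_FTC2[of a t0 b g t] t0 t g
      by (simp add: has_real_derivative_iff_has_vector_derivative)
    then have "((\<lambda>t. (exp ((LBINT s=t0..t. g s) + c) - y t) * exp (L t)) has_real_derivative
       (exp ((LBINT s=t0..t. g s) + c) * g t - ((g t + l t) * x t - l t * y t)) * exp (L t)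
        + (exp ((LBINT s=t0..t. g s) + c) - y t) * (exp (L t) * l t)) (at t within {a..b})"
      using y[OF t, THEN has_field_derivative_at_within] L[OF t, THEN has_field_derivative_at_within]
      by (auto intro!: derivative_eq_intros)
    moreover have "(exp ((LBINT s=t0..t. g s) + c) * g t - ((g t + l t) * x t - l t * y t)) * exp (L t)
        + (exp ((LBINT s=t0..t. g s) + c) - y t) * (exp (L t) * l t) = 0"
      unfolding x[OF t, symmetric] by (simp add: algebra_simps)
    ultimately show ?thesis by (simp add: has_field_derivative_def lambda_zero)
  qed
  have "(x t - y t) * exp (L t) = (x t0 - y t0) * exp (L t0)"
    using has_derivative_zero_unique[OF _ D t t0] unfolding x[OF t] x[OF t0] by simp
  then show ?thesis using y0 by simp
qed

subsection \<open>Existence\<close>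

locale curvature_data =
  fixes K H a logK4 :: "real \<times> real \<Rightarrow> real" and D :: "(real \<times> real) set"
  assumes open_D: "open D"
    and smooth_K: "smooth_on D K" and smooth_H: "smooth_on D H"
    and K_pos: "p \<in> D \<Longrightarrow> K p > 0" and KH_pos: "p \<in> D \<Longrightarrow> K p - (H p)\<^sup>2 > 0"
    and a_def: "a = (\<lambda>p. H p / sqrt (K p - (H p)\<^sup>2))"
    and logK4_def: "logK4 = (\<lambda>p. ln (root 4 (K p)))"
begin

definition w where "w p = sqrt (1 + (a p)\<^sup>2)"

lemma smooth_a: "smooth_on D a"
  unfolding a_def using KH_pos
  by (intro smooth_on_divide smooth_on_sqrt smooth_on_diff smooth_on_power2 open_D smooth_K smooth_H)
     (auto dest!: KH_pos)

lemma w_pos: "w p > 0" and w_sq: "(w p)\<^sup>2 = 1 + (a p)\<^sup>2"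
  by (auto simp: w_def add_pos_nonneg)

lemma smooth_w: "smooth_on D w"
  unfolding w_def
  by (intro smooth_on_sqrt smooth_on_add smooth_on_power2 smooth_on_const smooth_a open_D)
     (simp add: add_pos_nonneg)

lemma smooth_sqrt_K: "smooth_on D (\<lambda>p. sqrt (K p))"
  by (intro smooth_on_sqrt open_D smooth_K K_pos)

lemma a_eq: "a p = H p / sqrt (K p - (H p)\<^sup>2)" by (simp add: a_def)

lemma w_eq: assumes "p \<in> D" shows "w p = sqrt (K p) / sqrt (K p - (H p)\<^sup>2)"
proof -
  have "1 + (a p)\<^sup>2 = K p / (K p - (H p)\<^sup>2)"
    using KH_pos[OF assms] by (simp add: a_eq power_divide field_simps)
  then show ?thesis by (simp add: w_def real_sqrt_divide)
qed

text \<open>The frame construction produces the mean curvature in the form on the left. Both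
  \<open>a\<close> and \<open>w\<close> have denominator \<open>sqrt (K - H * H)\<close>, which
  cancels.\<close>

lemma H_eq: "p \<in> D \<Longrightarrow> a p * sqrt (K p) / w p = H p"
  using KH_pos[of p] K_pos[of p] by (simp add: w_eq a_eq)

lemma logK4_eq: "p \<in> D \<Longrightarrow> logK4 p = ln (K p) / 4"
  using K_pos[of p] by (simp add: logK4_def ln_root)

lemma logK4_eq_ln_sqrt: "p \<in> D \<Longrightarrow> logK4 p = (1/2) * ln (sqrt (K p))"
  using K_pos[of p] by (simp add: logK4_eq ln_sqrt)

lemma logK4_partials:
  assumes "(u, v) \<in> D"
  shows "((\<lambda>t. logK4 (t, v)) has_real_derivative Du K (u, v) / (4 * K (u, v))) (at u)"
    and "((\<lambda>t. logK4 (u, t)) has_real_derivative Dv K (u, v) / (4 * K (u, v))) (at v)"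
proof -
  have pos: "K (u, v) > 0" by (rule K_pos[OF assms])
  have "((\<lambda>t. ln (K (t, v)) / 4) has_real_derivative Du K (u, v) / (4 * K (u, v))) (at u)"
    using DERIV_cdivide[OF DERIV_chain2[OF DERIV_ln_divide[OF pos] smooth_on_real_partials(1)[OF smooth_K assms]], of 4]
    by (simp add: field_simps)
  then show "((\<lambda>t. logK4 (t, v)) has_real_derivative Du K (u, v) / (4 * K (u, v))) (at u)"
    by (rule DERIV_cong_ev[THEN iffD1, rotated 3])
       (use eventually_line_in_open(1)[OF open_D assms] in \<open>auto elim!: eventually_mono simp: logK4_eq\<close>)
  have "((\<lambda>t. ln (K (u, t)) / 4) has_real_derivative Dv K (u, v) / (4 * K (u, v))) (at v)"
    using DERIV_cdivide[OF DERIV_chain2[OF DERIV_ln_divide[OF pos] smooth_on_real_partials(2)[OF smooth_K assms]], of 4]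
    by (simp add: field_simps)
  then show "((\<lambda>t. logK4 (u, t)) has_real_derivative Dv K (u, v) / (4 * K (u, v))) (at v)"
    by (rule DERIV_cong_ev[THEN iffD1, rotated 3])
       (use eventually_line_in_open(2)[OF open_D assms] in \<open>auto elim!: eventually_mono simp: logK4_eq\<close>)
qed

lemma Du_logK4: "p \<in> D \<Longrightarrow> Du logK4 p = Du K p / (4 * K p)"
  and Dv_logK4: "p \<in> D \<Longrightarrow> Dv logK4 p = Dv K p / (4 * K p)"
  using Du_real_eqI[OF logK4_partials(1)] Dv_real_eqI[OF logK4_partials(2)] by (cases p; simp)+

lemma w_partials:
  assumes "(u, v) \<in> D"
  shows "((\<lambda>t. w (t, v)) has_real_derivative a (u, v) * Du a (u, v) / w (u, v)) (at u)"
    and "((\<lambda>t. w (u, t)) has_real_derivative a (u, v) * Dv a (u, v) / w (u, v)) (at v)"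
proof -
  have "1 + (a (u, v))\<^sup>2 > 0" by (simp add: add_pos_nonneg)
  then show "((\<lambda>t. w (t, v)) has_real_derivative a (u, v) * Du a (u, v) / w (u, v)) (at u)"
    "((\<lambda>t. w (u, t)) has_real_derivative a (u, v) * Dv a (u, v) / w (u, v)) (at v)"
    unfolding w_def
    by (auto intro!: derivative_eq_intros smooth_on_real_partials[OF smooth_a assms] simp: field_simps)
qed

lemma sqrt_K_partials:
  assumes "(u, v) \<in> D"
  shows "((\<lambda>t. sqrt (K (t, v))) has_real_derivative Du K (u, v) / (2 * sqrt (K (u, v)))) (at u)"
    and "((\<lambda>t. sqrt (K (u, t))) has_real_derivative Dv K (u, v) / (2 * sqrt (K (u, v)))) (at v)"
  using K_pos[OF assms]
  by (auto intro!: derivative_eq_intros smooth_on_real_partials[OF smooth_K assms] simp: field_simps)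

end

text \<open>Pure algebra in the values at one point, with \<open>F\<close> and \<open>P\<close> for
  \<open>\<Phi>\<close> and \<open>\<Psi>\<close>: the left side is \<open>p_v\<close> and the right
  side is \<open>q_u + m r\<close>. Their difference is the long equation multiplied by
  \<open>w * F * P\<close>.\<close>

lemma gauss_equation_rearranged:
  fixes F P K a au av auv w s g1 g2 g1u g2v Ku Kv :: real
  assumes pos: "F > 0" "P > 0" "K > 0" "w > 0" and w: "w\<^sup>2 = 1 + a\<^sup>2" and s: "s\<^sup>2 = K"
    and Ku: "Ku = g1 * F * K" and Kv: "Kv = g2 * P * K"
    and gauss: "1 / (F * P) * (auv / (1 + a\<^sup>2) - a * au * av / (1 + a\<^sup>2)\<^sup>2 - a * Ku * Kv / (8 * K\<^sup>2))
        - a * au * Ku / (4 * (1 + a\<^sup>2) * K * F\<^sup>2) + a * av * Kv / (4 * (1 + a\<^sup>2) * K * P\<^sup>2)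
        + Ku\<^sup>2 / (16 * F\<^sup>2 * K\<^sup>2) - Kv\<^sup>2 / (16 * P\<^sup>2 * K\<^sup>2)
        - 1 / (4 * F) * g1u + 1 / (4 * P) * g2v + K = 0"
  shows "- (1/4) * ((a * av / w) * F * g2 - w * (F * P / 4 * (g2 + a * g1)) * g2 + w * F * g2v)
      - (auv / w - au * (a * av / w) / w\<^sup>2)
    = - (1/4) * ((a * au / w) * P * g1 + w * (F * P / 4 * (a * g2 - g1)) * g1 + w * P * g1u)
      + (w * s * P) * (s * F)" (is "?l = ?r")
proof -
  \<comment> \<open>The left side of the long equation after \<open>Ku\<close> and \<open>Kv\<close>
    are expressed by \<open>g1\<close> and \<open>g2\<close>, which cancels every quotient by
    \<open>K\<close>, and \<open>1 + a * a\<close> is written as the square of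
    \<open>w\<close>.\<close>
  define G where "G = 1 / (F * P) * (auv / w\<^sup>2 - a * au * av / w ^ 4) - a * g1 * g2 / 8
     - a * au * g1 / (4 * w\<^sup>2 * F) + a * av * g2 / (4 * w\<^sup>2 * P) + g1\<^sup>2 / 16 - g2\<^sup>2 / 16
     - 1 / (4 * F) * g1u + 1 / (4 * P) * g2v + K"
  have w4: "(w\<^sup>2)\<^sup>2 = w ^ 4" by simp
  have t: "1 / (F * P) * (auv / w\<^sup>2 - a * au * av / w ^ 4 - a * (g1 * F * K) * (g2 * P * K) / (8 * K\<^sup>2))
      = 1 / (F * P) * (auv / w\<^sup>2 - a * au * av / w ^ 4) - a * g1 * g2 / 8"
    "a * au * (g1 * F * K) / (4 * w\<^sup>2 * K * F\<^sup>2) = a * au * g1 / (4 * w\<^sup>2 * F)"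
    "a * av * (g2 * P * K) / (4 * w\<^sup>2 * K * P\<^sup>2) = a * av * g2 / (4 * w\<^sup>2 * P)"
    "(g1 * F * K)\<^sup>2 / (16 * F\<^sup>2 * K\<^sup>2) = g1\<^sup>2 / 16" "(g2 * P * K)\<^sup>2 / (16 * P\<^sup>2 * K\<^sup>2) = g2\<^sup>2 / 16"
    using pos by (simp_all add: field_simps power2_eq_square)
  have "G = 0" using gauss unfolding Ku Kv w[symmetric] w4 unfolding t G_def .
  moreover have "?r - ?l = w * F * P * G"
  proof -
    have m0: "w * F * P * G = w * (auv / w\<^sup>2 - a * au * av / w ^ 4) - w * F * P * (a * g1 * g2 / 8)
       - w * P * (a * au * g1 / (4 * w\<^sup>2)) + w * F * (a * av * g2 / (4 * w\<^sup>2)) + w * F * P * (g1\<^sup>2 / 16) - w * F * P * (g2\<^sup>2 / 16)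
       - w * P * (g1u / 4) + w * F * (g2v / 4) + w * F * P * s\<^sup>2"
      using pos by (simp add: G_def s algebra_simps)
    have m: "w * (auv / w\<^sup>2 - a * au * av / w ^ 4) = auv / w - au * (a * av / w) / w\<^sup>2"
      "w * P * (a * au * g1 / (4 * w\<^sup>2)) = (1/4) * ((a * au / w) * P * g1)"
      "w * F * (a * av * g2 / (4 * w\<^sup>2)) = (1/4) * ((a * av / w) * F * g2)"
      using pos by (simp_all add: field_simps power2_eq_square eval_nat_numeral)
    show ?thesis unfolding m0 m
      by (simp add: algebra_simps power2_eq_square diff_divide_distrib add_divide_distrib)
  qed
  ultimately show ?thesis by simp
qed

locale goursat_solution = curvature_data +
  fixes \<Phi> \<Psi> :: "real \<times> real \<Rightarrow> real" and R :: "(real \<times> real) set" and u0 v0 :: real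
  assumes R: "open_rectangle R" "(u0, v0) \<in> R" "R \<subseteq> D"
    and smooth_sol: "smooth_on R \<Phi>" "smooth_on R \<Psi>"
    and pos_sol: "p \<in> R \<Longrightarrow> \<Phi> p > 0" "p \<in> R \<Longrightarrow> \<Psi> p > 0"
    and pde: "p \<in> R \<Longrightarrow> Dv \<Phi> p = - (1 / (4 * K p)) * (Dv K p * \<Phi> p + a p * Du K p * \<Psi> p)"
      "p \<in> R \<Longrightarrow> Du \<Psi> p = (1 / (4 * K p)) * (a p * Dv K p * \<Phi> p - Du K p * \<Psi> p)"
    and initial:
      "(u, v0) \<in> R \<Longrightarrow> \<Phi> (u, v0) =
         exp ((LBINT t=u0..u. a (t, v0) * Dv logK4 (t, v0) - Du logK4 (t, v0)) - logK4 (u0, v0))"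
      "(u0, v) \<in> R \<Longrightarrow> \<Psi> (u0, v) =
         exp ((LBINT s=v0..v. - Dv logK4 (u0, s) - a (u0, s) * Du logK4 (u0, s)) - logK4 (u0, v0))"
    and gauss_eq: "p \<in> R \<Longrightarrow>
        1 / (\<Phi> p * \<Psi> p) *
          (Dv (Du a) p / (1 + (a p)\<^sup>2) - a p * Du a p * Dv a p / (1 + (a p)\<^sup>2)\<^sup>2
            - a p * Du K p * Dv K p / (8 * (K p)\<^sup>2))
        - a p * Du a p * Du K p / (4 * (1 + (a p)\<^sup>2) * K p * (\<Phi> p)\<^sup>2)
        + a p * Dv a p * Dv K p / (4 * (1 + (a p)\<^sup>2) * K p * (\<Psi> p)\<^sup>2)
        + (Du K p)\<^sup>2 / (16 * (\<Phi> p)\<^sup>2 * (K p)\<^sup>2)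
        - (Dv K p)\<^sup>2 / (16 * (\<Psi> p)\<^sup>2 * (K p)\<^sup>2)
        - 1 / (4 * \<Phi> p) * Du (\<lambda>q. Du K q / (\<Phi> q * K q)) p
        + 1 / (4 * \<Psi> p) * Dv (\<lambda>q. Dv K q / (\<Psi> q * K q)) p
        + K p = 0"
begin

lemma open_R: "open R" using R(1) by (auto simp: open_rectangle_def)

lemma RD: "p \<in> R \<Longrightarrow> p \<in> D" using R(3) by blast

lemmas smooth_R = smooth_a[THEN smooth_on_subset, OF R(3)] smooth_w[THEN smooth_on_subset, OF R(3)]
  smooth_sqrt_K[THEN smooth_on_subset, OF R(3)] smooth_K[THEN smooth_on_subset, OF R(3)]

text \<open>Logarithmic derivatives of \<open>K\<close>, rescaled by the speeds of the parameter
  lines. They are the functions differentiated in the last terms of the long equation, and they turn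
  the derivatives of \<open>K\<close>, \<open>\<Phi>\<close> and \<open>\<Psi>\<close> occurring in
  the system into polynomials.\<close>

definition g1 where "g1 q = Du K q / (\<Phi> q * K q)"
definition g2 where "g2 q = Dv K q / (\<Psi> q * K q)"

lemma smooth_g1: "smooth_on R g1" and smooth_g2: "smooth_on R g2"
proof -
  have "\<Phi> q * K q \<noteq> 0" "\<Psi> q * K q \<noteq> 0" if "q \<in> R" for q
    using pos_sol[OF that] K_pos[OF RD[OF that]] by auto
  then show "smooth_on R g1" "smooth_on R g2" unfolding g1_def g2_def
    by (intro smooth_on_divide smooth_on_mult open_R smooth_sol smooth_R smooth_on_Du smooth_on_Dv; blast)+
qed

lemma K_partials: "p \<in> R \<Longrightarrow> Du K p = g1 p * \<Phi> p * K p" "p \<in> R \<Longrightarrow> Dv K p = g2 p * \<Psi> p * K p"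
  using pos_sol[of p] K_pos[OF RD, of p] by (simp_all add: g1_def g2_def)

lemma sol_partials:
  assumes "(u, v) \<in> R"
  shows "((\<lambda>t. \<Phi> (u, t)) has_real_derivative - (\<Phi> (u, v) * \<Psi> (u, v) / 4 * (g2 (u, v) + a (u, v) * g1 (u, v)))) (at v)"
    and "((\<lambda>t. \<Psi> (t, v)) has_real_derivative \<Phi> (u, v) * \<Psi> (u, v) / 4 * (a (u, v) * g2 (u, v) - g1 (u, v))) (at u)"
proof -
  note k = K_pos[OF RD[OF assms]]
  have "Dv \<Phi> (u, v) = - (\<Phi> (u, v) * \<Psi> (u, v) / 4 * (g2 (u, v) + a (u, v) * g1 (u, v)))"
    "Du \<Psi> (u, v) = \<Phi> (u, v) * \<Psi> (u, v) / 4 * (a (u, v) * g2 (u, v) - g1 (u, v))"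
    unfolding pde[OF assms] K_partials[OF assms] using k by (simp_all add: field_simps)
  with smooth_on_real_partials[OF smooth_sol(1) assms] smooth_on_real_partials[OF smooth_sol(2) assms]
  show "((\<lambda>t. \<Phi> (u, t)) has_real_derivative - (\<Phi> (u, v) * \<Psi> (u, v) / 4 * (g2 (u, v) + a (u, v) * g1 (u, v)))) (at v)"
    "((\<lambda>t. \<Psi> (t, v)) has_real_derivative \<Phi> (u, v) * \<Psi> (u, v) / 4 * (a (u, v) * g2 (u, v) - g1 (u, v))) (at u)"
    by simp_all
qed

lemma sqrt_K_partials':
  assumes "(u, v) \<in> R"
  shows "((\<lambda>t. sqrt (K (t, v))) has_real_derivative g1 (u, v) * \<Phi> (u, v) * sqrt (K (u, v)) / 2) (at u)"
    and "((\<lambda>t. sqrt (K (u, t))) has_real_derivative g2 (u, v) * \<Psi> (u, v) * sqrt (K (u, v)) / 2) (at v)"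
proof -
  have k: "K (u, v) > 0" by (rule K_pos[OF RD[OF assms]])
  then have "K (u, v) / (2 * sqrt (K (u, v))) = sqrt (K (u, v)) / 2"
    by (simp add: real_div_sqrt flip: divide_divide_eq_left')
  then have c: "c * K (u, v) / (2 * sqrt (K (u, v))) = c * sqrt (K (u, v)) / 2" for c
    by (metis times_divide_eq_right)
  from sqrt_K_partials[OF RD[OF assms]]
  show "((\<lambda>t. sqrt (K (t, v))) has_real_derivative g1 (u, v) * \<Phi> (u, v) * sqrt (K (u, v)) / 2) (at u)"
    "((\<lambda>t. sqrt (K (u, t))) has_real_derivative g2 (u, v) * \<Psi> (u, v) * sqrt (K (u, v)) / 2) (at v)"
    unfolding K_partials[OF assms] c .
qed

text \<open>The coefficients \<open>p, q, r, m, k\<close> of the structure equations, with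
  \<open>f_u = - \<Phi> g1 / 4\<close> and \<open>f_v = - \<Psi> g2 / 4\<close> inserted. The choice
  of \<open>fk\<close> makes \<open>a m + w k = 0\<close>, i.e. \<open>N = 0\<close>.\<close>

definition fp where "fp x = - (1/4) * (w x * \<Phi> x * g2 x) - Du a x / w x"
definition fq where "fq x = - (1/4) * (w x * \<Psi> x * g1 x)"
definition fr where "fr x = sqrt (K x) * \<Phi> x"
definition fm where "fm x = w x * sqrt (K x) * \<Psi> x"
definition fk where "fk x = - (a x * sqrt (K x) * \<Psi> x)"

lemma smooth_coefficients:
  "smooth_on R fp" "smooth_on R fq" "smooth_on R fr" "smooth_on R fm" "smooth_on R fk"
  "smooth_on R (\<lambda>x. a x * \<Psi> x)" "smooth_on R (\<lambda>x. w x * \<Psi> x)"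
  unfolding fp_def fq_def fr_def fm_def fk_def
  by (intro smooth_on_diff smooth_on_minus smooth_on_divide smooth_on_mult open_R smooth_sol smooth_R
      smooth_on_const smooth_on_Du smooth_g1 smooth_g2; use w_pos less_irrefl in metis)+

text \<open>The equations for \<open>\<Phi>_v\<close> and \<open>\<Psi>_u\<close> give the first two
  closedness conditions and both Codazzi equations; the third closedness condition is an identity.
  The fourth claim is where the long equation is used.\<close>

lemma compatibility:
  assumes x: "x \<in> R"
  shows "Dv \<Phi> x = Du (\<lambda>x. a x * \<Psi> x) x + (w x * \<Psi> x) * fp x"
    and "\<Phi> x * fq x = (a x * \<Psi> x) * fp x + Du (\<lambda>x. w x * \<Psi> x) x"
    and "\<Phi> x * fm x = (w x * \<Psi> x) * fr x"
    and "Dv fp x = Du fq x + fm x * fr x"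
    and "Du fm x = fp x * fk x - fq x * fr x"
    and "Dv fr x = Du fk x - fp x * fm x"
proof -
  obtain u v where xuv: "x = (u, v)" by fastforce
  have uv: "(u, v) \<in> R" using x xuv by simp
  have wp: "w x > 0" and w2: "w x * w x = 1 + a x * a x"
    using w_pos[of x] w_sq[of x] by (simp_all add: power2_eq_square)
  note d = sol_partials[OF uv] sqrt_K_partials'[OF uv] w_partials[OF RD[OF uv]]
    smooth_on_real_partials[OF smooth_R(1) uv] smooth_on_real_partials[OF smooth_g1 uv]
    smooth_on_real_partials[OF smooth_g2 uv] smooth_on_real_partials[OF smooth_on_Du[OF smooth_R(1)] uv]
  have e1: "Dv \<Phi> x = - (\<Phi> x * \<Psi> x / 4 * (g2 x + a x * g1 x))"
    unfolding xuv by (rule Dv_real_eqI, rule d)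
  have e2: "Du (\<lambda>x. a x * \<Psi> x) x = Du a x * \<Psi> x + a x * (\<Phi> x * \<Psi> x / 4 * (a x * g2 x - g1 x))"
    unfolding xuv by (rule Du_real_eqI) (rule derivative_eq_intros d refl | simp)+
  have e3: "Du (\<lambda>x. w x * \<Psi> x) x = a x * Du a x / w x * \<Psi> x + w x * (\<Phi> x * \<Psi> x / 4 * (a x * g2 x - g1 x))"
    unfolding xuv by (rule Du_real_eqI) (rule derivative_eq_intros d refl | simp)+
  have e4: "Dv fp x = - (1/4) * ((a x * Dv a x / w x) * \<Phi> x * g2 x
      - w x * (\<Phi> x * \<Psi> x / 4 * (g2 x + a x * g1 x)) * g2 x + w x * \<Phi> x * Dv g2 x)
      - (Dv (Du a) x / w x - Du a x * (a x * Dv a x / w x) / (w x)\<^sup>2)"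
    unfolding xuv fp_def
  proof (rule Dv_real_eqI, rule DERIV_diff)
    show "((\<lambda>t. - (1/4) * (w (u, t) * \<Phi> (u, t) * g2 (u, t))) has_real_derivative
      - (1/4) * ((a (u, v) * Dv a (u, v) / w (u, v)) * \<Phi> (u, v) * g2 (u, v)
      - w (u, v) * (\<Phi> (u, v) * \<Psi> (u, v) / 4 * (g2 (u, v) + a (u, v) * g1 (u, v))) * g2 (u, v)
      + w (u, v) * \<Phi> (u, v) * Dv g2 (u, v))) (at v)"
      by (rule derivative_eq_intros d refl)+ (simp add: algebra_simps)
    show "((\<lambda>t. Du a (u, t) / w (u, t)) has_real_derivative Dv (Du a) (u, v) / w (u, v)
      - Du a (u, v) * (a (u, v) * Dv a (u, v) / w (u, v)) / (w (u, v))\<^sup>2) (at v)"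
    proof (rule DERIV_cong[OF DERIV_divide[OF d(14) d(6)]])
      show "w (u, v) \<noteq> 0" using wp xuv by simp
      then show "(Dv (Du a) (u, v) * w (u, v) - Du a (u, v) * (a (u, v) * Dv a (u, v) / w (u, v))) / (w (u, v) * w (u, v))
        = Dv (Du a) (u, v) / w (u, v) - Du a (u, v) * (a (u, v) * Dv a (u, v) / w (u, v)) / (w (u, v))\<^sup>2"
        by (simp add: diff_divide_distrib power2_eq_square)
    qed
  qed
  have e5: "Du fq x = - (1/4) * ((a x * Du a x / w x) * \<Psi> x * g1 x
      + w x * (\<Phi> x * \<Psi> x / 4 * (a x * g2 x - g1 x)) * g1 x + w x * \<Psi> x * Du g1 x)"
    unfolding xuv fq_def
    by (rule Du_real_eqI, (rule derivative_eq_intros d refl)+) (simp add: algebra_simps)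
  have e6: "Du fm x = a x * Du a x / w x * sqrt (K x) * \<Psi> x + w x * (g1 x * \<Phi> x * sqrt (K x) / 2) * \<Psi> x
      + w x * sqrt (K x) * (\<Phi> x * \<Psi> x / 4 * (a x * g2 x - g1 x))"
    unfolding xuv fm_def
    by (rule Du_real_eqI, (rule derivative_eq_intros d refl)+) (simp add: algebra_simps)
  have e7: "Dv fr x = g2 x * \<Psi> x * sqrt (K x) / 2 * \<Phi> x - sqrt (K x) * (\<Phi> x * \<Psi> x / 4 * (g2 x + a x * g1 x))"
    unfolding xuv fr_def
    by (rule Dv_real_eqI, (rule derivative_eq_intros d refl)+) (simp add: algebra_simps)
  have e8: "Du fk x = - (Du a x * sqrt (K x) * \<Psi> x + a x * (g1 x * \<Phi> x * sqrt (K x) / 2) * \<Psi> x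
      + a x * sqrt (K x) * (\<Phi> x * \<Psi> x / 4 * (a x * g2 x - g1 x)))"
    unfolding xuv fk_def
    by (rule Du_real_eqI, (rule derivative_eq_intros d refl)+) (simp add: algebra_simps)
  \<comment> \<open>Multiplying by \<open>w\<close> removes the quotient \<open>a_u / w\<close> and
    lets the square of \<open>w\<close> become \<open>1 + a * a\<close>, the form in which the
    derivatives of \<open>\<Phi>\<close> and of \<open>fr\<close> can be compared.\<close>
  have wfp: "w x * fp x = - (1/4) * ((1 + a x * a x) * \<Phi> x * g2 x) - Du a x"
    using wp by (simp add: fp_def right_diff_distrib w2[symmetric])
  show "Dv \<Phi> x = Du (\<lambda>x. a x * \<Psi> x) x + (w x * \<Psi> x) * fp x"
  proof -
    have "(w x * \<Psi> x) * fp x = \<Psi> x * (w x * fp x)" by simp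
    then show ?thesis unfolding e1 e2 wfp by (simp add: algebra_simps)
  qed
  show "\<Phi> x * fq x = (a x * \<Psi> x) * fp x + Du (\<lambda>x. w x * \<Psi> x) x"
    unfolding e3 fq_def fp_def by (simp add: algebra_simps)
  show "\<Phi> x * fm x = (w x * \<Psi> x) * fr x" by (simp add: fm_def fr_def)
  show "Dv fp x = Du fq x + fm x * fr x"
    unfolding e4 e5 fm_def fr_def
    by (rule gauss_equation_rearranged[OF pos_sol[OF x] K_pos[OF RD[OF x]] wp w_sq _ K_partials[OF x]
          gauss_eq[OF x, folded g1_def[abs_def] g2_def[abs_def]]])
       (use K_pos[OF RD[OF x]] in simp)
  show "Du fm x = fp x * fk x - fq x * fr x"
    unfolding e6 fp_def fk_def fq_def fr_def by (simp add: algebra_simps)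
  show "Dv fr x = Du fk x - fp x * fm x"
  proof -
    have "fp x * fm x = (w x * fp x) * (sqrt (K x) * \<Psi> x)" by (simp add: fm_def)
    then show ?thesis unfolding e7 e8 wfp by (simp add: algebra_simps)
  qed
qed

end

section \<open>Segments and corners in open rectangles\<close>

lemma open_rectangleE:
  assumes "open_rectangle W"
  obtains a b c d where "W = {a<..<b} \<times> {c<..<d}"
proof -
  obtain p q where "W = box p q" using assms by (auto simp: open_rectangle_def)
  moreover obtain a c where "p = (a, c)" by fastforce
  moreover obtain b d where "q = (b, d)" by fastforce
  ultimately have "W = {a<..<b} \<times> {c<..<d}"
    by (auto simp: box_def Basis_prod_def inner_Pair)
  then show thesis by (rule that)
qed

lemma open_rectangle_open: "open_rectangle W \<Longrightarrow> open W"
  by (auto simp: open_rectangle_def)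

lemma open_rectangle_convex: "open_rectangle W \<Longrightarrow> convex W"
  by (auto simp: open_rectangle_def intro: convex_box)

lemma open_rectangle_corner: "open_rectangle W \<Longrightarrow> (u, v) \<in> W \<Longrightarrow> (u', v') \<in> W \<Longrightarrow> (u, v') \<in> W"
  by (elim open_rectangleE) auto

lemma open_rectangle_segment:
  assumes "open_rectangle W"
  shows "(u, v) \<in> W \<Longrightarrow> (u', v) \<in> W \<Longrightarrow> t \<in> {min u u'..max u u'} \<Longrightarrow> (t, v) \<in> W"
    and "(u, v) \<in> W \<Longrightarrow> (u, v') \<in> W \<Longrightarrow> t \<in> {min v v'..max v v'} \<Longrightarrow> (u, t) \<in> W"
proof -
  obtain a b c d where W: "W = {a<..<b} \<times> {c<..<d}" by (rule open_rectangleE[OF assms])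
  show "(u, v) \<in> W \<Longrightarrow> (u', v) \<in> W \<Longrightarrow> t \<in> {min u u'..max u u'} \<Longrightarrow> (t, v) \<in> W"
    "(u, v) \<in> W \<Longrightarrow> (u, v') \<in> W \<Longrightarrow> t \<in> {min v v'..max v v'} \<Longrightarrow> (u, t) \<in> W"
    unfolding W by auto
qed

lemma continuous_on_rectangle_line:
  assumes "open_rectangle W" "continuous_on W g"
  shows "(u, v) \<in> W \<Longrightarrow> (u', v) \<in> W \<Longrightarrow> continuous_on {min u u'..max u u'} (\<lambda>t. g (t, v))"
    and "(u, v) \<in> W \<Longrightarrow> (u, v') \<in> W \<Longrightarrow> continuous_on {min v v'..max v v'} (\<lambda>t. g (u, t))"
proof -
  show "continuous_on {min u u'..max u u'} (\<lambda>t. g (t, v))" if "(u, v) \<in> W" "(u', v) \<in> W"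
    by (rule continuous_on_compose2[OF assms(2)])
       (use open_rectangle_segment(1)[OF assms(1) that] in \<open>auto intro!: continuous_intros\<close>)
  show "continuous_on {min v v'..max v v'} (\<lambda>t. g (u, t))" if "(u, v) \<in> W" "(u, v') \<in> W"
    by (rule continuous_on_compose2[OF assms(2)])
       (use open_rectangle_segment(2)[OF assms(1) that] in \<open>auto intro!: continuous_intros\<close>)
qed

context curvature_data
begin

lemma smooth_K_quotients:
  "smooth_on D (\<lambda>p. Du K p / (4 * K p))" "smooth_on D (\<lambda>p. Dv K p / (4 * K p))"
  using K_pos by (intro smooth_on_divide smooth_on_mult smooth_on_const smooth_on_Du smooth_on_Dv smooth_K open_D; force)+

end

context goursat_solution
begin

text \<open>With \<open>L = logK4\<close>, the datum on \<open>v = v0\<close> says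
  \<open>\<Phi>_u = (a L_v - L_u) \<Phi>\<close>, whereas the system says
  \<open>\<Psi>_u = a L_v \<Phi> - L_u \<Psi>\<close>. The difference solves a homogeneous linear
  equation and vanishes at the base point. The other axis is analogous with the roles
  exchanged.\<close>

lemma axes_agree:
  shows "(u, v0) \<in> R \<Longrightarrow> \<Phi> (u, v0) = \<Psi> (u, v0)"
    and "(u0, v) \<in> R \<Longrightarrow> \<Psi> (u0, v) = \<Phi> (u0, v)"
proof -
  have base: "\<Phi> (u0, v0) = exp (- logK4 (u0, v0))" "\<Psi> (u0, v0) = exp (- logK4 (u0, v0))"
    using initial[OF R(2)] by simp_all
  have cg: "continuous_on R (\<lambda>p. a p * Dv logK4 p - Du logK4 p)"
    "continuous_on R (\<lambda>p. - Dv logK4 p - a p * Du logK4 p)"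
  proof -
    note c = smooth_K_quotients[THEN smooth_on_continuous, THEN continuous_on_subset, OF R(3)]
      smooth_R(1)[THEN smooth_on_continuous]
    have "continuous_on R (\<lambda>p. a p * (Dv K p / (4 * K p)) - Du K p / (4 * K p))"
      "continuous_on R (\<lambda>p. - (Dv K p / (4 * K p)) - a p * (Du K p / (4 * K p)))"
      by (intro continuous_on_diff continuous_on_mult continuous_on_minus c)+
    then show "continuous_on R (\<lambda>p. a p * Dv logK4 p - Du logK4 p)"
      "continuous_on R (\<lambda>p. - Dv logK4 p - a p * Du logK4 p)"
      by (simp_all add: Du_logK4 Dv_logK4 RD cong: continuous_on_cong_simp)
  qed
  show "\<Phi> (u, v0) = \<Psi> (u, v0)" if u: "(u, v0) \<in> R"
  proof (rule axis_solutions_agree[where x = "\<lambda>t. \<Phi> (t, v0)" and y = "\<lambda>t. \<Psi> (t, v0)" and ?t0.0 = u0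
        and g = "\<lambda>t. a (t, v0) * Dv logK4 (t, v0) - Du logK4 (t, v0)" and l = "\<lambda>t. Du logK4 (t, v0)"
        and L = "\<lambda>t. logK4 (t, v0)" and c = "- logK4 (u0, v0)"])
    show "continuous_on {min u0 u..max u0 u} (\<lambda>t. a (t, v0) * Dv logK4 (t, v0) - Du logK4 (t, v0))"
      by (rule continuous_on_rectangle_line(1)[OF R(1) cg(1) R(2) u])
    fix t assume "t \<in> {min u0 u..max u0 u}"
    then have t: "(t, v0) \<in> R" by (rule open_rectangle_segment(1)[OF R(1,2) u])
    note tD = RD[OF t]
    show "\<Phi> (t, v0) = exp ((LBINT s=u0..t. a (s, v0) * Dv logK4 (s, v0) - Du logK4 (s, v0)) + - logK4 (u0, v0))"
      using initial(1)[OF t] by simp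
    show "((\<lambda>t. logK4 (t, v0)) has_real_derivative Du logK4 (t, v0)) (at t)"
      using logK4_partials(1)[OF tD] by (simp add: Du_logK4[OF tD])
    have "Du \<Psi> (t, v0) = (a (t, v0) * Dv logK4 (t, v0) - Du logK4 (t, v0) + Du logK4 (t, v0)) * \<Phi> (t, v0)
        - Du logK4 (t, v0) * \<Psi> (t, v0)"
      unfolding pde(2)[OF t] Du_logK4[OF tD] Dv_logK4[OF tD] using K_pos[OF tD] by (simp add: field_simps)
    then show "((\<lambda>t. \<Psi> (t, v0)) has_real_derivative (a (t, v0) * Dv logK4 (t, v0) - Du logK4 (t, v0) + Du logK4 (t, v0)) * \<Phi> (t, v0)
        - Du logK4 (t, v0) * \<Psi> (t, v0)) (at t)"
      using smooth_on_real_partials(1)[OF smooth_sol(2) t] by simp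
  qed (use base in auto)
  show "\<Psi> (u0, v) = \<Phi> (u0, v)" if v: "(u0, v) \<in> R"
  proof (rule axis_solutions_agree[where x = "\<lambda>t. \<Psi> (u0, t)" and y = "\<lambda>t. \<Phi> (u0, t)" and ?t0.0 = v0
        and g = "\<lambda>t. - Dv logK4 (u0, t) - a (u0, t) * Du logK4 (u0, t)" and l = "\<lambda>t. Dv logK4 (u0, t)"
        and L = "\<lambda>t. logK4 (u0, t)" and c = "- logK4 (u0, v0)"])
    show "continuous_on {min v0 v..max v0 v} (\<lambda>t. - Dv logK4 (u0, t) - a (u0, t) * Du logK4 (u0, t))"
      by (rule continuous_on_rectangle_line(2)[OF R(1) cg(2) R(2) v])
    fix t assume "t \<in> {min v0 v..max v0 v}"
    then have t: "(u0, t) \<in> R" by (rule open_rectangle_segment(2)[OF R(1,2) v])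
    note tD = RD[OF t]
    show "\<Psi> (u0, t) = exp ((LBINT s=v0..t. - Dv logK4 (u0, s) - a (u0, s) * Du logK4 (u0, s)) + - logK4 (u0, v0))"
      using initial(2)[OF t] by simp
    show "((\<lambda>t. logK4 (u0, t)) has_real_derivative Dv logK4 (u0, t)) (at t)"
      using logK4_partials(2)[OF tD] by (simp add: Dv_logK4[OF tD])
    have "Dv \<Phi> (u0, t) = (- Dv logK4 (u0, t) - a (u0, t) * Du logK4 (u0, t) + Dv logK4 (u0, t)) * \<Psi> (u0, t)
        - Dv logK4 (u0, t) * \<Phi> (u0, t)"
      unfolding pde(1)[OF t] Du_logK4[OF tD] Dv_logK4[OF tD] using K_pos[OF tD] by (simp add: field_simps)
    then show "((\<lambda>t. \<Phi> (u0, t)) has_real_derivative (- Dv logK4 (u0, t) - a (u0, t) * Du logK4 (u0, t) + Dv logK4 (u0, t)) * \<Psi> (u0, t)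
        - Dv logK4 (u0, t) * \<Phi> (u0, t)) (at t)"
      using smooth_on_real_partials(2)[OF smooth_sol(1) t] by simp
  qed (use base in auto)
qed

lemma existence: "\<exists>W z. W \<subseteq> D \<and> canonical_surface_with_curvatures W u0 v0 K H z"
proof -
  obtain c d z e1 e2 n where cd: "(u0, v0) \<in> box c d" "box c d \<subseteq> R"
    and fr: "\<And>x. x \<in> box c d \<Longrightarrow> lorentz_frame (e1 x) (e2 x) (n x)"
    and sm: "smooth_on (box c d) z" "smooth_on (box c d) e1" "smooth_on (box c d) e2" "smooth_on (box c d) n"
    and zu: "\<And>x. x \<in> box c d \<Longrightarrow> Du z x = \<Phi> x *\<^sub>R e1 x"
    and zv: "\<And>x. x \<in> box c d \<Longrightarrow> Dv z x = (a x * \<Psi> x) *\<^sub>R e1 x + (w x * \<Psi> x) *\<^sub>R e2 x"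
    and e1u: "\<And>x. x \<in> box c d \<Longrightarrow> Du e1 x = fp x *\<^sub>R e2 x"
    and e1v: "\<And>x. x \<in> box c d \<Longrightarrow> Dv e1 x = fq x *\<^sub>R e2 x + fm x *\<^sub>R n x"
    and e2v: "\<And>x. x \<in> box c d \<Longrightarrow> Dv e2 x = fq x *\<^sub>R e1 x + fk x *\<^sub>R n x"
  proof (rule frame_system_solution[OF open_R R(2) smooth_sol(1) smooth_coefficients(6,7,1,2,3,4,5) compatibility], goal_cases)
    case (7 c d z e1 e2 n)
    show thesis by (rule 7(1)) (fact 7)+
  qed
  define W where "W = box c d"
  note cd = cd[folded W_def] note fr = fr[folded W_def] note sm = sm[folded W_def]
  note zu = zu[folded W_def] note e1u = e1u[folded W_def] note e1v = e1v[folded W_def] note e2v = e2v[folded W_def]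
  have zv: "Dv z x = \<Psi> x *\<^sub>R (a x *\<^sub>R e1 x + w x *\<^sub>R e2 x)" if "x \<in> W" for x
    using zv[folded W_def, OF that] by (simp add: algebra_simps)
  have W: "open W" "open_rectangle W" unfolding W_def open_rectangle_def by (rule open_box, blast)
  have WD: "x \<in> D" if "x \<in> W" for x using that cd(2) RD by blast
  have pos: "\<Phi> x > 0" "\<Psi> x > 0" "K x > 0" if "x \<in> W" for x
    using that cd(2) pos_sol[of x] K_pos[OF WD[OF that]] by blast+
  have smW: "smooth_on W \<Phi>" "smooth_on W \<Psi>" "smooth_on W a" "smooth_on W w"
    using smooth_on_subset[OF _ cd(2)] smooth_sol smooth_R by blast+
  have N: "a x * fm x + w x * fk x = 0" for x by (simp add: fm_def fk_def)
  have coefs: "unit_normal z x = n x" "coefE z x = (\<Phi> x)\<^sup>2" "coefF z x = a x * \<Phi> x * \<Psi> x"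
    "coefG z x = - (\<Psi> x)\<^sup>2" "coefL z x = 0" "coefM z x = \<Phi> x * fm x" "coefN z x = 0" if "x \<in> W" for x
    by (rule adapted_surface_coefficients[OF W(1) that fr zu zv pos(1,2)[OF that] w_pos w_sq
          smW sm(2,3) e1u[OF that] e1v[OF that] e2v[OF that] N]; assumption)+
  have sa: "surf_a z x = a x" if "x \<in> W" for x
    using pos[OF that] by (simp add: surf_a_def coefs[OF that] real_sqrt_mult[symmetric])
  have sal: "surf_alpha z x = w x * sqrt (K x)" if "x \<in> W" for x
    using pos[OF that] by (simp add: surf_alpha_def coefs[OF that] fm_def)
  have sf: "surf_f z x = - logK4 x" if "x \<in> W" for x
    using pos[OF that] w_pos[of x]
    by (simp add: surf_f_def sa[OF that] sal[OF that] logK4_eq_ln_sqrt[OF WD[OF that]] abs_mult ln_mult flip: w_def)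
  \<comment> \<open>The discriminant is minus a perfect square because \<open>1 + a * a\<close> is
    the square of \<open>w\<close>; both curvatures are divided by it next.\<close>
  have den: "coefE z x * coefG z x - (coefF z x)\<^sup>2 = - ((\<Phi> x * \<Psi> x * w x)\<^sup>2)" if "x \<in> W" for x
    by (simp add: coefs[OF that] power_mult_distrib w_sq algebra_simps)
  have GC: "gauss_curv z x = K x" if "x \<in> W" for x
  proof -
    have "(coefM z x)\<^sup>2 = (\<Phi> x * \<Psi> x * w x)\<^sup>2 * K x"
      using pos[OF that] by (simp add: coefs[OF that] fm_def power_mult_distrib)
    moreover have "\<Phi> x * \<Psi> x * w x \<noteq> 0" using pos[OF that] w_pos[of x] by auto
    ultimately show ?thesis by (simp add: gauss_curv_def den[OF that] coefs(5,7)[OF that])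
  qed
  have MC: "mean_curv z x = H x" if "x \<in> W" for x
  proof -
    have "coefF z x * coefM z x = (\<Phi> x * \<Psi> x * w x)\<^sup>2 * (a x * sqrt (K x) / w x)"
      using pos[OF that] w_pos[of x] by (simp add: coefs[OF that] fm_def power2_eq_square field_simps)
    moreover have "\<Phi> x * \<Psi> x * w x \<noteq> 0" using pos[OF that] w_pos[of x] by auto
    ultimately show ?thesis by (simp add: mean_curv_def den[OF that] coefs(5,7)[OF that] H_eq[OF WD[OF that]])
  qed
  have timelike: "timelike_surface W z"
    unfolding timelike_surface_def regular_on_def timelike_on_def
    using sm(1) adapted_frame_timelike[OF fr pos(1,2) w_pos zu zv] by blast
  have asym: "asymptotic_on W z"
    unfolding asymptotic_on_def
  proof
    fix p assume p: "p \<in> W"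
    show "coefL z p = 0 \<and> coefN z p = 0 \<and> gauss_curv z p - (mean_curv z p)\<^sup>2 > 0
        \<and> coefE z p > 0 \<and> coefG z p < 0 \<and> surf_alpha z p > 0"
      using pos[OF p] w_pos[of p] KH_pos[OF WD[OF p]] by (simp add: coefs[OF p] GC[OF p] MC[OF p] sal[OF p])
  qed
  have partial_f: "Du (surf_f z) x = - (Du K x / (4 * K x))" "Dv (surf_f z) x = - (Dv K x / (4 * K x))" if "x \<in> W" for x
  proof -
    obtain u v where x: "x = (u, v)" by fastforce
    note uD = WD[OF that, unfolded x]
    show "Du (surf_f z) x = - (Du K x / (4 * K x))" "Dv (surf_f z) x = - (Dv K x / (4 * K x))"
      using Du_Dv_cong[OF W(1) that sf] Du_real_eqI[OF DERIV_minus[OF logK4_partials(1)[OF uD]]]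
        Dv_real_eqI[OF DERIV_minus[OF logK4_partials(2)[OF uD]]] by (auto simp: x)
  qed
  \<comment> \<open>With \<open>f = - logK4\<close>, the canonical integrands are the right sides of
    the system divided by \<open>\<Phi>\<close> and \<open>\<Psi>\<close>, hence logarithmic
    derivatives.\<close>
  have cv: "canon_v z x = Dv \<Phi> x / \<Phi> x" and cu: "canon_u z x = Du \<Psi> x / \<Psi> x" if "x \<in> W" for x
  proof -
    have xR: "x \<in> R" using that cd by blast
    show "canon_v z x = Dv \<Phi> x / \<Phi> x" "canon_u z x = Du \<Psi> x / \<Psi> x"
      unfolding canon_v_def canon_u_def partial_f[OF that] sa[OF that] coefs[OF that] pde[OF xR]
      using pos[OF that] by (simp_all add: field_simps)
  qed
  have "continuous_on W (\<lambda>x. Dv \<Phi> x / \<Phi> x)" "continuous_on W (\<lambda>x. Du \<Psi> x / \<Psi> x)"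
    using smW[THEN smooth_on_continuous] smW(1)[THEN smooth_on_Dv, THEN smooth_on_continuous]
      smW(2)[THEN smooth_on_Du, THEN smooth_on_continuous] pos
    by (intro continuous_on_divide; fastforce)+
  then have cont: "continuous_on W (canon_v z)" "continuous_on W (canon_u z)"
    by (simp_all add: cv cu cong: continuous_on_cong_simp)
  have Iv: "(LBINT s=v1..v2. canon_v z (u, s)) = ln (\<Phi> (u, v2)) - ln (\<Phi> (u, v1))"
    if "(u, v1) \<in> W" "(u, v2) \<in> W" for u v1 v2
  proof (rule interval_integral_eq_ln_diff)
    show "continuous_on {min v1 v2..max v1 v2} (\<lambda>s. canon_v z (u, s))"
      by (rule continuous_on_rectangle_line(2)[OF W(2) cont(1) that])
    fix s assume "s \<in> {min v1 v2..max v1 v2}"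
    then have s: "(u, s) \<in> W" by (rule open_rectangle_segment(2)[OF W(2) that])
    show "((\<lambda>s. \<Phi> (u, s)) has_real_derivative canon_v z (u, s) * \<Phi> (u, s)) (at s)" "0 < \<Phi> (u, s)"
      using smooth_on_real_partials(2)[OF smW(1) s] pos[OF s] by (simp_all add: cv[OF s])
  qed
  have Iu: "(LBINT s=u1..u2. canon_u z (s, v)) = ln (\<Psi> (u2, v)) - ln (\<Psi> (u1, v))"
    if "(u1, v) \<in> W" "(u2, v) \<in> W" for v u1 u2
  proof (rule interval_integral_eq_ln_diff)
    show "continuous_on {min u1 u2..max u1 u2} (\<lambda>s. canon_u z (s, v))"
      by (rule continuous_on_rectangle_line(1)[OF W(2) cont(2) that])
    fix s assume "s \<in> {min u1 u2..max u1 u2}"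
    then have s: "(s, v) \<in> W" by (rule open_rectangle_segment(1)[OF W(2) that])
    show "((\<lambda>s. \<Psi> (s, v)) has_real_derivative canon_u z (s, v) * \<Psi> (s, v)) (at s)" "0 < \<Psi> (s, v)"
      using smooth_on_real_partials(1)[OF smW(2) s] pos[OF s] by (simp_all add: cu[OF s])
  qed
  have "- logK4 (u0, v0) = ln (\<Phi> (u0, v0))" "- logK4 (u0, v0) = ln (\<Psi> (u0, v0))"
    using initial[OF R(2)] by simp_all
  then have f0: "surf_f z (u0, v0) = ln (\<Phi> (u0, v0))" "surf_f z (u0, v0) = ln (\<Psi> (u0, v0))"
    using sf[OF cd(1)] by simp_all
  have "sqrt (coefE z (u, v)) = exp ((LBINT s=v0..v. canon_v z (u, s)) + (LBINT t=u0..u. canon_u z (t, v0)) + surf_f z (u0, v0))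
      \<and> sqrt (- coefG z (u, v)) = exp ((LBINT t=u0..u. canon_u z (t, v)) + (LBINT s=v0..v. canon_v z (u0, s)) + surf_f z (u0, v0))"
    if uv: "(u, v) \<in> W" for u v
  proof -
    have c: "(u, v0) \<in> W" "(u0, v) \<in> W"
      using open_rectangle_corner[OF W(2)] uv cd(1) by blast+
    \<comment> \<open>For \<open>\<Phi>\<close> the path runs along \<open>v = v0\<close>, where the
      integral yields logarithms of \<open>\<Psi>\<close>, and then vertically, where it yields
      logarithms of \<open>\<Phi>\<close>. Equality of the two functions at the turning point makes
      the sum telescope; for the other formula the path turns at \<open>(u0, v)\<close>.\<close>
    then have "\<Phi> (u, v0) = \<Psi> (u, v0)" "\<Psi> (u0, v) = \<Phi> (u0, v)"
      using axes_agree cd(2) by blast+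
    then show ?thesis
      using f0 pos[OF uv] by (simp add: coefs[OF uv] Iv[OF c(1) uv] Iu[OF cd(1) c(1)] Iu[OF c(2) uv] Iv[OF cd(1) c(2)])
  qed
  then have "canonical_surface_with_curvatures W u0 v0 K H z"
    unfolding canonical_surface_with_curvatures_def canonical_asymptotic_on_def
    using timelike W(2) cd(1) asym GC MC by blast
  moreover have "W \<subseteq> D" using WD by blast
  ultimately show ?thesis by blast
qed

end

subsection \<open>Uniqueness for the linear Goursat problem\<close>

text \<open>Comparison with the antiderivative \<open>M / l * exp (l * \<bar>t - a\<bar>)\<close>,
  separately on each side of \<open>a\<close>. Integration thus preserves the weight and gains a
  factor \<open>1 / l\<close>, the source of the contraction below.\<close>

lemma exponential_growth_bound:
  fixes h h' :: "real \<Rightarrow> real"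
  assumes der: "\<And>t. t \<in> {min a b..max a b} \<Longrightarrow> (h has_real_derivative h' t) (at t)"
    and bound: "\<And>t. t \<in> {min a b..max a b} \<Longrightarrow> \<bar>h' t\<bar> \<le> M * exp (l * \<bar>t - a\<bar>)"
    and "h a = 0" "l > 0" "M \<ge> 0"
  shows "\<bar>h b\<bar> \<le> M / l * exp (l * \<bar>b - a\<bar>)"
proof -
  have cont: "continuous_on {min a b..max a b} h"
    using der DERIV_isCont by (blast intro: continuous_at_imp_continuous_on)
  have hv: "(h has_vector_derivative h' t) (at t)" if "t \<in> {min a b..max a b}" for t
    using der[OF that] by (simp add: has_real_derivative_iff_has_vector_derivative)
  consider "a = b" | "a < b" | "b < a" by linarith
  then show ?thesis
  proof cases
    case 1
    then show ?thesis using assms by simp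
  next
    case 2
    have "norm (h b - h a) \<le> M / l * exp (l * (b - a)) - M / l * exp (l * (a - a))"
    proof (rule differentiable_bound_general[OF 2, where f' = h' and \<phi>' = "\<lambda>t. M * exp (l * (t - a))"])
      show "((\<lambda>t. M / l * exp (l * (t - a))) has_vector_derivative M * exp (l * (t - a))) (at t)" for t
        unfolding has_real_derivative_iff_has_vector_derivative[symmetric]
        using \<open>l > 0\<close> by (auto intro!: derivative_eq_intros)
      show "norm (h' t) \<le> M * exp (l * (t - a))" if "a < t" "t < b" for t
        using bound[of t] that 2 by simp
    qed (use cont hv 2 \<open>l > 0\<close> in \<open>auto intro!: continuous_intros\<close>)
    moreover have "0 \<le> M / l" using assms by simp
    ultimately show ?thesis using 2 \<open>h a = 0\<close> by simp
  next
    case 3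
    have "norm (h a - h b) \<le> - (M / l * exp (l * (a - a))) - (- (M / l * exp (l * (a - b))))"
    proof (rule differentiable_bound_general[OF 3, where f' = h' and \<phi>' = "\<lambda>t. M * exp (l * (a - t))"])
      show "((\<lambda>t. - (M / l * exp (l * (a - t)))) has_vector_derivative M * exp (l * (a - t))) (at t)" for t
        unfolding has_real_derivative_iff_has_vector_derivative[symmetric]
        using \<open>l > 0\<close> by (auto intro!: derivative_eq_intros)
      show "norm (h' t) \<le> M * exp (l * (a - t))" if "b < t" "t < a" for t
        using bound[of t] that 3 by simp
    qed (use cont hv 3 \<open>l > 0\<close> in \<open>auto intro!: continuous_intros simp: min_absorb2 max_absorb1\<close>)
    moreover have "0 \<le> M / l" using assms by simp
    ultimately show ?thesis using 3 \<open>h a = 0\<close> by simp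
  qed
qed

text \<open>In the sup norm weighted by \<open>exp (-l (|u - u0| + |v - v0|))\<close> the integral operator is a
  contraction once \<open>l\<close> is large.\<close>

lemma goursat_uniqueness:
  fixes X Y c1 c2 c3 c4 :: "real \<times> real \<Rightarrow> real"
  assumes W: "open_rectangle W" "(u0, v0) \<in> W"
    and cont: "continuous_on W X" "continuous_on W Y" "continuous_on W c1" "continuous_on W c2"
      "continuous_on W c3" "continuous_on W c4"
    and X: "\<And>u v. (u, v) \<in> W \<Longrightarrow>
      ((\<lambda>t. X (u, t)) has_real_derivative c1 (u, v) * X (u, v) + c2 (u, v) * Y (u, v)) (at v)"
    and Y: "\<And>u v. (u, v) \<in> W \<Longrightarrow>
      ((\<lambda>t. Y (t, v)) has_real_derivative c3 (u, v) * X (u, v) + c4 (u, v) * Y (u, v)) (at u)"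
    and X0: "\<And>u. (u, v0) \<in> W \<Longrightarrow> X (u, v0) = 0" and Y0: "\<And>v. (u0, v) \<in> W \<Longrightarrow> Y (u0, v) = 0"
    and p: "p \<in> W"
  shows "X p = 0" "Y p = 0"
proof -
  obtain u1 v1 where p1: "p = (u1, v1)" by fastforce
  obtain a b c d where Wb: "W = {a<..<b} \<times> {c<..<d}" by (rule open_rectangleE[OF W(1)])
  \<comment> \<open>The compact rectangle spanned by the base point and \<open>p\<close> contains
    every segment along which the equations are integrated, so suprema over it are attained.\<close>
  let ?I = "{min u0 u1..max u0 u1}" and ?J = "{min v0 v1..max v0 v1}"
  let ?Q = "?I \<times> ?J"
  have QW: "?Q \<subseteq> W" using W(2) p unfolding Wb p1 by auto
  have "compact ?Q" by (intro compact_Times) auto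
  have "\<exists>C. \<forall>p\<in>?Q. \<bar>g p\<bar> \<le> C" if "continuous_on W g" for g :: "real \<times> real \<Rightarrow> real"
    using compact_imp_bounded[OF compact_continuous_image[OF continuous_on_subset[OF that QW] \<open>compact ?Q\<close>]]
    by (auto simp: bounded_iff)
  then obtain C1 C2 C3 C4 where C14: "\<And>p. p \<in> ?Q \<Longrightarrow> \<bar>c1 p\<bar> \<le> C1" "\<And>p. p \<in> ?Q \<Longrightarrow> \<bar>c2 p\<bar> \<le> C2"
    "\<And>p. p \<in> ?Q \<Longrightarrow> \<bar>c3 p\<bar> \<le> C3" "\<And>p. p \<in> ?Q \<Longrightarrow> \<bar>c4 p\<bar> \<le> C4"
    using cont(3-6) by metis
  define C where "C = max 1 (max (max C1 C2) (max C3 C4))"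
  have C: "C \<ge> 1" "\<And>p. p \<in> ?Q \<Longrightarrow> \<bar>c1 p\<bar> \<le> C" "\<And>p. p \<in> ?Q \<Longrightarrow> \<bar>c2 p\<bar> \<le> C"
    "\<And>p. p \<in> ?Q \<Longrightarrow> \<bar>c3 p\<bar> \<le> C" "\<And>p. p \<in> ?Q \<Longrightarrow> \<bar>c4 p\<bar> \<le> C"
    by (simp add: C_def) (drule C14, simp add: C_def le_max_iff_disj)+
  \<comment> \<open>Each right side is at most \<open>2 * C * S\<close> times the weight. Division
    by \<open>l = 4 * C\<close> leaves \<open>S / 2\<close>.\<close>
  define l where "l = 4 * C"
  have l: "l > 0" using C(1) by (simp add: l_def)
  define wt where "wt p = exp (l * \<bar>fst p - u0\<bar>) * exp (l * \<bar>snd p - v0\<bar>)" for p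
  have wt: "wt p > 0" for p by (simp add: wt_def)
  have "continuous_on ?Q (\<lambda>p. max \<bar>X p\<bar> \<bar>Y p\<bar> / wt p)"
    unfolding wt_def by (intro continuous_intros continuous_on_subset[OF cont(1) QW] continuous_on_subset[OF cont(2) QW]) auto
  moreover have pQ: "p \<in> ?Q" by (auto simp: p1)
  ultimately obtain q where q: "q \<in> ?Q" "\<And>p. p \<in> ?Q \<Longrightarrow> max \<bar>X p\<bar> \<bar>Y p\<bar> / wt p \<le> max \<bar>X q\<bar> \<bar>Y q\<bar> / wt q"
    using continuous_attains_sup[OF \<open>compact ?Q\<close>] by blast
  \<comment> \<open>The weighted maximum is attained at \<open>q\<close>. Applying the improved
    bound \<open>S / 2\<close> at \<open>q\<close> itself forces \<open>S = 0\<close>.\<close>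
  define S where "S = max \<bar>X q\<bar> \<bar>Y q\<bar> / wt q"
  have S0: "S \<ge> 0" using wt[of q] by (simp add: S_def le_max_iff_disj)
  have XY: "\<bar>X p\<bar> \<le> S * wt p" "\<bar>Y p\<bar> \<le> S * wt p" if "p \<in> ?Q" for p
    using q(2)[OF that] wt[of p] by (simp_all add: S_def[symmetric] pos_divide_le_eq)
  have lin: "\<bar>c * X p + c' * Y p\<bar> \<le> 2 * C * S * wt p" if "p \<in> ?Q" "\<bar>c\<bar> \<le> C" "\<bar>c'\<bar> \<le> C" for c c' p
  proof -
    have "\<bar>c * X p + c' * Y p\<bar> \<le> \<bar>c\<bar> * \<bar>X p\<bar> + \<bar>c'\<bar> * \<bar>Y p\<bar>"
      using abs_triangle_ineq[of "c * X p" "c' * Y p"] by (simp add: abs_mult)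
    also have "\<dots> \<le> C * (S * wt p) + C * (S * wt p)"
      using that XY[OF that(1)] C(1) by (intro add_mono mult_mono) auto
    finally show ?thesis by simp
  qed
  have half: "\<bar>X (u, v)\<bar> \<le> S / 2 * wt (u, v)" "\<bar>Y (u, v)\<bar> \<le> S / 2 * wt (u, v)" if uv: "(u, v) \<in> ?Q" for u v
  proof -
    have sub: "(u, t) \<in> ?Q" if "t \<in> {min v0 v..max v0 v}" for t using uv that by auto
    have sub': "(t, v) \<in> ?Q" if "t \<in> {min u0 u..max u0 u}" for t using uv that by auto
    have base: "(u, v0) \<in> W" "(u0, v) \<in> W" using sub[of v0] sub'[of u0] QW by auto
    have "\<bar>X (u, v)\<bar> \<le> (2 * C * S * exp (l * \<bar>u - u0\<bar>)) / l * exp (l * \<bar>v - v0\<bar>)"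
    proof (rule exponential_growth_bound[where h = "\<lambda>t. X (u, t)" and h' = "\<lambda>t. c1 (u, t) * X (u, t) + c2 (u, t) * Y (u, t)"])
      fix t assume "t \<in> {min v0 v..max v0 v}"
      note t = sub[OF this]
      show "((\<lambda>t. X (u, t)) has_real_derivative c1 (u, t) * X (u, t) + c2 (u, t) * Y (u, t)) (at t)"
        using X t QW by blast
      show "\<bar>c1 (u, t) * X (u, t) + c2 (u, t) * Y (u, t)\<bar> \<le> 2 * C * S * exp (l * \<bar>u - u0\<bar>) * exp (l * \<bar>t - v0\<bar>)"
        using lin[OF t C(2,3)[OF t]] by (simp add: wt_def mult.assoc)
    qed (use X0 base l C S0 in auto)
    then show "\<bar>X (u, v)\<bar> \<le> S / 2 * wt (u, v)" using C(1) by (simp add: wt_def l_def)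
    have "\<bar>Y (u, v)\<bar> \<le> (2 * C * S * exp (l * \<bar>v - v0\<bar>)) / l * exp (l * \<bar>u - u0\<bar>)"
    proof (rule exponential_growth_bound[where h = "\<lambda>t. Y (t, v)" and h' = "\<lambda>t. c3 (t, v) * X (t, v) + c4 (t, v) * Y (t, v)"])
      fix t assume "t \<in> {min u0 u..max u0 u}"
      note t = sub'[OF this]
      show "((\<lambda>t. Y (t, v)) has_real_derivative c3 (t, v) * X (t, v) + c4 (t, v) * Y (t, v)) (at t)"
        using Y t QW by blast
      show "\<bar>c3 (t, v) * X (t, v) + c4 (t, v) * Y (t, v)\<bar> \<le> 2 * C * S * exp (l * \<bar>v - v0\<bar>) * exp (l * \<bar>t - u0\<bar>)"
        using lin[OF t C(4,5)[OF t]] by (simp add: wt_def mult.commute mult.left_commute)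
    qed (use Y0 base l C S0 in auto)
    then show "\<bar>Y (u, v)\<bar> \<le> S / 2 * wt (u, v)" using C(1) by (simp add: wt_def l_def mult.commute mult.left_commute)
  qed
  have "max \<bar>X q\<bar> \<bar>Y q\<bar> \<le> S / 2 * wt q" using half[of "fst q" "snd q"] q(1) by simp
  then have "S \<le> S / 2" using wt[of q] by (simp add: S_def[symmetric] pos_divide_le_eq flip: S_def) (simp add: S_def pos_divide_le_eq)
  then have "S = 0" using S0 by simp
  then show "X p = 0" "Y p = 0" using XY[OF pQ] by simp_all
qed

subsection \<open>Uniqueness of the surface\<close>

lemma DERIV_exp_interval_integral:
  fixes g y :: "real \<Rightarrow> real"
  assumes t: "t0 \<in> {c<..<d}" "t \<in> {c<..<d}" and g: "continuous_on {c<..<d} g"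
    and y: "\<And>s. s \<in> {c<..<d} \<Longrightarrow> y s = exp ((LBINT r=t0..s. g r) + C)"
  shows "(y has_real_derivative g t * y t) (at t)"
proof -
  \<comment> \<open>Points strictly between the ends of the interval and the points
    \<open>t0\<close>, \<open>t\<close>: then \<open>t\<close> is interior to \<open>{a..b}\<close>,
    and the one-sided statement of the fundamental theorem yields a full derivative.\<close>
  define a b where "a = (c + min t0 t) / 2" and "b = (d + max t0 t) / 2"
  have ab: "c < a" "a < t0" "a < t" "t0 < b" "t < b" "b < d" using t by (auto simp: a_def b_def min_def max_def)
  have "((\<lambda>s. LBINT r=t0..s. g r) has_vector_derivative g t) (at t within {a..b})"
    by (rule interval_integral_FTC2) (use ab in \<open>auto intro: continuous_on_subset[OF g]\<close>)
  moreover have "at t within {a..b} = at t" by (rule at_within_interior) (use ab in auto)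
  ultimately have "((\<lambda>s. LBINT r=t0..s. g r) has_real_derivative g t) (at t)"
    by (simp add: has_real_derivative_iff_has_vector_derivative)
  then have "((\<lambda>s. exp ((LBINT r=t0..s. g r) + C)) has_real_derivative g t * y t) (at t)"
    unfolding y[OF t(2)] by (auto intro!: derivative_eq_intros)
  then show ?thesis
    by (rule has_field_derivative_transform_within_open[of _ _ _ "{c<..<d}"]) (use t y in auto)
qed

text \<open>Write an increment of \<open>z\<close> in the first variable as an integral of
  \<open>Du z\<close>, differentiate under the integral sign in the second variable, and then
  differentiate the resulting integral with respect to its upper limit.\<close>

lemma Dv_Du_commute:
  fixes z :: "real \<times> real \<Rightarrow> 'a::banach"
  assumes W: "open W" "x \<in> W" and z: "smooth_on W z"
  shows "Dv (Du z) x = Du (Dv z) x"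
proof -
  obtain u v where x: "x = (u, v)" by fastforce
  obtain U V where UV: "open U" "open V" "u \<in> U" "v \<in> V" "U \<times> V \<subseteq> W"
    using open_prod_elim[OF W] x by (metis mem_Times_iff fst_conv snd_conv)
  obtain e1 e2 where e: "e1 > 0" "cball u e1 \<subseteq> U" "e2 > 0" "cball v e2 \<subseteq> V"
    using UV(1-4) open_contains_cball by metis
  let ?I = "{u - e1..u + e1}" and ?J = "{v - e2..v + e2}"
  have IJ: "(s, t) \<in> W" if "s \<in> ?I" "t \<in> ?J" for s t
    using that e UV(5) unfolding cball_eq_atLeastAtMost by blast
  note zu = smooth_on_Du[OF z] note zv = smooth_on_Dv[OF z]
  have cont: "continuous_on (?J \<times> cbox (u - e1) s) (\<lambda>(t, r). Dv (Du z) (r, t))" if "s \<in> ?I" for s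
    unfolding case_prod_beta
    by (rule continuous_on_compose2[OF smooth_on_continuous[OF smooth_on_Dv[OF zu]]])
       (use IJ that in \<open>auto intro!: continuous_intros\<close>)
  have inc: "((\<lambda>r. Du z (r, t)) has_integral z (s, t) - z (u - e1, t)) {u - e1..s}"
    if "s \<in> ?I" "t \<in> ?J" for s t
    by (rule fundamental_theorem_of_calculus)
       (use that IJ in \<open>auto intro!: has_vector_derivative_at_within smooth_on_partials(1)[OF z]\<close>)
  have atv: "at v within ?J = at v" and atu: "at u within ?I = at u"
    using e by (auto intro!: at_within_interior)
  have eq: "Dv z (s, v) = Dv z (u - e1, v) + integral {u - e1..s} (\<lambda>r. Dv (Du z) (r, v))" if s: "s \<in> ?I" for s
  proof -
    have "((\<lambda>t. integral (cbox (u - e1) s) (\<lambda>r. Du z (r, t))) has_vector_derivative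
        integral (cbox (u - e1) s) (\<lambda>r. Dv (Du z) (r, v))) (at v within ?J)"
    proof (rule leibniz_rule_vector_derivative)
      show "((\<lambda>t. Du z (r, t)) has_vector_derivative Dv (Du z) (r, t)) (at t within ?J)"
        if "t \<in> ?J" "r \<in> cbox (u - e1) s" for t r
        by (rule has_vector_derivative_at_within, rule smooth_on_partials(2)[OF zu]) (use that s IJ in auto)
      show "(\<lambda>r. Du z (r, t)) integrable_on cbox (u - e1) s" if "t \<in> ?J" for t
        using inc[OF s that] by (auto simp: integrable_on_def)
    qed (use cont[OF s] e in auto)
    from has_vector_derivative_transform[OF _ _ this[unfolded cbox_interval], of "\<lambda>t. z (s, t) - z (u - e1, t)"]
    have "((\<lambda>t. z (s, t) - z (u - e1, t)) has_vector_derivative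
        integral {u - e1..s} (\<lambda>r. Dv (Du z) (r, v))) (at v within ?J)"
      using e integral_unique[OF inc[OF s]] by auto
    moreover have "((\<lambda>t. z (s, t) - z (u - e1, t)) has_vector_derivative Dv z (s, v) - Dv z (u - e1, v)) (at v)"
      by (intro has_vector_derivative_diff smooth_on_partials(2)[OF z] IJ) (use s e in auto)
    ultimately have "integral {u - e1..s} (\<lambda>r. Dv (Du z) (r, v)) = Dv z (s, v) - Dv z (u - e1, v)"
      unfolding atv by (metis vector_derivative_at)
    then show ?thesis by simp
  qed
  have "((\<lambda>s. Dv z (u - e1, v) + integral {u - e1..s} (\<lambda>r. Dv (Du z) (r, v))) has_vector_derivative 0 + Dv (Du z) (u, v)) (at u within ?I)"
  proof (intro has_vector_derivative_add has_vector_derivative_const integral_has_vector_derivative)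
    show "continuous_on ?I (\<lambda>r. Dv (Du z) (r, v))"
      by (rule continuous_on_compose2[OF smooth_on_continuous[OF smooth_on_Dv[OF zu]]])
         (use IJ e in \<open>auto intro!: continuous_intros\<close>)
  qed (use e in auto)
  from has_vector_derivative_transform[OF _ eq this]
  have "((\<lambda>s. Dv z (s, v)) has_vector_derivative Dv (Du z) (u, v)) (at u)"
    using e unfolding atu by simp
  then show ?thesis using Du_eqI[of "Dv z" x] by (simp add: x)
qed

text \<open>Applied to the six frame products, this is the Lorentzian skew symmetry of the
  connection matrices.\<close>

lemma lorentz_const_partials:
  assumes W: "open W" "x \<in> W" and fg: "f differentiable (at x)" "g differentiable (at x)"
    and c: "\<And>y. y \<in> W \<Longrightarrow> lorentz (f y) (g y) = c"
  shows "lorentz (f x) (Du g x) = - lorentz (g x) (Du f x)"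
    and "lorentz (f x) (Dv g x) = - lorentz (g x) (Dv f x)"
proof -
  note D = bounded_bilinear.FDERIV[OF bounded_bilinear_lorentz fg[THEN differentiable_partials(1)]]
  have "Du (\<lambda>y. lorentz (f y) (g y)) x = Du (\<lambda>_. c) x" "Dv (\<lambda>y. lorentz (f y) (g y)) x = Dv (\<lambda>_. c) x"
    by (rule Du_Dv_cong[OF W c], assumption)+
  moreover have "Du (\<lambda>_. c) x = 0" "Dv (\<lambda>_. c) x = 0" by (simp_all add: Du_def Dv_def)
  ultimately show "lorentz (f x) (Du g x) = - lorentz (g x) (Du f x)"
    "lorentz (f x) (Dv g x) = - lorentz (g x) (Dv f x)"
    using has_derivative_Du[OF D] has_derivative_Dv[OF D] lorentz_commute[of "g x"] by simp_all
qed

text \<open>Skewness leaves three unknown coefficients in each direction. The normal ones come from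
  the second fundamental form, the one for \<open>Du e2\<close> after exchanging mixed derivatives.
  The \<open>e1\<close>- and \<open>e2\<close>-components of \<open>z_uv = z_vu\<close> determine
  \<open>p\<close> and then \<open>q\<close>, so everything is expressed by \<open>\<Phi>\<close>,
  \<open>b1\<close>, \<open>b2\<close> and \<open>M\<close>.\<close>

lemma surface_structure_equations:
  fixes z e1 e2 n :: "real \<times> real \<Rightarrow> real^3"
  assumes W: "open W" "x \<in> W" and z: "smooth_on W z"
    and sm: "smooth_on W e1" "smooth_on W e2" "smooth_on W n" "smooth_on W \<Phi>" "smooth_on W b1" "smooth_on W b2"
    and fr: "\<And>y. y \<in> W \<Longrightarrow> lorentz_frame (e1 y) (e2 y) (n y)"
    and zu: "\<And>y. y \<in> W \<Longrightarrow> Du z y = \<Phi> y *\<^sub>R e1 y"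
    and zv: "\<And>y. y \<in> W \<Longrightarrow> Dv z y = b1 y *\<^sub>R e1 y + b2 y *\<^sub>R e2 y"
    and nz: "\<Phi> x \<noteq> 0" "b2 x \<noteq> 0"
    and LMN: "lorentz (n x) (Du (Du z) x) = 0" "lorentz (n x) (Dv (Du z) x) = M" "lorentz (n x) (Dv (Dv z) x) = 0"
  defines "p \<equiv> (Dv \<Phi> x - Du b1 x) / b2 x"
  defines "q \<equiv> (b1 x * p + Du b2 x) / \<Phi> x"
  shows "Du e1 x = p *\<^sub>R e2 x" "Dv e1 x = q *\<^sub>R e2 x + (M / \<Phi> x) *\<^sub>R n x"
    "Du e2 x = p *\<^sub>R e1 x + (M / b2 x) *\<^sub>R n x"
    "Dv e2 x = q *\<^sub>R e1 x + (- b1 x * (M / \<Phi> x) / b2 x) *\<^sub>R n x"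
    "Du n x = (M / b2 x) *\<^sub>R e2 x"
    "Dv n x = (- b1 x * (M / \<Phi> x) / b2 x) *\<^sub>R e2 x - (M / \<Phi> x) *\<^sub>R e1 x"
proof -
  note f = lorentz_frameD[OF fr[OF W(2)]]
  have d: "g differentiable (at x)" if "smooth_on W g" for g :: "real \<times> real \<Rightarrow> 'c::real_normed_vector"
    by (rule smooth_on_differentiable[OF that W(2)])
  note dd = sm[THEN d]
  note rel = lorentz_const_partials[OF W dd(1) dd(1) lorentz_frameD(1)[OF fr]]
    lorentz_const_partials[OF W dd(2) dd(2) lorentz_frameD(2)[OF fr]]
    lorentz_const_partials[OF W dd(3) dd(3) lorentz_frameD(3)[OF fr]]
    lorentz_const_partials[OF W dd(1) dd(2) lorentz_frameD(4)[OF fr]]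
    lorentz_const_partials[OF W dd(1) dd(3) lorentz_frameD(5)[OF fr]]
    lorentz_const_partials[OF W dd(2) dd(3) lorentz_frameD(6)[OF fr]]
  have zz: "Du (Du z) x = \<Phi> x *\<^sub>R Du e1 x + Du \<Phi> x *\<^sub>R e1 x" "Dv (Du z) x = \<Phi> x *\<^sub>R Dv e1 x + Dv \<Phi> x *\<^sub>R e1 x"
  proof -
    have "Du (Du z) x = Du (\<lambda>y. \<Phi> y *\<^sub>R e1 y) x" "Dv (Du z) x = Dv (\<lambda>y. \<Phi> y *\<^sub>R e1 y) x"
      by (rule Du_Dv_cong[OF W zu], assumption)+
    then show "Du (Du z) x = \<Phi> x *\<^sub>R Du e1 x + Du \<Phi> x *\<^sub>R e1 x" "Dv (Du z) x = \<Phi> x *\<^sub>R Dv e1 x + Dv \<Phi> x *\<^sub>R e1 x"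
      by (simp_all add: Du_scaleR[OF dd(4) dd(1)])
  qed
  have zz': "Du (Dv z) x = (b1 x *\<^sub>R Du e1 x + Du b1 x *\<^sub>R e1 x) + (b2 x *\<^sub>R Du e2 x + Du b2 x *\<^sub>R e2 x)"
    "Dv (Dv z) x = (b1 x *\<^sub>R Dv e1 x + Dv b1 x *\<^sub>R e1 x) + (b2 x *\<^sub>R Dv e2 x + Dv b2 x *\<^sub>R e2 x)"
  proof -
    have c: "Du (Dv z) x = Du (\<lambda>y. b1 y *\<^sub>R e1 y + b2 y *\<^sub>R e2 y) x" "Dv (Dv z) x = Dv (\<lambda>y. b1 y *\<^sub>R e1 y + b2 y *\<^sub>R e2 y) x"
      by (rule Du_Dv_cong[OF W zv], assumption)+
    have s: "smooth_on W (\<lambda>y. b1 y *\<^sub>R e1 y)" "smooth_on W (\<lambda>y. b2 y *\<^sub>R e2 y)"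
      by (intro smooth_on_scaleR W sm)+
    show "Du (Dv z) x = (b1 x *\<^sub>R Du e1 x + Du b1 x *\<^sub>R e1 x) + (b2 x *\<^sub>R Du e2 x + Du b2 x *\<^sub>R e2 x)"
      "Dv (Dv z) x = (b1 x *\<^sub>R Dv e1 x + Dv b1 x *\<^sub>R e1 x) + (b2 x *\<^sub>R Dv e2 x + Dv b2 x *\<^sub>R e2 x)"
      unfolding c Du_add[OF d[OF s(1)] d[OF s(2)]] Du_scaleR[OF dd(5) dd(1)] Du_scaleR[OF dd(6) dd(2)] by simp_all
  qed
  have diag: "lorentz (e1 x) (Du e1 x) = 0" "lorentz (e1 x) (Dv e1 x) = 0" "lorentz (e2 x) (Du e2 x) = 0"
    "lorentz (e2 x) (Dv e2 x) = 0" "lorentz (n x) (Du n x) = 0" "lorentz (n x) (Dv n x) = 0"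
    using rel(1-6) by simp_all
  have off: "lorentz (e1 x) (Du e2 x) = - lorentz (e2 x) (Du e1 x)" "lorentz (e1 x) (Dv e2 x) = - lorentz (e2 x) (Dv e1 x)"
    "lorentz (e1 x) (Du n x) = - lorentz (n x) (Du e1 x)" "lorentz (e1 x) (Dv n x) = - lorentz (n x) (Dv e1 x)"
    "lorentz (e2 x) (Du n x) = - lorentz (n x) (Du e2 x)" "lorentz (e2 x) (Dv n x) = - lorentz (n x) (Dv e2 x)"
    by (rule rel, assumption)+
  have n1u: "lorentz (n x) (Du e1 x) = 0"
    using LMN(1) nz by (simp add: zz lorentz_simps f)
  have n1v: "lorentz (n x) (Dv e1 x) = M / \<Phi> x"
    using LMN(2) nz by (simp add: zz lorentz_simps f field_simps)
  have n2v: "lorentz (n x) (Dv e2 x) = - b1 x * (M / \<Phi> x) / b2 x"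
  proof -
    have "b1 x * (M / \<Phi> x) + b2 x * lorentz (n x) (Dv e2 x) = 0"
      using LMN(3) by (simp add: zz' lorentz_simps f n1v)
    then have "b2 x * lorentz (n x) (Dv e2 x) = - b1 x * (M / \<Phi> x)" by linarith
    then show ?thesis by (metis nonzero_mult_div_cancel_left nz(2))
  qed
  have comm: "Dv (Du z) x = Du (Dv z) x" by (rule Dv_Du_commute[OF W z])
  have n2u: "lorentz (n x) (Du e2 x) = M / b2 x"
    using LMN(2) nz unfolding comm by (simp add: zz' lorentz_simps f n1u field_simps)
  have p: "lorentz (e2 x) (Du e1 x) = - p"
  proof -
    have "lorentz (e1 x) (Dv (Du z) x) = lorentz (e1 x) (Du (Dv z) x)" by (simp add: comm)
    then have "Dv \<Phi> x = Du b1 x - b2 x * lorentz (e2 x) (Du e1 x)"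
      by (simp add: zz zz' lorentz_simps f diag off)
    then show ?thesis using nz by (simp add: p_def field_simps)
  qed
  have q: "lorentz (e2 x) (Dv e1 x) = - q"
  proof -
    have "lorentz (e2 x) (Dv (Du z) x) = lorentz (e2 x) (Du (Dv z) x)" by (simp add: comm)
    then have "\<Phi> x * lorentz (e2 x) (Dv e1 x) = - (b1 x * p) - Du b2 x"
      by (simp add: zz zz' lorentz_simps f diag p)
    then show ?thesis using nz by (simp add: q_def field_simps)
  qed
  note ex = lorentz_frame_expansion[OF fr[OF W(2)]]
  show "Du e1 x = p *\<^sub>R e2 x" using ex[of "Du e1 x"] by (simp add: diag p n1u)
  show "Dv e1 x = q *\<^sub>R e2 x + (M / \<Phi> x) *\<^sub>R n x" using ex[of "Dv e1 x"] by (simp add: diag q n1v)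
  show "Du e2 x = p *\<^sub>R e1 x + (M / b2 x) *\<^sub>R n x" using ex[of "Du e2 x"] by (simp add: diag off p n2u)
  show "Dv e2 x = q *\<^sub>R e1 x + (- b1 x * (M / \<Phi> x) / b2 x) *\<^sub>R n x"
    using ex[of "Dv e2 x"] unfolding diag off q n2v by simp
  show "Du n x = (M / b2 x) *\<^sub>R e2 x" using ex[of "Du n x"] by (simp add: diag off n1u n2u)
  show "Dv n x = (- b1 x * (M / \<Phi> x) / b2 x) *\<^sub>R e2 x - (M / \<Phi> x) *\<^sub>R e1 x"
    using ex[of "Dv n x"] unfolding diag off n1v n2v by simp
qed

text \<open>The linear map taking one frame to the other is independent of the base point, because both
  frames have the same skew connection matrices.\<close>

lemma rigid_motion_of_frames:
  fixes z z' e1 e2 n e1' e2' n' :: "real \<times> real \<Rightarrow> real^3"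
  assumes W: "open W" "convex W" "x0 \<in> W"
    and dif: "\<And>x. x \<in> W \<Longrightarrow> z differentiable (at x)" "\<And>x. x \<in> W \<Longrightarrow> z' differentiable (at x)"
      "\<And>x. x \<in> W \<Longrightarrow> e1 differentiable (at x)" "\<And>x. x \<in> W \<Longrightarrow> e2 differentiable (at x)" "\<And>x. x \<in> W \<Longrightarrow> n differentiable (at x)"
      "\<And>x. x \<in> W \<Longrightarrow> e1' differentiable (at x)" "\<And>x. x \<in> W \<Longrightarrow> e2' differentiable (at x)" "\<And>x. x \<in> W \<Longrightarrow> n' differentiable (at x)"
    and fr: "\<And>x. x \<in> W \<Longrightarrow> lorentz_frame (e1 x) (e2 x) (n x)" "\<And>x. x \<in> W \<Longrightarrow> lorentz_frame (e1' x) (e2' x) (n' x)"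
    and s: "\<And>x. x \<in> W \<Longrightarrow> Du e1 x = p x *\<^sub>R e2 x" "\<And>x. x \<in> W \<Longrightarrow> Dv e1 x = q x *\<^sub>R e2 x + m x *\<^sub>R n x"
      "\<And>x. x \<in> W \<Longrightarrow> Du e2 x = p x *\<^sub>R e1 x + r x *\<^sub>R n x" "\<And>x. x \<in> W \<Longrightarrow> Dv e2 x = q x *\<^sub>R e1 x + k x *\<^sub>R n x"
      "\<And>x. x \<in> W \<Longrightarrow> Du n x = r x *\<^sub>R e2 x" "\<And>x. x \<in> W \<Longrightarrow> Dv n x = k x *\<^sub>R e2 x - m x *\<^sub>R e1 x"
    and s': "\<And>x. x \<in> W \<Longrightarrow> Du e1' x = p x *\<^sub>R e2' x" "\<And>x. x \<in> W \<Longrightarrow> Dv e1' x = q x *\<^sub>R e2' x + m x *\<^sub>R n' x"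
      "\<And>x. x \<in> W \<Longrightarrow> Du e2' x = p x *\<^sub>R e1' x + r x *\<^sub>R n' x" "\<And>x. x \<in> W \<Longrightarrow> Dv e2' x = q x *\<^sub>R e1' x + k x *\<^sub>R n' x"
      "\<And>x. x \<in> W \<Longrightarrow> Du n' x = r x *\<^sub>R e2' x" "\<And>x. x \<in> W \<Longrightarrow> Dv n' x = k x *\<^sub>R e2' x - m x *\<^sub>R e1' x"
    and z: "\<And>x. x \<in> W \<Longrightarrow> Du z x = \<Phi> x *\<^sub>R e1 x" "\<And>x. x \<in> W \<Longrightarrow> Dv z x = b1 x *\<^sub>R e1 x + b2 x *\<^sub>R e2 x"
    and z': "\<And>x. x \<in> W \<Longrightarrow> Du z' x = \<Phi> x *\<^sub>R e1' x" "\<And>x. x \<in> W \<Longrightarrow> Dv z' x = b1 x *\<^sub>R e1' x + b2 x *\<^sub>R e2' x"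
  shows "\<exists>T. motion T \<and> (\<forall>x\<in>W. z' x = T (z x))"
proof -
  define A where "A x y = lorentz (e1 x) y *\<^sub>R e1' x - lorentz (e2 x) y *\<^sub>R e2' x + lorentz (n x) y *\<^sub>R n' x" for x y
  note dl = bounded_linear.has_derivative[OF bounded_bilinear.bounded_linear_left[OF bounded_bilinear_lorentz]]
  have "((\<lambda>x. A x y) has_derivative (\<lambda>_. 0)) (at x within W)" if x: "x \<in> W" for x y
  proof -
    note D = dif[OF x, THEN differentiable_partials(1)]
    have "((\<lambda>x. A x y) has_derivative (\<lambda>h.
        (lorentz (e1 x) y *\<^sub>R (fst h *\<^sub>R Du e1' x + snd h *\<^sub>R Dv e1' x) + lorentz (fst h *\<^sub>R Du e1 x + snd h *\<^sub>R Dv e1 x) y *\<^sub>R e1' x)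
      - (lorentz (e2 x) y *\<^sub>R (fst h *\<^sub>R Du e2' x + snd h *\<^sub>R Dv e2' x) + lorentz (fst h *\<^sub>R Du e2 x + snd h *\<^sub>R Dv e2 x) y *\<^sub>R e2' x)
      + (lorentz (n x) y *\<^sub>R (fst h *\<^sub>R Du n' x + snd h *\<^sub>R Dv n' x) + lorentz (fst h *\<^sub>R Du n x + snd h *\<^sub>R Dv n x) y *\<^sub>R n' x))) (at x)"
      unfolding A_def by (intro has_derivative_add has_derivative_diff has_derivative_scaleR dl D)
    moreover have "(\<lambda>h.
        (lorentz (e1 x) y *\<^sub>R (fst h *\<^sub>R Du e1' x + snd h *\<^sub>R Dv e1' x) + lorentz (fst h *\<^sub>R Du e1 x + snd h *\<^sub>R Dv e1 x) y *\<^sub>R e1' x)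
      - (lorentz (e2 x) y *\<^sub>R (fst h *\<^sub>R Du e2' x + snd h *\<^sub>R Dv e2' x) + lorentz (fst h *\<^sub>R Du e2 x + snd h *\<^sub>R Dv e2 x) y *\<^sub>R e2' x)
      + (lorentz (n x) y *\<^sub>R (fst h *\<^sub>R Du n' x + snd h *\<^sub>R Dv n' x) + lorentz (fst h *\<^sub>R Du n x + snd h *\<^sub>R Dv n x) y *\<^sub>R n' x)) = (\<lambda>_. 0)"
      by (rule ext) (simp add: s[OF x] s'[OF x] lorentz_simps algebra_simps)
    ultimately show ?thesis by (simp add: has_derivative_at_withinI)
  qed
  from has_derivative_zero_unique[OF W(2) this]
  have const: "A x y = A x0 y" if "x \<in> W" for x y using that W(3) by blast
  have im: "A x (e1 x) = e1' x" "A x (e2 x) = e2' x" if "x \<in> W" for x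
    by (simp_all add: A_def lorentz_frameD[OF fr(1)[OF that]])
  note A0 = lorentz_frame_change[OF fr(1)[OF W(3)] fr(2)[OF W(3)], folded A_def]
  have blA: "bounded_linear (A x0)" using A0(1) by (simp add: linear_conv_bounded_linear)
  interpret A0: bounded_linear "A x0" by (rule blA)
  \<comment> \<open>As the frames correspond under one fixed linear map, so do the differentials of
    the two surfaces; what is left is the translation part of the motion.\<close>
  have "((\<lambda>x. z' x - A x0 (z x)) has_derivative (\<lambda>_. 0)) (at x within W)" if x: "x \<in> W" for x
  proof -
    note D = dif[OF x, THEN differentiable_partials(1)]
    have "((\<lambda>x. z' x - A x0 (z x)) has_derivative (\<lambda>h. (fst h *\<^sub>R Du z' x + snd h *\<^sub>R Dv z' x)
       - A x0 (fst h *\<^sub>R Du z x + snd h *\<^sub>R Dv z x))) (at x)"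
      by (intro has_derivative_diff bounded_linear.has_derivative[OF blA] D)
    moreover have "(\<lambda>h. (fst h *\<^sub>R Du z' x + snd h *\<^sub>R Dv z' x) - A x0 (fst h *\<^sub>R Du z x + snd h *\<^sub>R Dv z x)) = (\<lambda>_. 0)"
      using im[OF x] const[OF x]
      by (intro ext) (simp add: z[OF x] z'[OF x] A0.add A0.scaleR)
    ultimately show ?thesis by (simp add: has_derivative_at_withinI)
  qed
  from has_derivative_zero_unique[OF W(2) this]
  have "z' x - A x0 (z x) = z' x0 - A x0 (z x0)" if "x \<in> W" for x using that W(3) by blast
  then have "\<forall>x\<in>W. z' x = A x0 (z x) + (z' x0 - A x0 (z x0))" by (metis diff_add_cancel add.commute)
  moreover have "motion (\<lambda>y. A x0 y + (z' x0 - A x0 (z x0)))"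
    unfolding motion_def using A0 by blast
  ultimately show ?thesis by blast
qed

section \<open>A surface in canonical parameters with prescribed curvatures\<close>

context curvature_data
begin

text \<open>The coefficients of \<open>surface_structure_equations\<close> for
  \<open>b1 = \<Psi> a\<close>, \<open>b2 = \<Psi> w\<close> and
  \<open>M = \<alpha> \<Phi> \<Psi>\<close> with \<open>\<alpha> = w sqrt K\<close>. Taking
  \<open>\<Phi>\<close> and \<open>\<Psi>\<close> as arguments shows that besides these only
  \<open>K\<close> and \<open>H\<close> enter, so surfaces with the same pair share them.\<close>

definition "con_M \<Phi> \<Psi> x = w x * sqrt (K x) * \<Phi> x * \<Psi> x"
definition "con_p \<Phi> \<Psi> x = (Dv \<Phi> x - Du (\<lambda>y. \<Psi> y * a y) x) / (\<Psi> x * w x)"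
definition "con_q \<Phi> \<Psi> x = (\<Psi> x * a x * con_p \<Phi> \<Psi> x + Du (\<lambda>y. \<Psi> y * w y) x) / \<Phi> x"
definition "con_m \<Phi> \<Psi> x = con_M \<Phi> \<Psi> x / \<Phi> x"
definition "con_r \<Phi> \<Psi> x = con_M \<Phi> \<Psi> x / (\<Psi> x * w x)"
definition "con_k \<Phi> \<Psi> x = - (\<Psi> x * a x) * con_m \<Phi> \<Psi> x / (\<Psi> x * w x)"

end

locale canonical_surface = curvature_data +
  fixes W :: "(real \<times> real) set" and u0 v0 :: real and z :: "real \<times> real \<Rightarrow> real^3"
  assumes WD: "W \<subseteq> D" and canonical: "canonical_surface_with_curvatures W u0 v0 K H z"
begin

definition \<Phi> where "\<Phi> p = sqrt (coefE z p)"
definition \<Psi> where "\<Psi> p = sqrt (- coefG z p)"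

lemma W: "open_rectangle W" "(u0, v0) \<in> W" "open W" "convex W"
  using canonical open_rectangle_open open_rectangle_convex
  by (auto simp: canonical_surface_with_curvatures_def canonical_asymptotic_on_def)

lemma smooth_z: "smooth_on W z"
  using canonical by (simp add: canonical_surface_with_curvatures_def timelike_surface_def)

lemma asymptotic:
  assumes "p \<in> W"
  shows "coefL z p = 0" "coefN z p = 0" "coefE z p > 0" "coefG z p < 0" "surf_alpha z p > 0"
    "gauss_curv z p = K p" "mean_curv z p = H p"
  using canonical assms
  by (auto simp: canonical_surface_with_curvatures_def canonical_asymptotic_on_def asymptotic_on_def)

lemma \<Phi>_pos: "p \<in> W \<Longrightarrow> \<Phi> p > 0" and \<Psi>_pos: "p \<in> W \<Longrightarrow> \<Psi> p > 0"
  using asymptotic by (simp_all add: \<Phi>_def \<Psi>_def)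

lemma first_form:
  assumes "p \<in> W"
  shows "coefE z p = (\<Phi> p)\<^sup>2" "coefG z p = - (\<Psi> p)\<^sup>2" "coefF z p = surf_a z p * \<Phi> p * \<Psi> p"
    "coefM z p = surf_alpha z p * \<Phi> p * \<Psi> p"
  using asymptotic[OF assms] \<Phi>_pos[OF assms] \<Psi>_pos[OF assms]
  by (auto simp: surf_a_def surf_alpha_def simp flip: \<Phi>_def \<Psi>_def) (simp_all add: \<Phi>_def \<Psi>_def)

text \<open>For \<open>L = N = 0\<close> the curvature formulas make \<open>K - H * H\<close> the
  square of \<open>\<alpha> / (1 + a * a)\<close>, with \<open>a\<close> and \<open>\<alpha>\<close>
  those of the surface. The normalization \<open>\<alpha> > 0\<close> selects the root, and dividing
  \<open>H\<close> by it recovers \<open>a\<close>.\<close>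

lemma surf_a_alpha:
  assumes p: "p \<in> W"
  shows "surf_a z p = a p" "surf_alpha z p = w p * sqrt (K p)"
proof -
  let ?A = "surf_a z p" and ?al = "surf_alpha z p" and ?t = "(\<Phi> p * \<Psi> p)\<^sup>2"
  have t: "?t \<noteq> 0" using \<Phi>_pos[OF p] \<Psi>_pos[OF p] by simp
  have c: "1 + ?A\<^sup>2 > 0" by (simp add: add_pos_nonneg)
  have al: "?al > 0" by (rule asymptotic[OF p])
  have den: "coefE z p * coefG z p - (coefF z p)\<^sup>2 = - (?t * (1 + ?A\<^sup>2))"
    by (simp add: first_form[OF p] power_mult_distrib algebra_simps)
  have "(coefM z p)\<^sup>2 = ?t * ?al\<^sup>2" "coefF z p * coefM z p = ?t * (?A * ?al)"
    by (simp_all add: first_form[OF p] power2_eq_square)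
  then have KH: "K p = ?al\<^sup>2 / (1 + ?A\<^sup>2)" "H p = ?A * ?al / (1 + ?A\<^sup>2)"
    using t c asymptotic(6,7)[OF p, symmetric] unfolding gauss_curv_def mean_curv_def den asymptotic(1,2)[OF p]
    by (simp_all add: mult.assoc)
  have "K p - (H p)\<^sup>2 = (?al / (1 + ?A\<^sup>2))\<^sup>2"
  proof -
    have "K p - (H p)\<^sup>2 = (?al\<^sup>2 * (1 + ?A\<^sup>2) - (?A * ?al)\<^sup>2) / (1 + ?A\<^sup>2)\<^sup>2"
      using c by (simp add: KH power_divide diff_divide_distrib power2_eq_square)
    also have "?al\<^sup>2 * (1 + ?A\<^sup>2) - (?A * ?al)\<^sup>2 = ?al\<^sup>2" by (simp add: power_mult_distrib algebra_simps)
    finally show ?thesis by (simp add: power_divide)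
  qed
  then have "sqrt (K p - (H p)\<^sup>2) = ?al / (1 + ?A\<^sup>2)" using al c by simp
  then show A: "surf_a z p = a p" using al c by (simp add: a_eq KH)
  have "(w p * sqrt (K p))\<^sup>2 = ?al\<^sup>2"
    using c K_pos[of p] WD p w_pos[of p] by (auto simp: power_mult_distrib KH(1) A w_sq[symmetric])
  then show "surf_alpha z p = w p * sqrt (K p)"
    using al w_pos[of p] K_pos[of p] WD p by (auto simp: power2_eq_iff_nonneg)
qed

lemma smooth_coefs: "smooth_on W \<Phi>" "smooth_on W \<Psi>"
proof -
  have "smooth_on W (coefE z)" "smooth_on W (coefG z)"
    unfolding coefE_def[abs_def] coefG_def[abs_def] smooth_on_def
    using smooth_on_Du[OF smooth_z] smooth_on_Dv[OF smooth_z]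
    by (auto intro!: bounded_bilinear.Ck_on_prod[OF bounded_bilinear_lorentz] W simp: smooth_on_def)
  then show "smooth_on W \<Phi>" "smooth_on W \<Psi>"
    unfolding \<Phi>_def[abs_def] \<Psi>_def[abs_def]
    by (intro smooth_on_sqrt smooth_on_minus W; use asymptotic in simp)+
qed

lemmas smooth_W = smooth_a[THEN smooth_on_subset, OF WD] smooth_w[THEN smooth_on_subset, OF WD]
  smooth_sqrt_K[THEN smooth_on_subset, OF WD]

definition e1 where "e1 p = (1 / \<Phi> p) *\<^sub>R Du z p"
definition e2 where "e2 p = (1 / w p) *\<^sub>R ((1 / \<Psi> p) *\<^sub>R Dv z p - a p *\<^sub>R e1 p)"
definition n where "n p = lorentz_cross (e1 p) (e2 p)"

lemma smooth_frame: "smooth_on W e1" "smooth_on W e2" "smooth_on W n"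
proof -
  have nz: "\<Phi> p \<noteq> 0" "\<Psi> p \<noteq> 0" "w p \<noteq> 0" if "p \<in> W" for p
    using \<Phi>_pos[OF that] \<Psi>_pos[OF that] w_pos[of p] by auto
  show 1: "smooth_on W e1"
    unfolding e1_def[abs_def]
    by (intro smooth_on_scaleR smooth_on_divide smooth_on_const smooth_on_Du smooth_z smooth_coefs W nz)
  show 2: "smooth_on W e2"
    unfolding e2_def[abs_def]
    by (intro smooth_on_scaleR smooth_on_diff smooth_on_divide smooth_on_const smooth_on_Dv smooth_z smooth_coefs
        smooth_W 1 W nz)
  show "smooth_on W n"
    using 1 2 unfolding n_def[abs_def] smooth_on_def
    by (auto intro!: bounded_bilinear.Ck_on_prod[OF bounded_bilinear_lorentz_cross] W)
qed

lemma frame: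
  assumes p: "p \<in> W"
  shows "lorentz_frame (e1 p) (e2 p) (n p)" "Du z p = \<Phi> p *\<^sub>R e1 p"
    "Dv z p = \<Psi> p *\<^sub>R (a p *\<^sub>R e1 p + w p *\<^sub>R e2 p)"
proof -
  have E: "lorentz (Du z p) (Du z p) > 0" "lorentz (Dv z p) (Dv z p) < 0"
    using asymptotic[OF p] by (simp_all add: coefE_def coefG_def)
  have a: "lorentz (Du z p) (Dv z p) / (sqrt (lorentz (Du z p) (Du z p)) * sqrt (- lorentz (Dv z p) (Dv z p))) = a p"
    using surf_a_alpha(1)[OF p] by (simp add: surf_a_def coefE_def coefF_def coefG_def)
  note ex = adapted_frame_exists[OF E, unfolded a, folded w_def coefE_def coefG_def, folded \<Phi>_def \<Psi>_def,
      folded e1_def, folded e2_def, folded n_def]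
  show "lorentz_frame (e1 p) (e2 p) (n p)" "Du z p = \<Phi> p *\<^sub>R e1 p"
    "Dv z p = \<Psi> p *\<^sub>R (a p *\<^sub>R e1 p + w p *\<^sub>R e2 p)"
    by (rule ex)+
qed

lemma Dv_z: "p \<in> W \<Longrightarrow> Dv z p = (\<Psi> p * a p) *\<^sub>R e1 p + (\<Psi> p * w p) *\<^sub>R e2 p"
  using frame(3)[of p] by (simp add: algebra_simps)

lemma unit_normal: "p \<in> W \<Longrightarrow> unit_normal z p = n p"
  unfolding unit_normal_def
  by (rule adapted_frame_normal_unique[OF frame(1) \<Phi>_pos \<Psi>_pos w_pos frame(2,3)])

lemma second_form:
  assumes "p \<in> W"
  shows "lorentz (n p) (Du (Du z) p) = 0" "lorentz (n p) (Dv (Du z) p) = w p * sqrt (K p) * \<Phi> p * \<Psi> p"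
    "lorentz (n p) (Dv (Dv z) p) = 0"
  using asymptotic(1,2)[OF assms] first_form(4)[OF assms]
  by (simp_all add: coefL_def coefM_def coefN_def unit_normal[OF assms] surf_a_alpha(2)[OF assms])

lemma structure_equations:
  assumes x: "x \<in> W"
  shows "Du e1 x = con_p \<Phi> \<Psi> x *\<^sub>R e2 x" "Dv e1 x = con_q \<Phi> \<Psi> x *\<^sub>R e2 x + con_m \<Phi> \<Psi> x *\<^sub>R n x"
    "Du e2 x = con_p \<Phi> \<Psi> x *\<^sub>R e1 x + con_r \<Phi> \<Psi> x *\<^sub>R n x"
    "Dv e2 x = con_q \<Phi> \<Psi> x *\<^sub>R e1 x + con_k \<Phi> \<Psi> x *\<^sub>R n x"
    "Du n x = con_r \<Phi> \<Psi> x *\<^sub>R e2 x"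
    "Dv n x = con_k \<Phi> \<Psi> x *\<^sub>R e2 x - con_m \<Phi> \<Psi> x *\<^sub>R e1 x"
proof -
  have nz: "\<Phi> x \<noteq> 0" "\<Psi> x * w x \<noteq> 0"
    using \<Phi>_pos[OF x] \<Psi>_pos[OF x] w_pos[of x] by auto
  show "Du e1 x = con_p \<Phi> \<Psi> x *\<^sub>R e2 x" "Dv e1 x = con_q \<Phi> \<Psi> x *\<^sub>R e2 x + con_m \<Phi> \<Psi> x *\<^sub>R n x"
    "Du e2 x = con_p \<Phi> \<Psi> x *\<^sub>R e1 x + con_r \<Phi> \<Psi> x *\<^sub>R n x"
    "Dv e2 x = con_q \<Phi> \<Psi> x *\<^sub>R e1 x + con_k \<Phi> \<Psi> x *\<^sub>R n x"
    "Du n x = con_r \<Phi> \<Psi> x *\<^sub>R e2 x"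
    "Dv n x = con_k \<Phi> \<Psi> x *\<^sub>R e2 x - con_m \<Phi> \<Psi> x *\<^sub>R e1 x"
    unfolding con_q_def con_p_def con_k_def con_m_def con_r_def con_M_def
    by (rule surface_structure_equations[OF W(3) x smooth_z smooth_frame smooth_coefs(1)
          smooth_on_mult[OF W(3) smooth_coefs(2) smooth_W(1)] smooth_on_mult[OF W(3) smooth_coefs(2) smooth_W(2)]
          frame(1,2) Dv_z nz second_form[OF x]], assumption+)+
qed

lemma surf_f_eq: "p \<in> W \<Longrightarrow> surf_f z p = - logK4 p"
  using WD w_pos[of p] K_pos[of p]
  by (auto simp: surf_f_def surf_a_alpha logK4_eq_ln_sqrt abs_mult ln_mult simp flip: w_def)

lemma canon_eq:
  assumes p: "p \<in> W"
  shows "canon_v z p = - (Dv K p / (4 * K p)) - a p * (Du K p / (4 * K p)) * (\<Psi> p / \<Phi> p)"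
    and "canon_u z p = a p * (Dv K p / (4 * K p)) * (\<Phi> p / \<Psi> p) - Du K p / (4 * K p)"
proof -
  obtain u v where x: "p = (u, v)" by fastforce
  have uD: "(u, v) \<in> D" using p WD x by blast
  have "Du (surf_f z) p = - (Du K p / (4 * K p))" "Dv (surf_f z) p = - (Dv K p / (4 * K p))"
    using Du_Dv_cong[OF W(3) p surf_f_eq] Du_real_eqI[OF DERIV_minus[OF logK4_partials(1)[OF uD]]]
      Dv_real_eqI[OF DERIV_minus[OF logK4_partials(2)[OF uD]]] by (auto simp: x)
  then show "canon_v z p = - (Dv K p / (4 * K p)) - a p * (Du K p / (4 * K p)) * (\<Psi> p / \<Phi> p)"
    "canon_u z p = a p * (Dv K p / (4 * K p)) * (\<Phi> p / \<Psi> p) - Du K p / (4 * K p)"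
    by (simp_all add: canon_v_def canon_u_def surf_a_alpha[OF p] flip: \<Phi>_def \<Psi>_def)
qed

lemma integral_equations:
  assumes "(u, v) \<in> W"
  shows "\<Phi> (u, v) = exp ((LBINT s=v0..v. canon_v z (u, s)) + (LBINT t=u0..u. canon_u z (t, v0)) + surf_f z (u0, v0))"
    and "\<Psi> (u, v) = exp ((LBINT t=u0..u. canon_u z (t, v)) + (LBINT s=v0..v. canon_v z (u0, s)) + surf_f z (u0, v0))"
  using canonical assms
  by (auto simp: canonical_surface_with_curvatures_def canonical_asymptotic_on_def \<Phi>_def \<Psi>_def)

lemma continuous_canon: "continuous_on W (canon_v z)" "continuous_on W (canon_u z)"
proof -
  note c = smooth_K_quotients[THEN smooth_on_continuous, THEN continuous_on_subset, OF WD]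
    smooth_W(1)[THEN smooth_on_continuous] smooth_coefs[THEN smooth_on_continuous]
  have nz: "\<forall>p\<in>W. \<Phi> p \<noteq> 0" "\<forall>p\<in>W. \<Psi> p \<noteq> 0" using \<Phi>_pos \<Psi>_pos less_irrefl by metis+
  have "continuous_on W (\<lambda>p. - (Dv K p / (4 * K p)) - a p * (Du K p / (4 * K p)) * (\<Psi> p / \<Phi> p))"
    "continuous_on W (\<lambda>p. a p * (Dv K p / (4 * K p)) * (\<Phi> p / \<Psi> p) - Du K p / (4 * K p))"
    by (intro continuous_on_diff continuous_on_mult continuous_on_minus continuous_on_divide[of _ \<Psi> \<Phi>]
        continuous_on_divide[of _ \<Phi> \<Psi>] c nz)+
  then show "continuous_on W (canon_v z)" "continuous_on W (canon_u z)"
    by (simp_all add: canon_eq cong: continuous_on_cong_simp)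
qed

text \<open>In the formula for \<open>\<Phi>\<close> only the first integral depends on
  \<open>v\<close>, so its logarithmic \<open>v\<close>-derivative is \<open>canon_v\<close>;
  similarly for \<open>\<Psi>\<close> and \<open>u\<close>. Multiplying by \<open>\<Phi>\<close> or
  \<open>\<Psi>\<close> cancels their ratio and leaves a linear system.\<close>

lemma goursat_system:
  assumes uv: "(u, v) \<in> W"
  shows "((\<lambda>t. \<Phi> (u, t)) has_real_derivative - (Dv K (u, v) / (4 * K (u, v))) * \<Phi> (u, v)
      + - (a (u, v) * (Du K (u, v) / (4 * K (u, v)))) * \<Psi> (u, v)) (at v)"
    and "((\<lambda>t. \<Psi> (t, v)) has_real_derivative a (u, v) * (Dv K (u, v) / (4 * K (u, v))) * \<Phi> (u, v)
      + - (Du K (u, v) / (4 * K (u, v))) * \<Psi> (u, v)) (at u)"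
proof -
  obtain b1 d1 b2 d2 where Wb: "W = {b1<..<d1} \<times> {b2<..<d2}" by (rule open_rectangleE[OF W(1)])
  have cv: "continuous_on {b2<..<d2} (\<lambda>s. canon_v z (u, s))" "continuous_on {b1<..<d1} (\<lambda>s. canon_u z (s, v))"
    by (rule continuous_on_compose2[OF continuous_canon(1)] continuous_on_compose2[OF continuous_canon(2)],
        use uv in \<open>auto simp: Wb intro!: continuous_intros\<close>)+
  have "((\<lambda>t. \<Phi> (u, t)) has_real_derivative canon_v z (u, v) * \<Phi> (u, v)) (at v)"
    by (rule DERIV_exp_interval_integral[of v0 b2 d2 v "\<lambda>s. canon_v z (u, s)" "\<lambda>t. \<Phi> (u, t)"
          "(LBINT t=u0..u. canon_u z (t, v0)) + surf_f z (u0, v0)"])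
       (use uv W(2) cv integral_equations(1) in \<open>auto simp: Wb add.assoc\<close>)
  moreover have "canon_v z (u, v) * \<Phi> (u, v) = - (Dv K (u, v) / (4 * K (u, v))) * \<Phi> (u, v)
      + - (a (u, v) * (Du K (u, v) / (4 * K (u, v)))) * \<Psi> (u, v)"
    unfolding canon_eq[OF uv] using \<Phi>_pos[OF uv] by (simp add: left_diff_distrib)
  ultimately show "((\<lambda>t. \<Phi> (u, t)) has_real_derivative - (Dv K (u, v) / (4 * K (u, v))) * \<Phi> (u, v)
      + - (a (u, v) * (Du K (u, v) / (4 * K (u, v)))) * \<Psi> (u, v)) (at v)" by simp
  have "((\<lambda>t. \<Psi> (t, v)) has_real_derivative canon_u z (u, v) * \<Psi> (u, v)) (at u)"
    by (rule DERIV_exp_interval_integral[of u0 b1 d1 u "\<lambda>s. canon_u z (s, v)" "\<lambda>t. \<Psi> (t, v)"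
          "(LBINT s=v0..v. canon_v z (u0, s)) + surf_f z (u0, v0)"])
       (use uv W(2) cv integral_equations(2) in \<open>auto simp: Wb add.assoc\<close>)
  moreover have "canon_u z (u, v) * \<Psi> (u, v) = a (u, v) * (Dv K (u, v) / (4 * K (u, v))) * \<Phi> (u, v)
      + - (Du K (u, v) / (4 * K (u, v))) * \<Psi> (u, v)"
    unfolding canon_eq[OF uv] using \<Psi>_pos[OF uv] by (simp add: left_diff_distrib)
  ultimately show "((\<lambda>t. \<Psi> (t, v)) has_real_derivative a (u, v) * (Dv K (u, v) / (4 * K (u, v))) * \<Phi> (u, v)
      + - (Du K (u, v) / (4 * K (u, v))) * \<Psi> (u, v)) (at u)" by simp
qed

text \<open>On an axis one integral in each formula is over a trivial interval and the remaining
  exponents coincide. The ratio of \<open>\<Phi>\<close> and \<open>\<Psi>\<close> is then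
  \<open>1\<close>, and the integrand no longer refers to the surface.\<close>

lemma axis_values:
  shows "(u, v0) \<in> W \<Longrightarrow> \<Phi> (u, v0) =
      exp ((LBINT t=u0..u. a (t, v0) * (Dv K (t, v0) / (4 * K (t, v0))) - Du K (t, v0) / (4 * K (t, v0))) - logK4 (u0, v0))"
    and "(u0, v) \<in> W \<Longrightarrow> \<Psi> (u0, v) =
      exp ((LBINT s=v0..v. - (Dv K (u0, s) / (4 * K (u0, s))) - a (u0, s) * (Du K (u0, s) / (4 * K (u0, s)))) - logK4 (u0, v0))"
proof -
  have eq: "\<Phi> (t, v0) = \<Psi> (t, v0)" if "(t, v0) \<in> W" for t
    by (simp add: integral_equations[OF that])
  have eq': "\<Phi> (u0, t) = \<Psi> (u0, t)" if "(u0, t) \<in> W" for t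
    by (simp add: integral_equations[OF that])
  show "\<Phi> (u, v0) =
      exp ((LBINT t=u0..u. a (t, v0) * (Dv K (t, v0) / (4 * K (t, v0))) - Du K (t, v0) / (4 * K (t, v0))) - logK4 (u0, v0))"
    if u: "(u, v0) \<in> W"
  proof -
    have "(LBINT t=u0..u. canon_u z (t, v0))
        = (LBINT t=u0..u. a (t, v0) * (Dv K (t, v0) / (4 * K (t, v0))) - Du K (t, v0) / (4 * K (t, v0)))"
    proof (rule interval_integral_cong)
      fix t assume "t \<in> einterval (min (ereal u0) (ereal u)) (max (ereal u0) (ereal u))"
      then have "t \<in> {min u0 u..max u0 u}" by (auto simp: einterval_def min_def max_def split: if_splits)
      then have t: "(t, v0) \<in> W" by (rule open_rectangle_segment(1)[OF W(1,2) u])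
      show "canon_u z (t, v0) = a (t, v0) * (Dv K (t, v0) / (4 * K (t, v0))) - Du K (t, v0) / (4 * K (t, v0))"
        using \<Psi>_pos[OF t] by (simp add: canon_eq[OF t] eq[OF t])
    qed
    then show ?thesis by (simp add: integral_equations(1)[OF u] surf_f_eq[OF W(2)])
  qed
  show "\<Psi> (u0, v) =
      exp ((LBINT s=v0..v. - (Dv K (u0, s) / (4 * K (u0, s))) - a (u0, s) * (Du K (u0, s) / (4 * K (u0, s)))) - logK4 (u0, v0))"
    if v: "(u0, v) \<in> W"
  proof -
    have "(LBINT s=v0..v. canon_v z (u0, s))
        = (LBINT s=v0..v. - (Dv K (u0, s) / (4 * K (u0, s))) - a (u0, s) * (Du K (u0, s) / (4 * K (u0, s))))"
    proof (rule interval_integral_cong)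
      fix t assume "t \<in> einterval (min (ereal v0) (ereal v)) (max (ereal v0) (ereal v))"
      then have "t \<in> {min v0 v..max v0 v}" by (auto simp: einterval_def min_def max_def split: if_splits)
      then have t: "(u0, t) \<in> W" by (rule open_rectangle_segment(2)[OF W(1,2) v])
      show "canon_v z (u0, t) = - (Dv K (u0, t) / (4 * K (u0, t))) - a (u0, t) * (Du K (u0, t) / (4 * K (u0, t)))"
        using \<Psi>_pos[OF t] by (simp add: canon_eq[OF t] eq'[OF t])
    qed
    then show ?thesis by (simp add: integral_equations(2)[OF v] surf_f_eq[OF W(2)])
  qed
qed

end

context curvature_data
begin

lemma uniqueness:
  assumes WD: "W \<subseteq> D" and z: "canonical_surface_with_curvatures W u0 v0 K H z"
    and z': "canonical_surface_with_curvatures W u0 v0 K H z'"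
  shows "\<exists>T. motion T \<and> (\<forall>p\<in>W. z' p = T (z p))"
proof -
  interpret S: canonical_surface K H a logK4 D W u0 v0 z by unfold_locales (fact WD z)+
  interpret S': canonical_surface K H a logK4 D W u0 v0 z' by unfold_locales (fact WD z')+
  note W = S.W
  note cK = smooth_K_quotients[THEN smooth_on_continuous, THEN continuous_on_subset, OF WD]
    S.smooth_W(1)[THEN smooth_on_continuous]
  \<comment> \<open>The differences of the two pairs solve the same linear system with zero values
    on the axes. Hence the first fundamental forms agree on all of \<open>W\<close>, and with them
    the connection coefficients.\<close>
  have 0: "S.\<Phi> p - S'.\<Phi> p = 0 \<and> S.\<Psi> p - S'.\<Psi> p = 0" if p: "p \<in> W" for p
  proof -
    have c: "continuous_on W (\<lambda>p. S.\<Phi> p - S'.\<Phi> p)" "continuous_on W (\<lambda>p. S.\<Psi> p - S'.\<Psi> p)"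
      "continuous_on W (\<lambda>p. - (Dv K p / (4 * K p)))" "continuous_on W (\<lambda>p. - (a p * (Du K p / (4 * K p))))"
      "continuous_on W (\<lambda>p. a p * (Dv K p / (4 * K p)))" "continuous_on W (\<lambda>p. - (Du K p / (4 * K p)))"
      by (intro continuous_on_diff continuous_on_mult continuous_on_minus cK
          S.smooth_coefs[THEN smooth_on_continuous] S'.smooth_coefs[THEN smooth_on_continuous])+
    have dv: "((\<lambda>t. S.\<Phi> (u, t) - S'.\<Phi> (u, t)) has_real_derivative - (Dv K (u, v) / (4 * K (u, v))) * (S.\<Phi> (u, v) - S'.\<Phi> (u, v))
      + - (a (u, v) * (Du K (u, v) / (4 * K (u, v)))) * (S.\<Psi> (u, v) - S'.\<Psi> (u, v))) (at v)" if "(u, v) \<in> W" for u v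
      by (rule DERIV_cong[OF DERIV_diff[OF S.goursat_system(1)[OF that] S'.goursat_system(1)[OF that]]]) algebra
    have du: "((\<lambda>t. S.\<Psi> (t, v) - S'.\<Psi> (t, v)) has_real_derivative a (u, v) * (Dv K (u, v) / (4 * K (u, v))) * (S.\<Phi> (u, v) - S'.\<Phi> (u, v))
      + - (Du K (u, v) / (4 * K (u, v))) * (S.\<Psi> (u, v) - S'.\<Psi> (u, v))) (at u)" if "(u, v) \<in> W" for u v
      by (rule DERIV_cong[OF DERIV_diff[OF S.goursat_system(2)[OF that] S'.goursat_system(2)[OF that]]]) algebra
    have ax: "S.\<Phi> (u, v0) - S'.\<Phi> (u, v0) = 0" if "(u, v0) \<in> W" for u
      by (simp add: S.axis_values(1)[OF that] S'.axis_values(1)[OF that])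
    have ax': "S.\<Psi> (u0, v) - S'.\<Psi> (u0, v) = 0" if "(u0, v) \<in> W" for v
      by (simp add: S.axis_values(2)[OF that] S'.axis_values(2)[OF that])
    show ?thesis
      using goursat_uniqueness[OF W(1,2) c dv du ax ax' p] by blast
  qed
  then have eq: "S'.\<Phi> p = S.\<Phi> p" "S'.\<Psi> p = S.\<Psi> p" if "p \<in> W" for p using that by auto
  have D\<Phi>: "Dv S'.\<Phi> p = Dv S.\<Phi> p" "Du (\<lambda>q. S'.\<Psi> q * g q) p = Du (\<lambda>q. S.\<Psi> q * g q) p" if "p \<in> W" for p g
    by (rule Du_Dv_cong[OF W(3) that]; simp add: eq)+
  have con: "con_p S'.\<Phi> S'.\<Psi> p = con_p S.\<Phi> S.\<Psi> p" "con_q S'.\<Phi> S'.\<Psi> p = con_q S.\<Phi> S.\<Psi> p"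
    "con_m S'.\<Phi> S'.\<Psi> p = con_m S.\<Phi> S.\<Psi> p" "con_r S'.\<Phi> S'.\<Psi> p = con_r S.\<Phi> S.\<Psi> p"
    "con_k S'.\<Phi> S'.\<Psi> p = con_k S.\<Phi> S.\<Psi> p" if "p \<in> W" for p
    unfolding con_q_def con_p_def con_k_def con_m_def con_r_def con_M_def eq[OF that] D\<Phi>[OF that] by (rule refl)+
  have s': "Du S'.e1 p = con_p S.\<Phi> S.\<Psi> p *\<^sub>R S'.e2 p"
    "Dv S'.e1 p = con_q S.\<Phi> S.\<Psi> p *\<^sub>R S'.e2 p + con_m S.\<Phi> S.\<Psi> p *\<^sub>R S'.n p"
    "Du S'.e2 p = con_p S.\<Phi> S.\<Psi> p *\<^sub>R S'.e1 p + con_r S.\<Phi> S.\<Psi> p *\<^sub>R S'.n p"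
    "Dv S'.e2 p = con_q S.\<Phi> S.\<Psi> p *\<^sub>R S'.e1 p + con_k S.\<Phi> S.\<Psi> p *\<^sub>R S'.n p"
    "Du S'.n p = con_r S.\<Phi> S.\<Psi> p *\<^sub>R S'.e2 p"
    "Dv S'.n p = con_k S.\<Phi> S.\<Psi> p *\<^sub>R S'.e2 p - con_m S.\<Phi> S.\<Psi> p *\<^sub>R S'.e1 p"
    if "p \<in> W" for p
    by (fact S'.structure_equations[OF that, unfolded con[OF that]])+
  have z': "Du z' p = S.\<Phi> p *\<^sub>R S'.e1 p"
    "Dv z' p = (S.\<Psi> p * a p) *\<^sub>R S'.e1 p + (S.\<Psi> p * w p) *\<^sub>R S'.e2 p" if "p \<in> W" for p
    using S'.frame(2)[OF that] S'.Dv_z[OF that] by (simp_all add: eq[OF that])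
  note d = smooth_on_differentiable
  show ?thesis
    by (rule rigid_motion_of_frames[OF W(3,4,2) d[OF S.smooth_z] d[OF S'.smooth_z]
          d[OF S.smooth_frame(1)] d[OF S.smooth_frame(2)] d[OF S.smooth_frame(3)]
          d[OF S'.smooth_frame(1)] d[OF S'.smooth_frame(2)] d[OF S'.smooth_frame(3)]
          S.frame(1) S'.frame(1)
          S.structure_equations s'
          S.frame(2) S.Dv_z z'])
qed

end

theorem theorem4p5:
  fixes K H a logK4 \<Phi> \<Psi> :: "real \<times> real \<Rightarrow> real"
    and D R :: "(real \<times> real) set"
    and u0 v0 :: real
  assumes D: "open D" "(u0, v0) \<in> D"
    and smooth: "smooth_on D K" "smooth_on D H"
    and pos: "\<And>p. p \<in> D \<Longrightarrow> K p > 0"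
             "\<And>p. p \<in> D \<Longrightarrow> K p - (H p)\<^sup>2 > 0"
    and a: "a = (\<lambda>p. H p / sqrt (K p - (H p)\<^sup>2))"
    and logK4: "logK4 = (\<lambda>p. ln (root 4 (K p)))"
    and R: "open_rectangle R" "(u0, v0) \<in> R" "R \<subseteq> D"
    and smooth_sol: "smooth_on R \<Phi>" "smooth_on R \<Psi>"
    and pos_sol: "\<And>p. p \<in> R \<Longrightarrow> \<Phi> p > 0" "\<And>p. p \<in> R \<Longrightarrow> \<Psi> p > 0"
    and pde: "\<And>p. p \<in> R \<Longrightarrow> Dv \<Phi> p = - (1 / (4 * K p)) * (Dv K p * \<Phi> p + a p * Du K p * \<Psi> p)"
             "\<And>p. p \<in> R \<Longrightarrow> Du \<Psi> p = (1 / (4 * K p)) * (a p * Dv K p * \<Phi> p - Du K p * \<Psi> p)"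
    and initial:
      "\<And>u. (u, v0) \<in> R \<Longrightarrow> \<Phi> (u, v0) =
         exp ((LBINT t=u0..u. a (t, v0) * Dv logK4 (t, v0) - Du logK4 (t, v0)) - logK4 (u0, v0))"
      "\<And>v. (u0, v) \<in> R \<Longrightarrow> \<Psi> (u0, v) =
         exp ((LBINT s=v0..v. - Dv logK4 (u0, s) - a (u0, s) * Du logK4 (u0, s)) - logK4 (u0, v0))"
    and gauss_eq: "\<And>p. p \<in> R \<Longrightarrow>
        1 / (\<Phi> p * \<Psi> p) *
          (Dv (Du a) p / (1 + (a p)\<^sup>2) - a p * Du a p * Dv a p / (1 + (a p)\<^sup>2)\<^sup>2
            - a p * Du K p * Dv K p / (8 * (K p)\<^sup>2))
        - a p * Du a p * Du K p / (4 * (1 + (a p)\<^sup>2) * K p * (\<Phi> p)\<^sup>2)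
        + a p * Dv a p * Dv K p / (4 * (1 + (a p)\<^sup>2) * K p * (\<Psi> p)\<^sup>2)
        + (Du K p)\<^sup>2 / (16 * (\<Phi> p)\<^sup>2 * (K p)\<^sup>2)
        - (Dv K p)\<^sup>2 / (16 * (\<Psi> p)\<^sup>2 * (K p)\<^sup>2)
        - 1 / (4 * \<Phi> p) * Du (\<lambda>q. Du K q / (\<Phi> q * K q)) p
        + 1 / (4 * \<Psi> p) * Dv (\<lambda>q. Dv K q / (\<Psi> q * K q)) p
        + K p = 0"
  shows "(\<exists>W z. W \<subseteq> D \<and> canonical_surface_with_curvatures W u0 v0 K H z)
    \<and> (\<forall>W z z'. W \<subseteq> D \<and> canonical_surface_with_curvatures W u0 v0 K H z
          \<and> canonical_surface_with_curvatures W u0 v0 K H z'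
        \<longrightarrow> (\<exists>T. motion T \<and> (\<forall>p\<in>W. z' p = T (z p))))"
proof -
  interpret goursat_solution K H a logK4 D \<Phi> \<Psi> R u0 v0
    by unfold_locales (fact assms)+
  show ?thesis using existence uniqueness by blast
qed

end
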